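(* Let $R$ be a commutative ring with unity and let $C$ be a semidualizing $R$-module. If $R$ is $G_C$-hereditary, then $R$ is coherent.
   Context: $R$ is a commutative ring with unity, and all modules are $R$-modules. An $R$-module $C$ is semidualizing if (1) $C$ admits a degreewise finite projective resolution (a resolution by finitely generated projective modules), (2) the natural homothety map $R\to\operatorname{Hom}_R(C,C)$ is an isomorphism, and (3) $\operatorname{Ext}^i_R(C,C)=0$ for all $i\ge 1$. An $R$-module $M$ is $G_C$-projective if there exists an exact sequence of $R$-modules $\mathbb{X}=\cdots\to P_1\to P_0\to C\otimes_R P_{-1}\to C\otimes_R P_{-2}\to\cdots$ with all $P_i$ projective, such that $M\cong\operatorname{Im}(P_0\to C\otimes_R P_{-1})$ and $\operatorname{Hom}_R(\mathbb{X},C\otimes_R P)$ is exact for every projective $R$-module $P$. $R$ is called $G_C$-hereditary ($C$-Gorenstein hereditary) if every submodule of a projective $R$-module is $G_C$-projective. $R$ is coherent if every finitely generated ideal of $R$ is finitely presented. *)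

theory Defs
  imports "HOL-Algebra.Module" "HOL-Algebra.QuotRing"
begin

text \<open>
  Modules are the \<^typ>\<open>('a, 'b) module\<close> records of HOL-Algebra over a ring \<open>R\<close> with carrier
  type \<^typ>\<open>'a\<close>; their fields \<^const>\<open>mult\<close> and \<^const>\<open>one\<close> carry no meaning and are left
  unspecified in the constructions below.

  HOL cannot quantify over types inside a formula, so "all modules" and "there are modules" refer
  to modules whose elements are taken from a type of the form \<^typ>\<open>('a + 'u) list\<close>. Such a type is
  infinite and contains copies of \<^typ>\<open>'a\<close> and \<^typ>\<open>'u\<close>; up to isomorphism it accommodates
  every module of cardinality at most \<open>max(|'a|, |'u|, \<aleph>)\<close>, where \<open>\<aleph>\<close> is the first infinite
  cardinal, including the free modules with bases of that size. Since \<^typ>\<open>'u\<close> remains a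
  free type variable, there is no bound on the cardinality.
\<close>

section \<open>Module homomorphisms, submodules and quotients\<close>

text \<open>Homomorphisms are undefined outside the carrier, so that equality of homomorphisms is
  equality of functions.\<close>

definition mod_hom ::
  "('a, 'r) ring_scheme \<Rightarrow> ('a, 'b) module \<Rightarrow> ('a, 'c) module \<Rightarrow> ('b \<Rightarrow> 'c) set"
  where "mod_hom R M N =
    {f \<in> carrier M \<rightarrow>\<^sub>E carrier N.
       (\<forall>x\<in>carrier M. \<forall>y\<in>carrier M. f (x \<oplus>\<^bsub>M\<^esub> y) = f x \<oplus>\<^bsub>N\<^esub> f y) \<and>
       (\<forall>r\<in>carrier R. \<forall>x\<in>carrier M. f (r \<odot>\<^bsub>M\<^esub> x) = r \<odot>\<^bsub>N\<^esub> f x)}"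

definition mod_iso ::
  "('a, 'r) ring_scheme \<Rightarrow> ('a, 'b) module \<Rightarrow> ('a, 'c) module \<Rightarrow> ('b \<Rightarrow> 'c) set"
  where "mod_iso R M N = {f \<in> mod_hom R M N. bij_betw f (carrier M) (carrier N)}"

definition mod_isomorphic ::
  "('a, 'r) ring_scheme \<Rightarrow> ('a, 'b) module \<Rightarrow> ('a, 'c) module \<Rightarrow> bool"
  where "mod_isomorphic R M N \<longleftrightarrow> mod_iso R M N \<noteq> {}"

definition mod_span :: "('a, 'r) ring_scheme \<Rightarrow> ('a, 'b) module \<Rightarrow> 'b set \<Rightarrow> 'b set"
  where "mod_span R M S = \<Inter>{N. submodule N R M \<and> S \<subseteq> N}"

definition fin_gen :: "('a, 'r) ring_scheme \<Rightarrow> ('a, 'b) module \<Rightarrow> bool"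
  where "fin_gen R M \<longleftrightarrow> (\<exists>S. finite S \<and> S \<subseteq> carrier M \<and> mod_span R M S = carrier M)"

definition quot_mod :: "('a, 'b) module \<Rightarrow> 'b set \<Rightarrow> ('a, 'b set) module"
  where "quot_mod M N =
    \<lparr>carrier = a_rcosets\<^bsub>M\<^esub> N, mult = undefined, one = undefined,
     zero = N, add = set_add M,
     smult = (\<lambda>r A. \<Union>x\<in>A. N +>\<^bsub>M\<^esub> (r \<odot>\<^bsub>M\<^esub> x))\<rparr>"

definition Hom_mod ::
  "('a, 'r) ring_scheme \<Rightarrow> ('a, 'b) module \<Rightarrow> ('a, 'c) module \<Rightarrow> ('a, 'b \<Rightarrow> 'c) module"
  where "Hom_mod R M N =
    \<lparr>carrier = mod_hom R M N, mult = undefined, one = undefined,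
     zero = (\<lambda>x\<in>carrier M. \<zero>\<^bsub>N\<^esub>),
     add = (\<lambda>f g. \<lambda>x\<in>carrier M. f x \<oplus>\<^bsub>N\<^esub> g x),
     smult = (\<lambda>r f. \<lambda>x\<in>carrier M. r \<odot>\<^bsub>N\<^esub> f x)\<rparr>"

text \<open>The map \<open>Hom(f, W) : Hom(B, W) \<rightarrow> Hom(A, W)\<close> for \<open>f : A \<rightarrow> B\<close>.\<close>

definition Hom_map ::
  "('a, 'r) ring_scheme \<Rightarrow> ('a, 'b) module \<Rightarrow> ('a, 'c) module \<Rightarrow> ('a, 'd) module
     \<Rightarrow> ('b \<Rightarrow> 'c) \<Rightarrow> ('c \<Rightarrow> 'd) \<Rightarrow> ('b \<Rightarrow> 'd)"
  where "Hom_map R A B W f = (\<lambda>\<phi>\<in>mod_hom R B W. \<lambda>x\<in>carrier A. \<phi> (f x))"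

text \<open>Exactness of \<open>A \<rightarrow> B \<rightarrow> D\<close> at \<open>B\<close>.\<close>

definition exact_at ::
  "('a, 'r) ring_scheme \<Rightarrow> ('a, 'b) module \<Rightarrow> ('b \<Rightarrow> 'c) \<Rightarrow> ('a, 'c) module \<Rightarrow> ('c \<Rightarrow> 'd)
     \<Rightarrow> ('a, 'd) module \<Rightarrow> bool"
  where "exact_at R A f B g D \<longleftrightarrow>
    f \<in> mod_hom R A B \<and> g \<in> mod_hom R B D \<and>
    f ` carrier A = {b \<in> carrier B. g b = \<zero>\<^bsub>D\<^esub>}"

section \<open>Free, projective and finitely presented modules\<close>

definition self_mod :: "('a, 'r) ring_scheme \<Rightarrow> ('a, 'a) module"
  where "self_mod R =
    \<lparr>carrier = carrier R, mult = mult R, one = \<one>\<^bsub>R\<^esub>, zero = \<zero>\<^bsub>R\<^esub>, add = add R, smult = mult R\<rparr>"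

text \<open>The free module \<open>R\<^sup>(\<^sup>X\<^sup>)\<close>: functions of finite support contained in \<open>X\<close>.\<close>

definition free_mod :: "('a, 'r) ring_scheme \<Rightarrow> 'i set \<Rightarrow> ('a, 'i \<Rightarrow> 'a) module"
  where "free_mod R X =
    \<lparr>carrier = {f. range f \<subseteq> carrier R \<and> (\<forall>x. x \<notin> X \<longrightarrow> f x = \<zero>\<^bsub>R\<^esub>) \<and> finite {x. f x \<noteq> \<zero>\<^bsub>R\<^esub>}},
     mult = undefined, one = undefined,
     zero = (\<lambda>x. \<zero>\<^bsub>R\<^esub>),
     add = (\<lambda>f g x. f x \<oplus>\<^bsub>R\<^esub> g x),
     smult = (\<lambda>r f x. r \<otimes>\<^bsub>R\<^esub> f x)\<rparr>"

definition free_gen :: "('a, 'r) ring_scheme \<Rightarrow> 'i \<Rightarrow> 'i \<Rightarrow> 'a"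
  where "free_gen R x = (\<lambda>y. if y = x then \<one>\<^bsub>R\<^esub> else \<zero>\<^bsub>R\<^esub>)"

text \<open>Projective modules are the direct summands of free modules. A basis inside the type of the
  elements of \<open>P\<close> is enough, because \<open>P\<close> is a quotient of the free module on its own carrier.\<close>

definition projective :: "('a, 'r) ring_scheme \<Rightarrow> ('a, 'b) module \<Rightarrow> bool"
  where "projective R P \<longleftrightarrow>
    module R P \<and>
    (\<exists>(X :: 'b set) i p. i \<in> mod_hom R P (free_mod R X) \<and> p \<in> mod_hom R (free_mod R X) P \<and>
       (\<forall>x\<in>carrier P. p (i x) = x))"

definition fin_presented :: "('a, 'r) ring_scheme \<Rightarrow> ('a, 'b) module \<Rightarrow> bool"
  where "fin_presented R M \<longleftrightarrow>
    (\<exists>(n :: nat) p. p \<in> mod_hom R (free_mod R {..<n}) M \<and>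
       p ` carrier (free_mod R {..<n}) = carrier M \<and>
       fin_gen R ((free_mod R {..<n})
         \<lparr>carrier := {x \<in> carrier (free_mod R {..<n}). p x = \<zero>\<^bsub>M\<^esub>}\<rparr>))"

definition coherent_ring :: "('a, 'r) ring_scheme \<Rightarrow> bool"
  where "coherent_ring R \<longleftrightarrow>
    (\<forall>S. finite S \<and> S \<subseteq> carrier R \<longrightarrow>
       fin_presented R ((self_mod R)\<lparr>carrier := Idl\<^bsub>R\<^esub> S\<rparr>))"

section \<open>Tensor products\<close>

text \<open>The quotient of the free module on \<open>M \<times> N\<close> by the bilinearity relations.\<close>

definition tensor_rels ::
  "('a, 'r) ring_scheme \<Rightarrow> ('a, 'b) module \<Rightarrow> ('a, 'c) module \<Rightarrow> ('b \<times> 'c \<Rightarrow> 'a) set"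
  where "tensor_rels R M N =
   (let F = free_mod R (carrier M \<times> carrier N); e = (\<lambda>x y. free_gen R (x, y)) in
      {e (x \<oplus>\<^bsub>M\<^esub> x') y \<ominus>\<^bsub>F\<^esub> (e x y \<oplus>\<^bsub>F\<^esub> e x' y) | x x' y.
         x \<in> carrier M \<and> x' \<in> carrier M \<and> y \<in> carrier N} \<union>
      {e x (y \<oplus>\<^bsub>N\<^esub> y') \<ominus>\<^bsub>F\<^esub> (e x y \<oplus>\<^bsub>F\<^esub> e x y') | x y y'.
         x \<in> carrier M \<and> y \<in> carrier N \<and> y' \<in> carrier N} \<union>
      {e (r \<odot>\<^bsub>M\<^esub> x) y \<ominus>\<^bsub>F\<^esub> (r \<odot>\<^bsub>F\<^esub> e x y) | r x y.
         r \<in> carrier R \<and> x \<in> carrier M \<and> y \<in> carrier N} \<union>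
      {e x (r \<odot>\<^bsub>N\<^esub> y) \<ominus>\<^bsub>F\<^esub> (r \<odot>\<^bsub>F\<^esub> e x y) | r x y.
         r \<in> carrier R \<and> x \<in> carrier M \<and> y \<in> carrier N})"

definition tensor ::
  "('a, 'r) ring_scheme \<Rightarrow> ('a, 'b) module \<Rightarrow> ('a, 'c) module \<Rightarrow> ('a, ('b \<times> 'c \<Rightarrow> 'a) set) module"
  where "tensor R M N =
    (let F = free_mod R (carrier M \<times> carrier N) in quot_mod F (mod_span R F (tensor_rels R M N)))"

section \<open>Projective resolutions and Ext\<close>

text \<open>The differential \<open>d n\<close> goes from \<open>F (n + 1)\<close> to \<open>F n\<close>, and \<open>\<epsilon>\<close> from \<open>F 0\<close> to \<open>M\<close>.\<close>

definition projective_resolution ::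
  "('a, 'r) ring_scheme \<Rightarrow> ('a, 'b) module \<Rightarrow> (nat \<Rightarrow> ('a, 'x) module) \<Rightarrow> (nat \<Rightarrow> 'x \<Rightarrow> 'x)
     \<Rightarrow> ('x \<Rightarrow> 'b) \<Rightarrow> bool"
  where "projective_resolution R M F d \<epsilon> \<longleftrightarrow>
    (\<forall>n. projective R (F n)) \<and>
    \<epsilon> ` carrier (F 0) = carrier M \<and>
    exact_at R (F 1) (d 0) (F 0) \<epsilon> M \<and>
    (\<forall>n. exact_at R (F (n + 2)) (d (n + 1)) (F (n + 1)) (d n) (F n))"

definition cocycles ::
  "('a, 'r) ring_scheme \<Rightarrow> (nat \<Rightarrow> ('a, 'x) module) \<Rightarrow> (nat \<Rightarrow> 'x \<Rightarrow> 'x) \<Rightarrow> ('a, 'c) module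
     \<Rightarrow> nat \<Rightarrow> ('x \<Rightarrow> 'c) set"
  where "cocycles R F d N n =
    {f \<in> mod_hom R (F n) N.
       Hom_map R (F (n + 1)) (F n) N (d n) f = \<zero>\<^bsub>Hom_mod R (F (n + 1)) N\<^esub>}"

definition coboundaries ::
  "('a, 'r) ring_scheme \<Rightarrow> (nat \<Rightarrow> ('a, 'x) module) \<Rightarrow> (nat \<Rightarrow> 'x \<Rightarrow> 'x) \<Rightarrow> ('a, 'c) module
     \<Rightarrow> nat \<Rightarrow> ('x \<Rightarrow> 'c) set"
  where "coboundaries R F d N n =
    (case n of 0 \<Rightarrow> {\<zero>\<^bsub>Hom_mod R (F 0) N\<^esub>}
     | Suc k \<Rightarrow> Hom_map R (F (Suc k)) (F k) N (d k) ` mod_hom R (F k) N)"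

text \<open>\<open>Ext\<^sup>n(M, N)\<close> is the cohomology of \<open>Hom(F, N)\<close> for a chosen projective resolution \<open>F\<close> of \<open>M\<close>;
  as usual, it depends on the choice only up to isomorphism. Every \<open>M\<close> has a (free) resolution by
  modules with elements in \<^typ>\<open>('a + 'b) list\<close>.\<close>

definition Ext ::
  "('a, 'r) ring_scheme \<Rightarrow> ('a, 'b) module \<Rightarrow> ('a, 'c) module \<Rightarrow> nat
     \<Rightarrow> ('a, (('a + 'b) list \<Rightarrow> 'c) set) module"
  where "Ext R M N n =
    (let (F, d, \<epsilon>) = (SOME (F :: nat \<Rightarrow> ('a, ('a + 'b) list) module, d, \<epsilon>).
                        projective_resolution R M F d \<epsilon>)
     in quot_mod ((Hom_mod R (F n) N)\<lparr>carrier := cocycles R F d N n\<rparr>) (coboundaries R F d N n))"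

section \<open>Semidualizing modules and \<open>G\<^sub>C\<close>-projective modules\<close>

definition homothety :: "('a, 'r) ring_scheme \<Rightarrow> ('a, 'c) module \<Rightarrow> 'a \<Rightarrow> 'c \<Rightarrow> 'c"
  where "homothety R C = (\<lambda>r\<in>carrier R. \<lambda>x\<in>carrier C. r \<odot>\<^bsub>C\<^esub> x)"

text \<open>Every finitely generated module is isomorphic to one with elements in
  \<^typ>\<open>('a + 'c) list\<close>, so fixing this type does not restrict the degreewise finite resolutions.\<close>

definition semidualizing :: "('a, 'r) ring_scheme \<Rightarrow> ('a, 'c) module \<Rightarrow> bool"
  where "semidualizing R C \<longleftrightarrow>
    module R C \<and>
    (\<exists>(F :: nat \<Rightarrow> ('a, ('a + 'c) list) module) d \<epsilon>.
       projective_resolution R C F d \<epsilon> \<and> (\<forall>n. fin_gen R (F n))) \<and>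
    homothety R C \<in> mod_iso R (self_mod R) (Hom_mod R C C) \<and>
    (\<forall>i\<ge>1. carrier (Ext R C C i) = {\<zero>\<^bsub>Ext R C C i\<^esub>})"

text \<open>
  The complex \<open>\<dots> \<rightarrow> P\<^sub>1 \<rightarrow> P\<^sub>0 \<rightarrow> C \<otimes> P\<^sub>-\<^sub>1 \<rightarrow> C \<otimes> P\<^sub>-\<^sub>2 \<rightarrow> \<dots>\<close> is \<open>X\<close>, indexed by the integers, with
  differentials \<open>d n : X n \<rightarrow> X (n - 1)\<close>. For negative \<open>n\<close> the term \<open>X n\<close> is a module isomorphic to
  \<open>C \<otimes> P\<close> rather than the tensor product itself, so that all terms have the same type. The type
  argument gives the size of the modules that may occur in the complex. Testing exactness
  with projective modules \<open>P\<close> of this size is enough for a semidualizing \<open>C\<close>: \<open>P\<close> may be taken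
  free, \<open>C\<close> is finitely generated, and so the image of a homomorphism \<open>X n \<rightarrow> C \<otimes> P\<close> lies in
  \<open>C \<otimes> P'\<close> for a free summand \<open>P'\<close> of \<open>P\<close> of this size.
\<close>

definition GC_projective ::
  "'x itself \<Rightarrow> ('a, 'r) ring_scheme \<Rightarrow> ('a, 'c) module \<Rightarrow> ('a, 'b) module \<Rightarrow> bool"
  where "GC_projective T R C M \<longleftrightarrow>
    (\<exists>(X :: int \<Rightarrow> ('a, ('a + 'x) list) module) d.
       (\<forall>n. module R (X n)) \<and>
       (\<forall>n\<ge>0. projective R (X n)) \<and>
       (\<forall>n<0. \<exists>P :: ('a, ('a + 'x) list) module.
          projective R P \<and> mod_isomorphic R (X n) (tensor R C P)) \<and>
       (\<forall>n. exact_at R (X (n + 1)) (d (n + 1)) (X n) (d n) (X (n - 1))) \<and>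
       mod_isomorphic R M ((X (-1))\<lparr>carrier := d 0 ` carrier (X 0)\<rparr>) \<and>
       (\<forall>P :: ('a, ('a + 'x) list) module. projective R P \<longrightarrow>
          (\<forall>n. exact_at R
             (Hom_mod R (X (n - 1)) (tensor R C P))
             (Hom_map R (X n) (X (n - 1)) (tensor R C P) (d n))
             (Hom_mod R (X n) (tensor R C P))
             (Hom_map R (X (n + 1)) (X n) (tensor R C P) (d (n + 1)))
             (Hom_mod R (X (n + 1)) (tensor R C P)))))"

text \<open>
  The size of the projective modules \<open>P\<close> and that of the complexes are governed by two independent
  type arguments. If every submodule of every projective module is \<open>G\<^sub>C\<close>-projective, then for each
  choice of \<^typ>\<open>'p\<close> this property holds as soon as \<^typ>\<open>'x\<close> is large enough, since up to
  isomorphism only a set of submodules is involved.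
\<close>

definition GC_hereditary ::
  "'p itself \<Rightarrow> 'x itself \<Rightarrow> ('a, 'r) ring_scheme \<Rightarrow> ('a, 'c) module \<Rightarrow> bool"
  where "GC_hereditary TP TX R C \<longleftrightarrow>
    (\<forall>P :: ('a, ('a + 'p) list) module. projective R P \<longrightarrow>
       (\<forall>N. submodule N R P \<longrightarrow> GC_projective TX R C (P\<lparr>carrier := N\<rparr>)))"

end

theory Submission
  imports Defs
begin

text \<open>
  Let \<open>I\<close> be an ideal generated by \<open>n\<close> elements, \<open>K \<subseteq> R\<^sup>n\<close> its module of relations,
  \<open>J = Hom(I, C) \<subseteq> C\<^sup>n\<close> and \<open>H = C\<^sup>n / J\<close>. A \<open>G\<^sub>C\<close>-projective module embeds in some \<open>C \<otimes> P\<close>,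
  so \<open>I\<close> is separated by its maps to \<open>C\<close>, and since \<open>R = Hom(C, C)\<close> this gives \<open>K \<cong> Hom(H, C)\<close>. It
  remains to show that \<open>Hom(H, C)\<close> is finitely generated.

  Being finitely generated and \<open>G\<^sub>C\<close>-projective, \<open>I\<close> is also reflexive with respect to \<open>C\<close>, and \<open>J\<close> is
  finitely generated. So \<open>H\<close> is finitely presented; let \<open>F \<rightarrow> H\<close> be a presentation by a finite free
  module, with kernel \<open>KH\<close>. Reflexivity and \<open>Ext\<^sup>1(C, C) = 0\<close> show that all maps \<open>KH \<rightarrow> C\<close> extend
  to \<open>F\<close>, that is, \<open>Ext\<^sup>1(H, C) = 0\<close>. Now \<open>KH\<close> is \<open>G\<^sub>C\<close>-projective, so it starts a coresolution
  \<open>KH \<rightarrow> W \<rightarrow> W'\<close> by modules of the form \<open>C \<otimes> P\<close>. The extension of \<open>KH \<rightarrow> W\<close> to \<open>F\<close> makes \<open>H\<close> a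
  direct summand of the pushout of \<open>F\<close> and \<open>W\<close> over \<open>KH\<close>, whose maps to \<open>C\<close> are controlled by those of
  \<open>F\<close> and \<open>W'\<close>; hence finitely many maps generate \<open>Hom(H, C)\<close>.
\<close>

text \<open>As a submodule of R^n, K is G_C-projective, but this bounds no number of generators.
  Finiteness lives on the dual side: a map from a finitely generated M into a sum of copies of C
  meets finitely many coordinates, and since R = Hom(C, C), every map M -> C that extends to the sum
  is an R-combination of these coordinates. K is read off from there: r in R^n gives the map sum r_k
  c_k on C^n, whose value at the point (g (a_k)) of J is g (sum r_k a_k), so it kills J exactly when
  all maps I -> C kill sum r_k a_k. The hypothesis reaches only submodules of projective modules. It
  applies to I in R and to KH in a finite free module, while H is a quotient and is reached through
  KH; hence Ext^1(H, C) = 0 has to be proved by hand. Neither H nor the pushout is built: maps H ->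
  C are treated as maps F -> C that vanish on KH, and the splitting becomes a correction. From a
  generator of Hom(F, C) one subtracts the extension, through W, of its restriction to KH; what is
  left of a map vanishing on KH factors through W'.\<close>

section \<open>Linear maps\<close>

text \<open>Unlike the elements of \<open>mod_hom\<close>, these maps are not required to be undefined outside the
  carrier, so that they compose as functions.\<close>

definition lin ::
  "('a, 'r) ring_scheme \<Rightarrow> ('a, 'b) module \<Rightarrow> ('a, 'c) module \<Rightarrow> ('b \<Rightarrow> 'c) \<Rightarrow> bool"
  where "lin R M N f \<longleftrightarrow>
    f \<in> carrier M \<rightarrow> carrier N \<and>
    (\<forall>x\<in>carrier M. \<forall>y\<in>carrier M. f (x \<oplus>\<^bsub>M\<^esub> y) = f x \<oplus>\<^bsub>N\<^esub> f y) \<and>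
    (\<forall>r\<in>carrier R. \<forall>x\<in>carrier M. f (r \<odot>\<^bsub>M\<^esub> x) = r \<odot>\<^bsub>N\<^esub> f x)"

lemma linI:
  assumes "\<And>x. x \<in> carrier M \<Longrightarrow> f x \<in> carrier N"
    and "\<And>x y. x \<in> carrier M \<Longrightarrow> y \<in> carrier M \<Longrightarrow> f (x \<oplus>\<^bsub>M\<^esub> y) = f x \<oplus>\<^bsub>N\<^esub> f y"
    and "\<And>r x. r \<in> carrier R \<Longrightarrow> x \<in> carrier M \<Longrightarrow> f (r \<odot>\<^bsub>M\<^esub> x) = r \<odot>\<^bsub>N\<^esub> f x"
  shows "lin R M N f"
  using assms by (auto simp: lin_def)

lemma lin_closed: "lin R M N f \<Longrightarrow> x \<in> carrier M \<Longrightarrow> f x \<in> carrier N"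
  by (auto simp: lin_def)

lemma lin_add:
  "lin R M N f \<Longrightarrow> x \<in> carrier M \<Longrightarrow> y \<in> carrier M \<Longrightarrow> f (x \<oplus>\<^bsub>M\<^esub> y) = f x \<oplus>\<^bsub>N\<^esub> f y"
  by (auto simp: lin_def)

lemma lin_smult:
  "lin R M N f \<Longrightarrow> r \<in> carrier R \<Longrightarrow> x \<in> carrier M \<Longrightarrow> f (r \<odot>\<^bsub>M\<^esub> x) = r \<odot>\<^bsub>N\<^esub> f x"
  by (auto simp: lin_def)

lemma mod_hom_lin: "f \<in> mod_hom R M N \<Longrightarrow> lin R M N f"
  by (auto simp: lin_def mod_hom_def)

lemma lin_restrict:
  assumes "lin R M N f" "module R M"
  shows "restrict f (carrier M) \<in> mod_hom R M N"
proof -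
  interpret M: module R M by fact
  show ?thesis using assms(1) by (auto simp: lin_def mod_hom_def)
qed

lemma lin_cong:
  assumes "lin R M N f" "module R M" "\<And>x. x \<in> carrier M \<Longrightarrow> g x = f x"
  shows "lin R M N g"
proof -
  interpret M: module R M by fact
  show ?thesis using assms(1,3) by (auto simp: lin_def)
qed

lemma lin_comp: "lin R M N f \<Longrightarrow> lin R N P g \<Longrightarrow> lin R M P (\<lambda>x. g (f x))"
  by (auto simp: lin_def Pi_iff)

lemma lin_sub: "lin R M N f \<Longrightarrow> H \<subseteq> carrier M \<Longrightarrow> lin R (M\<lparr>carrier := H\<rparr>) N f"
  by (auto simp: lin_def Pi_iff subset_iff)

lemma lin_id_sub: "H \<subseteq> carrier M \<Longrightarrow> lin R (M\<lparr>carrier := H\<rparr>) M (\<lambda>x. x)"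
  by (auto simp: lin_def)

lemma lin_id: "lin R M M (\<lambda>x. x)"
  by (auto simp: lin_def)

lemma lin_zero:
  assumes "lin R M N f" "module R M" "module R N"
  shows "f \<zero>\<^bsub>M\<^esub> = \<zero>\<^bsub>N\<^esub>"
proof -
  interpret M: module R M by fact
  interpret N: module R N by fact
  have "f (\<zero>\<^bsub>R\<^esub> \<odot>\<^bsub>M\<^esub> \<zero>\<^bsub>M\<^esub>) = \<zero>\<^bsub>R\<^esub> \<odot>\<^bsub>N\<^esub> f \<zero>\<^bsub>M\<^esub>"
    by (rule lin_smult[OF assms(1)]) auto
  then show ?thesis using lin_closed[OF assms(1)] by simp
qed

lemma lin_neg:
  assumes "lin R M N f" "module R M" "module R N" "x \<in> carrier M"
  shows "f (\<ominus>\<^bsub>M\<^esub> x) = \<ominus>\<^bsub>N\<^esub> f x"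
proof -
  interpret M: module R M by fact
  interpret N: module R N by fact
  have "f ((\<ominus>\<^bsub>R\<^esub> \<one>\<^bsub>R\<^esub>) \<odot>\<^bsub>M\<^esub> x) = (\<ominus>\<^bsub>R\<^esub> \<one>\<^bsub>R\<^esub>) \<odot>\<^bsub>N\<^esub> f x"
    using assms by (simp add: lin_smult)
  then show ?thesis using lin_closed[OF assms(1,4)] assms(4)
    by (simp add: M.smult_l_minus N.smult_l_minus)
qed

lemma lin_minus:
  assumes "lin R M N f" "module R M" "module R N" "x \<in> carrier M" "y \<in> carrier M"
  shows "f (x \<ominus>\<^bsub>M\<^esub> y) = f x \<ominus>\<^bsub>N\<^esub> f y"
proof -
  interpret M: module R M by fact
  show ?thesis using assms by (simp add: a_minus_def lin_add lin_neg)
qed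

lemma lin_finsum:
  assumes "lin R M N f" "module R M" "module R N" "g \<in> A \<rightarrow> carrier M"
  shows "f (finsum M g A) = finsum N (\<lambda>i. f (g i)) A"
proof (cases "finite A")
  case True
  interpret M: module R M by fact
  interpret N: module R N by fact
  from True assms(4) show ?thesis
  proof (induction A rule: finite_induct)
    case empty then show ?case using lin_zero[OF assms(1-3)] by simp
  next
    case (insert a A)
    then have "g \<in> A \<rightarrow> carrier M" "g a \<in> carrier M" by auto
    then show ?case using insert assms(1)
      by (simp add: lin_add[OF assms(1)] lin_closed Pi_iff)
  qed
next
  case False
  interpret M: module R M by fact
  interpret N: module R N by fact
  show ?thesis using False lin_zero[OF assms(1-3)] by (simp add: M.M.finsum_infinite N.M.finsum_infinite)
qed

lemma lin_addf:
  assumes "lin R M N f" "lin R M N g" "module R M" "module R N"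
  shows "lin R M N (\<lambda>x. f x \<oplus>\<^bsub>N\<^esub> g x)"
proof -
  interpret M: module R M by fact
  interpret N: module R N by fact
  show ?thesis using assms(1,2)
    by (intro linI) (simp_all add: lin_closed lin_add lin_smult N.smult_r_distr N.M.a_ac)
qed

lemma lin_smultf:
  assumes "lin R M N f" "r \<in> carrier R" "module R M" "module R N"
  shows "lin R M N (\<lambda>x. r \<odot>\<^bsub>N\<^esub> f x)"
proof -
  interpret M: module R M by fact
  interpret N: module R N by fact
  show ?thesis using assms(1,2)
    by (intro linI)
      (simp_all add: lin_closed lin_add lin_smult N.smult_r_distr N.smult_assoc1[symmetric] M.R.m_comm)
qed

lemma lin_negf:
  assumes "lin R M N f" "module R M" "module R N"
  shows "lin R M N (\<lambda>x. \<ominus>\<^bsub>N\<^esub> f x)"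
proof -
  interpret M: module R M by fact
  interpret N: module R N by fact
  have "lin R M N (\<lambda>x. (\<ominus>\<^bsub>R\<^esub> \<one>\<^bsub>R\<^esub>) \<odot>\<^bsub>N\<^esub> f x)"
    by (rule lin_smultf) (use assms in auto)
  then show ?thesis
    by (rule lin_cong[OF _ assms(2)]) (use assms in \<open>simp add: lin_closed N.smult_l_minus\<close>)
qed

lemma lin_minusf:
  assumes "lin R M N f" "lin R M N g" "module R M" "module R N"
  shows "lin R M N (\<lambda>x. f x \<ominus>\<^bsub>N\<^esub> g x)"
  unfolding a_minus_def using lin_addf[OF assms(1) lin_negf] assms by blast

lemma lin_zerof:
  assumes "module R M" "module R N"
  shows "lin R M N (\<lambda>x. \<zero>\<^bsub>N\<^esub>)"
proof -
  interpret M: module R M by fact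
  interpret N: module R N by fact
  show ?thesis by (intro linI) auto
qed

lemma lin_finsumf:
  assumes "\<And>i. i \<in> A \<Longrightarrow> lin R M N (f i)" "module R M" "module R N"
  shows "lin R M N (\<lambda>x. finsum N (\<lambda>i. f i x) A)"
proof (cases "finite A")
  case True
  interpret M: module R M by fact
  interpret N: module R N by fact
  from True assms(1) show ?thesis
  proof (induction A rule: finite_induct)
    case empty then show ?case using lin_zerof assms(2,3) by simp
  next
    case (insert a A)
    have l: "lin R M N (\<lambda>x. f a x \<oplus>\<^bsub>N\<^esub> finsum N (\<lambda>i. f i x) A)"
      by (rule lin_addf) (use insert assms(2,3) in auto)
    show ?case
    proof (rule lin_cong[OF l assms(2)])
      fix x assume "x \<in> carrier M"
      then have "f i x \<in> carrier N" if "i \<in> insert a A" for i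
        using lin_closed[OF insert.prems[OF that]] by blast
      then show "finsum N (\<lambda>i. f i x) (insert a A) = f a x \<oplus>\<^bsub>N\<^esub> finsum N (\<lambda>i. f i x) A"
        by (intro N.M.finsum_insert) (use insert.hyps in auto)
    qed
  qed
next
  case False
  interpret N: module R N by fact
  show ?thesis using False lin_zerof[OF assms(2,3)] by (simp add: N.M.finsum_infinite)
qed

lemma smult_lin:
  assumes "module R M" "r \<in> carrier R"
  shows "lin R M M (\<lambda>x. r \<odot>\<^bsub>M\<^esub> x)"
  by (rule lin_smultf[OF lin_id]) (use assms in auto)

lemma minus_zero_iff:
  assumes "module R M" "x \<in> carrier M" "y \<in> carrier M"
  shows "x \<ominus>\<^bsub>M\<^esub> y = \<zero>\<^bsub>M\<^esub> \<longleftrightarrow> x = y"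
proof -
  interpret M: module R M by fact
  show ?thesis
  proof
    assume "x \<ominus>\<^bsub>M\<^esub> y = \<zero>\<^bsub>M\<^esub>"
    then have "\<ominus>\<^bsub>M\<^esub> (\<ominus>\<^bsub>M\<^esub> y) = x"
      by (intro M.M.minus_equality) (use assms in \<open>simp_all add: a_minus_def\<close>)
    then show "x = y" using assms by simp
  qed (use assms in \<open>simp add: a_minus_def M.M.r_neg\<close>)
qed

section \<open>Submodules and generators\<close>

text \<open>Closure under negatives comes from the scalar -1.\<close>

lemma submodule_intro:
  assumes "module R M" "H \<subseteq> carrier M" "\<zero>\<^bsub>M\<^esub> \<in> H"
    and "\<And>x y. x \<in> H \<Longrightarrow> y \<in> H \<Longrightarrow> x \<oplus>\<^bsub>M\<^esub> y \<in> H"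
    and "\<And>r x. r \<in> carrier R \<Longrightarrow> x \<in> H \<Longrightarrow> r \<odot>\<^bsub>M\<^esub> x \<in> H"
  shows "submodule H R M"
proof -
  interpret M: module R M by fact
  have "\<ominus>\<^bsub>M\<^esub> x \<in> H" if "x \<in> H" for x
  proof -
    have "(\<ominus>\<^bsub>R\<^esub> \<one>\<^bsub>R\<^esub>) \<odot>\<^bsub>M\<^esub> x \<in> H" using that assms(5) by simp
    then show ?thesis using that assms(2) by (simp add: M.smult_l_minus subset_iff)
  qed
  then show ?thesis using assms by (intro M.submoduleI) auto
qed

lemma submodule_zero: "submodule H R M \<Longrightarrow> \<zero>\<^bsub>M\<^esub> \<in> H"
  using subgroup.one_closed[of H "add_monoid M"] by (simp add: submodule_def)

lemma submodule_subset: "submodule H R M \<Longrightarrow> H \<subseteq> carrier M"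
  using subgroup.subset[of H "add_monoid M"] by (simp add: submodule_def)

lemma submodule_add: "submodule H R M \<Longrightarrow> x \<in> H \<Longrightarrow> y \<in> H \<Longrightarrow> x \<oplus>\<^bsub>M\<^esub> y \<in> H"
  using subgroup.m_closed[of H "add_monoid M"] by (simp add: submodule_def)

lemma submodule_smult: "submodule H R M \<Longrightarrow> r \<in> carrier R \<Longrightarrow> x \<in> H \<Longrightarrow> r \<odot>\<^bsub>M\<^esub> x \<in> H"
  by (rule submodule.smult_closed)

lemma submodule_finsum:
  assumes "module R M" "submodule H R M" "g \<in> A \<rightarrow> H"
  shows "finsum M g A \<in> H"
proof (cases "finite A")
  case True
  interpret M: module R M by fact
  note sub = submodule_subset[OF assms(2)]
  from True assms(3) show ?thesis
  proof (induction A rule: finite_induct)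
    case empty then show ?case using submodule_zero[OF assms(2)] by simp
  next
    case (insert a A)
    then have "g \<in> A \<rightarrow> carrier M" "g a \<in> carrier M" using sub by auto
    then show ?case using insert submodule_add[OF assms(2)] by simp
  qed
next
  case False
  interpret M: module R M by fact
  show ?thesis using False submodule_zero[OF assms(2)] by (simp add: M.M.finsum_infinite)
qed

lemma submodule_trans:
  assumes "module R M" "submodule K R M" "submodule N R (M\<lparr>carrier := K\<rparr>)"
  shows "submodule N R M"
proof (rule submodule_intro[OF assms(1)])
  show "N \<subseteq> carrier M"
    using submodule_subset[OF assms(2)] submodule_subset[OF assms(3)] by auto
  show "\<zero>\<^bsub>M\<^esub> \<in> N" using submodule_zero[OF assms(3)] by simp
qed (use submodule_add[OF assms(3)] submodule_smult[OF assms(3)] in auto)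

lemma submodule_module: "module R M \<Longrightarrow> submodule K R M \<Longrightarrow> module R (M\<lparr>carrier := K\<rparr>)"
  by (rule submodule.submodule_is_module)

text \<open>\<open>finsum\<close> depends on the whole record, carrier included, so the two sums are
  different terms; linearity of the inclusion identifies them.\<close>

lemma finsum_sub:
  fixes M :: "('a, 'b) module"
  assumes "module R M" "submodule K R M" "g \<in> A \<rightarrow> K"
  shows "finsum (M\<lparr>carrier := K\<rparr>) g A = finsum M g A"
  using lin_finsum[OF lin_id_sub[OF submodule_subset[OF assms(2)]] submodule_module[OF assms(1,2)]
      assms(1), of g A] assms(3) by simp

text \<open>The additive inverse, too, is sought inside the carrier of the record, so the inclusion
  serves again.\<close>

lemma minus_sub:
  fixes M :: "('a, 'b) module"
  assumes "module R M" "submodule K R M" "x \<in> K" "y \<in> K"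
  shows "x \<ominus>\<^bsub>M\<lparr>carrier := K\<rparr>\<^esub> y = x \<ominus>\<^bsub>M\<^esub> y"
  using lin_minus[OF lin_id_sub[OF submodule_subset[OF assms(2)]] submodule_module[OF assms(1,2)]
      assms(1), of x y] assms(3,4) by simp

section \<open>Kernels, equalizers, spans and generators\<close>

lemma kernel_submodule:
  assumes "lin R M N f" "module R M" "module R N"
  shows "submodule {x \<in> carrier M. f x = \<zero>\<^bsub>N\<^esub>} R M"
proof -
  interpret M: module R M by fact
  interpret N: module R N by fact
  show ?thesis
    by (rule submodule_intro)
      (use assms lin_zero[OF assms] in \<open>auto simp: lin_add lin_smult\<close>)
qed

lemma equalizer_submodule:
  assumes "lin R M N f" "lin R M N g" "module R M" "module R N"
  shows "submodule {x \<in> carrier M. f x = g x} R M"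
proof -
  interpret M: module R M by fact
  interpret N: module R N by fact
  show ?thesis
    by (rule submodule_intro)
      (use assms lin_zero[OF assms(1,3,4)] lin_zero[OF assms(2,3,4)] in \<open>auto simp: lin_add lin_smult\<close>)
qed

lemma mod_span_le: "submodule N R M \<Longrightarrow> S \<subseteq> N \<Longrightarrow> mod_span R M S \<subseteq> N"
  by (auto simp: mod_span_def)

lemma subset_mod_span: "S \<subseteq> mod_span R M S"
  by (auto simp: mod_span_def)

lemma mod_span_submodule:
  assumes "module R M" "S \<subseteq> carrier M"
  shows "submodule (mod_span R M S) R M"
proof -
  interpret M: module R M by fact
  show ?thesis
  proof (rule submodule_intro[OF assms(1)])
    show "mod_span R M S \<subseteq> carrier M"
      by (rule mod_span_le[OF M.carrier_is_submodule assms(2)])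
  qed (auto simp: mod_span_def submodule_zero submodule_add submodule_smult)
qed

lemma mod_span_eqI:
  assumes "module R M" "S \<subseteq> carrier M"
    and "\<And>N. submodule N R M \<Longrightarrow> S \<subseteq> N \<Longrightarrow> carrier M \<subseteq> N"
  shows "mod_span R M S = carrier M"
  using assms(3)[OF mod_span_submodule[OF assms(1,2)] subset_mod_span]
    submodule_subset[OF mod_span_submodule[OF assms(1,2)]] by auto

text \<open>The equalizer of \<open>f\<close> and \<open>g\<close> is a submodule containing
  \<open>S\<close>.\<close>

lemma lin_eq_on_span:
  assumes "lin R M N f" "lin R M N g" "module R M" "module R N"
    and "mod_span R M S = carrier M" "S \<subseteq> carrier M" "\<And>x. x \<in> S \<Longrightarrow> f x = g x" "x \<in> carrier M"
  shows "f x = g x"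
  using mod_span_le[OF equalizer_submodule[OF assms(1-4)], of S] assms(5-8) by auto

lemma finsum_delta:
  assumes "module R M" "finite A" "j \<in> A" "v \<in> A \<rightarrow> carrier M"
  shows "finsum M (\<lambda>i. (if i = j then \<one>\<^bsub>R\<^esub> else \<zero>\<^bsub>R\<^esub>) \<odot>\<^bsub>M\<^esub> v i) A = v j"
proof -
  interpret M: module R M by fact
  have "finsum M (\<lambda>i. (if i = j then \<one>\<^bsub>R\<^esub> else \<zero>\<^bsub>R\<^esub>) \<odot>\<^bsub>M\<^esub> v i) A
      = finsum M (\<lambda>i. if j = i then v i else \<zero>\<^bsub>M\<^esub>) A"
    by (rule M.M.finsum_cong') (use assms in \<open>auto simp: Pi_iff\<close>)
  also have "\<dots> = v j" by (rule M.M.add.finprod_singleton) (use assms in auto)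
  finally show ?thesis .
qed

text \<open>Generation is tested against all submodules containing \<open>S\<close>; later proofs
  only have to place each element in such a submodule.\<close>

lemma fin_genI:
  assumes "module R M" "finite S" "S \<subseteq> carrier M"
    and "\<And>N. submodule N R M \<Longrightarrow> S \<subseteq> N \<Longrightarrow> carrier M \<subseteq> N"
  shows "fin_gen R M"
  unfolding fin_gen_def using mod_span_eqI[OF assms(1,3,4)] assms(2,3) by auto

text \<open>\<open>Q\<close> is not assumed to be a module: a surjection compatible with the
  operations carries every axiom over from \<open>M\<close>. This serves quotients and transported
  copies alike.\<close>

lemma module_surj_image:
  assumes "module R M" "\<kappa> ` carrier M = carrier Q"
    and add: "\<And>x y. x \<in> carrier M \<Longrightarrow> y \<in> carrier M \<Longrightarrow> \<kappa> (x \<oplus>\<^bsub>M\<^esub> y) = \<kappa> x \<oplus>\<^bsub>Q\<^esub> \<kappa> y"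
    and zero: "\<kappa> \<zero>\<^bsub>M\<^esub> = \<zero>\<^bsub>Q\<^esub>"
    and smult: "\<And>r x. r \<in> carrier R \<Longrightarrow> x \<in> carrier M \<Longrightarrow> \<kappa> (r \<odot>\<^bsub>M\<^esub> x) = r \<odot>\<^bsub>Q\<^esub> \<kappa> x"
  shows "module R Q" "lin R M Q \<kappa>"
proof -
  interpret M: module R M by fact
  note ops = add[symmetric] zero[symmetric] smult[symmetric]
  have surj: "\<exists>x\<in>carrier M. q = \<kappa> x" if "q \<in> carrier Q" for q
    using that assms(2) by auto
  have into: "\<kappa> x \<in> carrier Q" if "x \<in> carrier M" for x
    using that assms(2) by auto
  show "lin R M Q \<kappa>" using assms(3,5) into by (auto simp: lin_def)
  show "module R Q"
  proof (intro moduleI abelian_groupI)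
    show "cring R" by (rule M.R.is_cring)
    show "\<zero>\<^bsub>Q\<^esub> \<in> carrier Q" using into[of "\<zero>\<^bsub>M\<^esub>"] by (simp add: zero)
  next
    fix x y assume "x \<in> carrier Q" "y \<in> carrier Q"
    then obtain x' y' where "x' \<in> carrier M" "x = \<kappa> x'" "y' \<in> carrier M" "y = \<kappa> y'"
      using surj by metis
    then show "x \<oplus>\<^bsub>Q\<^esub> y \<in> carrier Q" "x \<oplus>\<^bsub>Q\<^esub> y = y \<oplus>\<^bsub>Q\<^esub> x"
      by (simp_all add: ops into M.M.a_comm del: add)
  next
    fix x y z assume "x \<in> carrier Q" "y \<in> carrier Q" "z \<in> carrier Q"
    then obtain x' y' z' where "x' \<in> carrier M" "x = \<kappa> x'" "y' \<in> carrier M" "y = \<kappa> y'"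
      "z' \<in> carrier M" "z = \<kappa> z'"
      using surj by metis
    then show "x \<oplus>\<^bsub>Q\<^esub> y \<oplus>\<^bsub>Q\<^esub> z = x \<oplus>\<^bsub>Q\<^esub> (y \<oplus>\<^bsub>Q\<^esub> z)"
      by (simp add: ops M.M.a_assoc)
  next
    fix x assume "x \<in> carrier Q"
    then obtain x' where x': "x' \<in> carrier M" "x = \<kappa> x'" using surj by metis
    then show "\<zero>\<^bsub>Q\<^esub> \<oplus>\<^bsub>Q\<^esub> x = x" by (simp add: ops)
    show "\<one>\<^bsub>R\<^esub> \<odot>\<^bsub>Q\<^esub> x = x" using x' by (simp add: ops)
    have "\<kappa> (\<ominus>\<^bsub>M\<^esub> x') \<oplus>\<^bsub>Q\<^esub> x = \<zero>\<^bsub>Q\<^esub>" using x' by (simp add: ops M.M.l_neg)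
    then show "\<exists>y\<in>carrier Q. y \<oplus>\<^bsub>Q\<^esub> x = \<zero>\<^bsub>Q\<^esub>" using x' into by blast
  next
    fix r x assume "r \<in> carrier R" "x \<in> carrier Q"
    then show "r \<odot>\<^bsub>Q\<^esub> x \<in> carrier Q" using surj[of x] by (auto simp: ops into)
  next
    fix r s x assume rs: "r \<in> carrier R" "s \<in> carrier R" and "x \<in> carrier Q"
    then obtain x' where x': "x' \<in> carrier M" "x = \<kappa> x'" using surj by metis
    then show "(r \<oplus>\<^bsub>R\<^esub> s) \<odot>\<^bsub>Q\<^esub> x = r \<odot>\<^bsub>Q\<^esub> x \<oplus>\<^bsub>Q\<^esub> s \<odot>\<^bsub>Q\<^esub> x"
      using rs by (simp add: ops M.smult_l_distr)
    show "(r \<otimes>\<^bsub>R\<^esub> s) \<odot>\<^bsub>Q\<^esub> x = r \<odot>\<^bsub>Q\<^esub> (s \<odot>\<^bsub>Q\<^esub> x)"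
      using rs x' by (simp add: ops M.smult_assoc1)
  next
    fix r x y assume r: "r \<in> carrier R" and "x \<in> carrier Q" "y \<in> carrier Q"
    then obtain x' y' where "x' \<in> carrier M" "x = \<kappa> x'" "y' \<in> carrier M" "y = \<kappa> y'"
      using surj by metis
    then show "r \<odot>\<^bsub>Q\<^esub> (x \<oplus>\<^bsub>Q\<^esub> y) = r \<odot>\<^bsub>Q\<^esub> x \<oplus>\<^bsub>Q\<^esub> r \<odot>\<^bsub>Q\<^esub> y"
      using r by (simp add: ops M.smult_r_distr)
  qed
qed

text \<open>The map is \<open>f\<close> after a choice of preimages. It is linear because
  \<open>f\<close> is constant on the fibres of \<open>\<kappa>\<close>: two points of a fibre
  differ by an element of the kernel.\<close>

lemma lin_factor:
  assumes "lin R M Q \<kappa>" "\<kappa> ` carrier M = carrier Q" "lin R M N f"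
    and "module R M" "module R N" "module R Q"
    and ker: "\<And>x. x \<in> carrier M \<Longrightarrow> \<kappa> x = \<zero>\<^bsub>Q\<^esub> \<Longrightarrow> f x = \<zero>\<^bsub>N\<^esub>"
  obtains g where "lin R Q N g" "\<And>x. x \<in> carrier M \<Longrightarrow> g (\<kappa> x) = f x"
proof -
  interpret M: module R M by fact
  interpret N: module R N by fact
  interpret Q: module R Q by fact
  have "\<forall>q\<in>carrier Q. \<exists>x\<in>carrier M. \<kappa> x = q"
    using assms(2) by (metis imageE)
  then obtain c where c: "\<And>q. q \<in> carrier Q \<Longrightarrow> c q \<in> carrier M"
    "\<And>q. q \<in> carrier Q \<Longrightarrow> \<kappa> (c q) = q"
    by metis
  have eq: "f x = f y" if x: "x \<in> carrier M" and y: "y \<in> carrier M" and xy: "\<kappa> x = \<kappa> y" for x y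
  proof -
    have "\<kappa> (x \<ominus>\<^bsub>M\<^esub> y) = \<kappa> y \<ominus>\<^bsub>Q\<^esub> \<kappa> y"
      unfolding lin_minus[OF assms(1,4,6) x y] xy ..
    also have "\<dots> = \<zero>\<^bsub>Q\<^esub>"
      using minus_zero_iff[OF assms(6)] lin_closed[OF assms(1) y] by blast
    finally have "f (x \<ominus>\<^bsub>M\<^esub> y) = \<zero>\<^bsub>N\<^esub>"
      by (rule ker[rotated]) (use x y in simp)
    then have "f x \<ominus>\<^bsub>N\<^esub> f y = \<zero>\<^bsub>N\<^esub>"
      unfolding lin_minus[OF assms(3,4,5) x y] .
    then show ?thesis
      using minus_zero_iff[OF assms(5)] lin_closed[OF assms(3)] x y by blast
  qed
  have g: "f (c (\<kappa> x)) = f x" if "x \<in> carrier M" for x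
    by (rule eq) (use that c lin_closed[OF assms(1)] in blast)+
  have "lin R Q N (\<lambda>q. f (c q))"
  proof (rule linI)
    fix q assume q: "q \<in> carrier Q"
    then show "f (c q) \<in> carrier N" using c lin_closed[OF assms(3)] by auto
    fix r assume r: "r \<in> carrier R"
    have "f (c (r \<odot>\<^bsub>Q\<^esub> q)) = f (c (\<kappa> (r \<odot>\<^bsub>M\<^esub> c q)))"
      using q r c by (simp add: lin_smult[OF assms(1)])
    then show "f (c (r \<odot>\<^bsub>Q\<^esub> q)) = r \<odot>\<^bsub>N\<^esub> f (c q)"
      using q r c by (simp add: g lin_smult[OF assms(3)])
  next
    fix p q assume q: "p \<in> carrier Q" "q \<in> carrier Q"
    have "f (c (p \<oplus>\<^bsub>Q\<^esub> q)) = f (c (\<kappa> (c p \<oplus>\<^bsub>M\<^esub> c q)))"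
      using q c by (simp add: lin_add[OF assms(1)])
    then show "f (c (p \<oplus>\<^bsub>Q\<^esub> q)) = f (c p) \<oplus>\<^bsub>N\<^esub> f (c q)"
      using q c by (simp add: g lin_add[OF assms(3)])
  qed
  then show thesis using g that by blast
qed

lemma quot_mod_module:
  fixes M :: "('a, 'b) module"
  assumes "module R M" "submodule N R M"
  shows "module R (quot_mod M N)" "lin R M (quot_mod M N) (\<lambda>x. N +>\<^bsub>M\<^esub> x)"
    "(\<lambda>x. N +>\<^bsub>M\<^esub> x) ` carrier M = carrier (quot_mod M N)"
proof -
  interpret M: module R M by fact
  have N: "subgroup N (add_monoid M)" using assms(2) by (simp add: submodule_def)
  interpret N: abelian_subgroup N M
    by (rule abelian_subgroupI3) (auto intro: additive_subgroup.intro N M.M.abelian_group_axioms)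
  show surj: "(\<lambda>x. N +>\<^bsub>M\<^esub> x) ` carrier M = carrier (quot_mod M N)"
    by (auto simp: quot_mod_def A_RCOSETS_def')
  \<comment> \<open>\<open>quot_mod\<close> multiplies a coset by uniting the classes of r y over
    all its elements y. These classes coincide, since y and x differ by an element of
    \<open>N\<close>, so the union is a single coset.\<close>
  have smult: "N +>\<^bsub>M\<^esub> (r \<odot>\<^bsub>M\<^esub> x) = (\<Union>y\<in>N +>\<^bsub>M\<^esub> x. N +>\<^bsub>M\<^esub> (r \<odot>\<^bsub>M\<^esub> y))"
    if "r \<in> carrier R" "x \<in> carrier M" for r x
  proof -
    have "N +>\<^bsub>M\<^esub> (r \<odot>\<^bsub>M\<^esub> y) = N +>\<^bsub>M\<^esub> (r \<odot>\<^bsub>M\<^esub> x)" if "y \<in> N +>\<^bsub>M\<^esub> x" for y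
    proof -
      obtain h where h: "h \<in> N" "y = h \<oplus>\<^bsub>M\<^esub> x"
        using \<open>y \<in> N +>\<^bsub>M\<^esub> x\<close> by (auto simp: a_r_coset_def')
      have hM: "h \<in> carrier M" using h submodule_subset[OF assms(2)] by auto
      have "r \<odot>\<^bsub>M\<^esub> y = r \<odot>\<^bsub>M\<^esub> h \<oplus>\<^bsub>M\<^esub> r \<odot>\<^bsub>M\<^esub> x"
        using h hM \<open>r \<in> carrier R\<close> \<open>x \<in> carrier M\<close> by (simp add: M.smult_r_distr)
      moreover have "r \<odot>\<^bsub>M\<^esub> h \<in> N" using h \<open>r \<in> carrier R\<close> submodule_smult[OF assms(2)] by auto
      ultimately have "r \<odot>\<^bsub>M\<^esub> y \<in> N +>\<^bsub>M\<^esub> (r \<odot>\<^bsub>M\<^esub> x)" by (auto simp: a_r_coset_def')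
      then show ?thesis
        using M.M.a_repr_independence[OF _ _ N] \<open>r \<in> carrier R\<close> \<open>x \<in> carrier M\<close> by auto
    qed
    moreover have "x \<in> N +>\<^bsub>M\<^esub> x" by (rule N.a_rcos_self) fact
    ultimately show ?thesis by blast
  qed
  have "N +>\<^bsub>M\<^esub> (x \<oplus>\<^bsub>M\<^esub> y) = (N +>\<^bsub>M\<^esub> x) \<oplus>\<^bsub>quot_mod M N\<^esub> (N +>\<^bsub>M\<^esub> y)"
    if "x \<in> carrier M" "y \<in> carrier M" for x y
    using N.a_rcos_sum[OF that] by (simp add: quot_mod_def)
  moreover have "N +>\<^bsub>M\<^esub> \<zero>\<^bsub>M\<^esub> = \<zero>\<^bsub>quot_mod M N\<^esub>"
    using M.M.a_coset_add_zero[OF N.a_subset] by (simp add: quot_mod_def)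
  moreover have "N +>\<^bsub>M\<^esub> (r \<odot>\<^bsub>M\<^esub> x) = r \<odot>\<^bsub>quot_mod M N\<^esub> (N +>\<^bsub>M\<^esub> x)"
    if "r \<in> carrier R" "x \<in> carrier M" for r x
    using smult[OF that] by (simp add: quot_mod_def)
  ultimately show "module R (quot_mod M N)" "lin R M (quot_mod M N) (\<lambda>x. N +>\<^bsub>M\<^esub> x)"
    using module_surj_image[OF assms(1) surj] by auto
qed

lemma quot_mod_zero_iff:
  fixes M :: "('a, 'b) module"
  assumes "module R M" "submodule N R M" "x \<in> carrier M"
  shows "N +>\<^bsub>M\<^esub> x = \<zero>\<^bsub>quot_mod M N\<^esub> \<longleftrightarrow> x \<in> N"
proof -
  interpret M: module R M by fact
  have N: "subgroup N (add_monoid M)" using assms(2) by (simp add: submodule_def)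
  show ?thesis
    using M.M.a_coset_join1[OF _ assms(3) N] M.M.a_coset_join2[OF assms(3) N]
    by (auto simp: quot_mod_def)
qed

section \<open>Free and projective modules\<close>

lemma self_mod_module:
  assumes "cring R"
  shows "module R (self_mod R)"
proof -
  interpret cring R by fact
  show ?thesis
  proof (intro moduleI abelian_groupI)
    fix x assume "x \<in> carrier (self_mod R)"
    then show "\<exists>y\<in>carrier (self_mod R). y \<oplus>\<^bsub>self_mod R\<^esub> x = \<zero>\<^bsub>self_mod R\<^esub>"
      by (intro bexI[of _ "\<ominus>\<^bsub>R\<^esub> x"]) (simp_all add: self_mod_def l_neg)
  qed (simp_all add: self_mod_def a_ac m_assoc l_distr r_distr is_cring)
qed

lemma free_mod_module:
  assumes "cring R"
  shows "module R (free_mod R X)"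
proof -
  interpret cring R by fact
  have fin: "finite {x. f x \<oplus>\<^bsub>R\<^esub> g x \<noteq> \<zero>\<^bsub>R\<^esub>}"
    if "finite {x. f x \<noteq> \<zero>\<^bsub>R\<^esub>}" "finite {x. g x \<noteq> \<zero>\<^bsub>R\<^esub>}" for f g :: "'c \<Rightarrow> 'a"
    by (rule finite_subset[OF _ finite_UnI[OF that]]) auto
  have fin': "finite {x. r \<otimes>\<^bsub>R\<^esub> f x \<noteq> \<zero>\<^bsub>R\<^esub>}" if "finite {x. f x \<noteq> \<zero>\<^bsub>R\<^esub>}" "r \<in> carrier R"
    for f :: "'c \<Rightarrow> 'a" and r
    by (rule finite_subset[OF _ that(1)]) (use that(2) in auto)
  have in_carrier: "f \<in> carrier (free_mod R X) \<longleftrightarrow> (\<forall>x. f x \<in> carrier R) \<and>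
      (\<forall>x. x \<notin> X \<longrightarrow> f x = \<zero>\<^bsub>R\<^esub>) \<and> finite {x. f x \<noteq> \<zero>\<^bsub>R\<^esub>}" for f
    by (auto simp: free_mod_def)
  have ops: "\<zero>\<^bsub>free_mod R X\<^esub> = (\<lambda>x. \<zero>\<^bsub>R\<^esub>)" "f \<oplus>\<^bsub>free_mod R X\<^esub> g = (\<lambda>x. f x \<oplus>\<^bsub>R\<^esub> g x)"
    "r \<odot>\<^bsub>free_mod R X\<^esub> f = (\<lambda>x. r \<otimes>\<^bsub>R\<^esub> f x)" for f g r
    by (simp_all add: free_mod_def)
  show ?thesis
  proof (intro moduleI abelian_groupI)
    fix f assume f: "f \<in> carrier (free_mod R X)"
    have "finite {x. \<ominus>\<^bsub>R\<^esub> f x \<noteq> \<zero>\<^bsub>R\<^esub>}"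
      by (rule finite_subset[of _ "{x. f x \<noteq> \<zero>\<^bsub>R\<^esub>}"]) (use f in \<open>auto simp: in_carrier\<close>)
    then have "(\<lambda>x. \<ominus>\<^bsub>R\<^esub> f x) \<in> carrier (free_mod R X)" using f by (simp add: in_carrier)
    then show "\<exists>g\<in>carrier (free_mod R X). g \<oplus>\<^bsub>free_mod R X\<^esub> f = \<zero>\<^bsub>free_mod R X\<^esub>"
      using f by (intro bexI[of _ "\<lambda>x. \<ominus>\<^bsub>R\<^esub> f x"]) (simp_all add: in_carrier ops l_neg)
  qed (simp_all add: in_carrier ops fin fin' is_cring a_ac m_assoc l_distr r_distr)
qed

section \<open>Coordinates and linear extension in free modules\<close>

lemma free_mod_carrier_in: "f \<in> carrier (free_mod R X) \<Longrightarrow> f x \<in> carrier R"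
  by (auto simp: free_mod_def)

lemma free_mod_support:
  "f \<in> carrier (free_mod R X) \<Longrightarrow> {x. f x \<noteq> \<zero>\<^bsub>R\<^esub>} \<subseteq> X"
  "f \<in> carrier (free_mod R X) \<Longrightarrow> finite {x. f x \<noteq> \<zero>\<^bsub>R\<^esub>}"
  by (auto simp: free_mod_def)

lemma free_gen_closed:
  assumes "cring R" "x \<in> X"
  shows "free_gen R x \<in> carrier (free_mod R X)"
proof -
  interpret cring R by fact
  show ?thesis using assms(2) by (auto simp: free_mod_def free_gen_def)
qed

lemma eval_lin: "cring R \<Longrightarrow> lin R (free_mod R X) (self_mod R) (\<lambda>f. f x)"
  by (auto simp: lin_def free_mod_def self_mod_def)

text \<open>\<open>A\<close> may exceed the support, so that several elements can be expanded over
  one index set. The two sides are compared at each index \<open>y\<close>, evaluation at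
  \<open>y\<close> being linear.\<close>

lemma free_expansion:
  assumes "cring R" "f \<in> carrier (free_mod R X)" "finite A" "{x. f x \<noteq> \<zero>\<^bsub>R\<^esub>} \<subseteq> A" "A \<subseteq> X"
  shows "f = finsum (free_mod R X) (\<lambda>x. f x \<odot>\<^bsub>free_mod R X\<^esub> free_gen R x) A"
proof
  fix y
  interpret cring R by fact
  interpret F: module R "free_mod R X" by (rule free_mod_module[OF assms(1)])
  interpret S: module R "self_mod R" by (rule self_mod_module[OF assms(1)])
  have fc: "f x \<in> carrier R" for x by (rule free_mod_carrier_in[OF assms(2)])
  have "(\<lambda>x. f x \<odot>\<^bsub>free_mod R X\<^esub> free_gen R x) \<in> A \<rightarrow> carrier (free_mod R X)"
    by (intro Pi_I F.smult_closed fc free_gen_closed assms(1)) (use assms(5) in auto)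
  then have "finsum (free_mod R X) (\<lambda>x. f x \<odot>\<^bsub>free_mod R X\<^esub> free_gen R x) A y
    = finsum (self_mod R) (\<lambda>x. (f x \<odot>\<^bsub>free_mod R X\<^esub> free_gen R x) y) A"
    by (rule lin_finsum[OF eval_lin[OF assms(1)] F.module_axioms S.module_axioms])
  also have "\<dots> = finsum (self_mod R) (\<lambda>x. if y = x then f x else \<zero>\<^bsub>self_mod R\<^esub>) A"
    by (rule S.M.finsum_cong') (use fc in \<open>auto simp: free_mod_def free_gen_def self_mod_def\<close>)
  also have "\<dots> = f y"
  proof (cases "y \<in> A")
    case True then show ?thesis using fc assms(3)
      by (intro S.M.add.finprod_singleton) (auto simp: self_mod_def)
  next
    case False
    then have "finsum (self_mod R) (\<lambda>x. if y = x then f x else \<zero>\<^bsub>self_mod R\<^esub>) A = \<zero>\<^bsub>self_mod R\<^esub>"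
      by (intro S.M.add.finprod_one_eqI) auto
    moreover have "f y = \<zero>\<^bsub>self_mod R\<^esub>" using False assms(4) by (auto simp: self_mod_def)
    ultimately show ?thesis by (rule trans[OF _ sym])
  qed
  finally show "f y = finsum (free_mod R X) (\<lambda>x. f x \<odot>\<^bsub>free_mod R X\<^esub> free_gen R x) A y" by simp
qed

lemma free_lin_eq:
  assumes "cring R" "lin R (free_mod R X) M f" "lin R (free_mod R X) M g" "module R M"
    and "\<And>x. x \<in> X \<Longrightarrow> f (free_gen R x) = g (free_gen R x)" "h \<in> carrier (free_mod R X)"
  shows "f h = g h"
proof -
  interpret F: module R "free_mod R X" by (rule free_mod_module[OF assms(1)])
  let ?S = "{x. h x \<noteq> \<zero>\<^bsub>R\<^esub>}" and ?N = "{x \<in> carrier (free_mod R X). f x = g x}"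
  note N = equalizer_submodule[OF assms(2,3) F.module_axioms assms(4)]
  have "h = finsum (free_mod R X) (\<lambda>x. h x \<odot>\<^bsub>free_mod R X\<^esub> free_gen R x) ?S"
    by (rule free_expansion) (use free_mod_support[OF assms(6)] assms in auto)
  also have "\<dots> \<in> ?N"
  proof (rule submodule_finsum[OF F.module_axioms N], rule Pi_I)
    fix x assume "x \<in> ?S"
    then have "x \<in> X" using free_mod_support[OF assms(6)] by auto
    then show "h x \<odot>\<^bsub>free_mod R X\<^esub> free_gen R x \<in> ?N"
      using assms(5) free_gen_closed[OF assms(1)] free_mod_carrier_in[OF assms(6)]
      by (intro submodule_smult[OF N]) auto
  qed
  finally show ?thesis by simp
qed

text \<open>Summing over the support of \<open>f\<close> keeps the basis set out of the definition;
  \<open>free_ext_eq\<close> then permits any finite set between the support and the basis.\<close>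

definition free_ext :: "('a, 'r) ring_scheme \<Rightarrow> ('a, 'b) module \<Rightarrow> ('i \<Rightarrow> 'b) \<Rightarrow> ('i \<Rightarrow> 'a) \<Rightarrow> 'b"
  where "free_ext R M v f = finsum M (\<lambda>x. f x \<odot>\<^bsub>M\<^esub> v x) {x. f x \<noteq> \<zero>\<^bsub>R\<^esub>}"

lemma free_ext_eq:
  assumes "module R M" "v \<in> X \<rightarrow> carrier M" "f \<in> carrier (free_mod R X)"
    and "finite A" "{x. f x \<noteq> \<zero>\<^bsub>R\<^esub>} \<subseteq> A" "A \<subseteq> X"
  shows "free_ext R M v f = finsum M (\<lambda>x. f x \<odot>\<^bsub>M\<^esub> v x) A"
proof -
  interpret M: module R M by fact
  have fc: "f x \<in> carrier R" for x by (rule free_mod_carrier_in[OF assms(3)])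
  show ?thesis unfolding free_ext_def
    by (rule M.M.add.finprod_mono_neutral_cong_left) (use assms fc in \<open>auto simp: Pi_iff subset_iff\<close>)
qed

lemma free_ext_lin:
  assumes "module R M" "v \<in> X \<rightarrow> carrier M"
  shows "lin R (free_mod R X) M (free_ext R M v)"
proof -
  interpret M: module R M by fact
  interpret F: module R "free_mod R X" by (rule free_mod_module[OF M.R.is_cring])
  let ?F = "free_mod R X"
  show ?thesis
  proof (rule linI)
    fix f assume f: "f \<in> carrier ?F"
    have fc: "f x \<in> carrier R" for x by (rule free_mod_carrier_in[OF f])
    have sf: "{x. f x \<noteq> \<zero>\<^bsub>R\<^esub>} \<subseteq> X" "finite {x. f x \<noteq> \<zero>\<^bsub>R\<^esub>}" using free_mod_support[OF f] by auto
    then have v: "v x \<in> carrier M" if "f x \<noteq> \<zero>\<^bsub>R\<^esub>" for x using that assms(2) by auto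
    show "free_ext R M v f \<in> carrier M"
      unfolding free_ext_def by (rule M.M.finsum_closed) (use fc v in auto)
    fix r assume r: "r \<in> carrier R"
    have "free_ext R M v (r \<odot>\<^bsub>?F\<^esub> f) = finsum M (\<lambda>x. (r \<odot>\<^bsub>?F\<^esub> f) x \<odot>\<^bsub>M\<^esub> v x) {x. f x \<noteq> \<zero>\<^bsub>R\<^esub>}"
      by (rule free_ext_eq[OF assms]) (use F.smult_closed[OF r f] r sf in \<open>auto simp: free_mod_def\<close>)
    also have "\<dots> = finsum M (\<lambda>x. r \<odot>\<^bsub>M\<^esub> (f x \<odot>\<^bsub>M\<^esub> v x)) {x. f x \<noteq> \<zero>\<^bsub>R\<^esub>}"
      by (rule M.M.finsum_cong') (use r fc v in \<open>auto simp: free_mod_def M.smult_assoc1\<close>)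
    also have "\<dots> = r \<odot>\<^bsub>M\<^esub> free_ext R M v f"
      unfolding free_ext_def by (rule M.finsum_smult_ldistr[symmetric]) (use sf r fc v in auto)
    finally show "free_ext R M v (r \<odot>\<^bsub>?F\<^esub> f) = r \<odot>\<^bsub>M\<^esub> free_ext R M v f" .
  next
    fix f g assume f: "f \<in> carrier ?F" and g: "g \<in> carrier ?F"
    have fc: "f x \<in> carrier R" "g x \<in> carrier R" for x
      using free_mod_carrier_in[OF f] free_mod_carrier_in[OF g] by auto
    \<comment> \<open>Cancellation can make the support of the sum smaller than this union; all
      three sums are taken over the common set.\<close>
    let ?A = "{x. f x \<noteq> \<zero>\<^bsub>R\<^esub>} \<union> {x. g x \<noteq> \<zero>\<^bsub>R\<^esub>}"
    have A: "?A \<subseteq> X" "finite ?A" using free_mod_support[OF f] free_mod_support[OF g] by auto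
    then have v: "v x \<in> carrier M" if "x \<in> ?A" for x using that assms(2) by auto
    have fg: "f \<oplus>\<^bsub>?F\<^esub> g \<in> carrier ?F" using f g by simp
    have "free_ext R M v (f \<oplus>\<^bsub>?F\<^esub> g) = finsum M (\<lambda>x. (f \<oplus>\<^bsub>?F\<^esub> g) x \<odot>\<^bsub>M\<^esub> v x) ?A"
      by (rule free_ext_eq[OF assms fg A(2) _ A(1)]) (auto simp: free_mod_def)
    also have "\<dots> = finsum M (\<lambda>x. f x \<odot>\<^bsub>M\<^esub> v x \<oplus>\<^bsub>M\<^esub> g x \<odot>\<^bsub>M\<^esub> v x) ?A"
      by (rule M.M.finsum_cong') (use fc v in \<open>auto simp: free_mod_def M.smult_l_distr\<close>)
    also have "\<dots> = finsum M (\<lambda>x. f x \<odot>\<^bsub>M\<^esub> v x) ?A \<oplus>\<^bsub>M\<^esub> finsum M (\<lambda>x. g x \<odot>\<^bsub>M\<^esub> v x) ?A"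
      by (rule M.M.finsum_addf) (use fc v in auto)
    also have "\<dots> = free_ext R M v f \<oplus>\<^bsub>M\<^esub> free_ext R M v g"
      using free_ext_eq[OF assms f A(2) _ A(1)] free_ext_eq[OF assms g A(2) _ A(1)] by simp
    finally show "free_ext R M v (f \<oplus>\<^bsub>?F\<^esub> g) = free_ext R M v f \<oplus>\<^bsub>M\<^esub> free_ext R M v g" .
  qed
qed

lemma free_ext_gen:
  assumes "module R M" "v \<in> X \<rightarrow> carrier M" "x \<in> X"
  shows "free_ext R M v (free_gen R x) = v x"
proof -
  interpret M: module R M by fact
  have "free_ext R M v (free_gen R x) = finsum M (\<lambda>y. free_gen R x y \<odot>\<^bsub>M\<^esub> v y) {x}"
    by (rule free_ext_eq[OF assms(1,2) free_gen_closed[OF M.R.is_cring assms(3)]])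
      (use assms(3) in \<open>auto simp: free_gen_def\<close>)
  also have "\<dots> = v x" using assms by (simp add: free_gen_def Pi_iff)
  finally show ?thesis .
qed

section \<open>Lifting along surjections\<close>

lemma free_lift:
  assumes "module R A" "module R B" "lin R A B q" "q ` carrier A = carrier B"
    and "lin R (free_mod R X) B f"
  obtains g where "lin R (free_mod R X) A g" "\<And>x. x \<in> carrier (free_mod R X) \<Longrightarrow> q (g x) = f x"
proof -
  interpret A: module R A by fact
  note cr = A.R.is_cring
  have "\<exists>a. a \<in> carrier A \<and> q a = f (free_gen R x)" if "x \<in> X" for x
  proof -
    have "f (free_gen R x) \<in> q ` carrier A"
      unfolding assms(4) by (intro lin_closed[OF assms(5)] free_gen_closed cr that)
    then show ?thesis by force
  qed
  then obtain v where v: "\<And>x. x \<in> X \<Longrightarrow> v x \<in> carrier A" "\<And>x. x \<in> X \<Longrightarrow> q (v x) = f (free_gen R x)"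
    by metis
  have vX: "v \<in> X \<rightarrow> carrier A" using v by auto
  note l = free_ext_lin[OF assms(1) vX]
  have "q (free_ext R A v h) = f h" if "h \<in> carrier (free_mod R X)" for h
    by (rule free_lin_eq[OF cr lin_comp[OF l assms(3)] assms(5,2) _ that])
      (simp add: v free_ext_gen[OF assms(1) vX])
  then show thesis using l that by blast
qed

text \<open>\<open>P\<close> is a retract of a free module: lift \<open>f\<close> after
  \<open>p\<close> there and restrict the lift along \<open>i\<close>.\<close>

lemma projective_lift:
  fixes P :: "('a, 'x) module"
  assumes "projective R P" "module R A" "module R B" "lin R A B q" "q ` carrier A = carrier B"
    and "lin R P B f"
  obtains g where "lin R P A g" "\<And>x. x \<in> carrier P \<Longrightarrow> q (g x) = f x"
proof -
  obtain X :: "'x set" and i p where X: "i \<in> mod_hom R P (free_mod R X)" "p \<in> mod_hom R (free_mod R X) P"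
    "\<And>x. x \<in> carrier P \<Longrightarrow> p (i x) = x"
    using assms(1) unfolding projective_def by blast
  obtain g where g: "lin R (free_mod R X) A g" "\<And>x. x \<in> carrier (free_mod R X) \<Longrightarrow> q (g x) = f (p x)"
    using free_lift[OF assms(2-5) lin_comp[OF mod_hom_lin[OF X(2)] assms(6)]] by blast
  show thesis
    by (rule that[OF lin_comp[OF mod_hom_lin[OF X(1)] g(1)]])
      (use g(2) X(3) lin_closed[OF mod_hom_lin[OF X(1)]] in auto)
qed

section \<open>Copies of a module in another type\<close>

lemma lin_inverse:
  assumes "lin R M N f" "bij_betw f (carrier M) (carrier N)" "module R M"
  shows "lin R N M (the_inv_into (carrier M) f)"
proof -
  interpret M: module R M by fact
  let ?g = "the_inv_into (carrier M) f"
  have inj: "inj_on f (carrier M)" and im: "f ` carrier M = carrier N"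
    using assms(2) by (auto simp: bij_betw_def)
  have g: "?g y \<in> carrier M" "f (?g y) = y" if "y \<in> carrier N" for y
    using that the_inv_into_into[OF inj, of y "carrier M"] f_the_inv_into_f[OF inj, of y] im by auto
  have gf: "?g y = x" if "x \<in> carrier M" "f x = y" for x y
    using that the_inv_into_f_eq[OF inj] by blast
  show ?thesis
  proof (rule linI)
    fix x y assume xy: "x \<in> carrier N" "y \<in> carrier N"
    show "?g x \<in> carrier M" using g xy by blast
    show "?g (x \<oplus>\<^bsub>N\<^esub> y) = ?g x \<oplus>\<^bsub>M\<^esub> ?g y"
      by (rule gf) (use g xy in \<open>simp_all add: lin_add[OF assms(1)]\<close>)
  next
    fix r x assume "r \<in> carrier R" "x \<in> carrier N"
    then show "?g (r \<odot>\<^bsub>N\<^esub> x) = r \<odot>\<^bsub>M\<^esub> ?g x"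
      by (intro gf) (use g in \<open>simp_all add: lin_smult[OF assms(1)]\<close>)
  qed
qed

text \<open>\<open>GC_hereditary\<close> quantifies only over modules with elements in one list
  type; a module living elsewhere is moved there along an injection.\<close>

definition transport :: "('a, 'b) module \<Rightarrow> ('b \<Rightarrow> 'c) \<Rightarrow> ('a, 'c) module"
  where "transport M \<phi> = (let \<psi> = the_inv_into (carrier M) \<phi> in
    \<lparr>carrier = \<phi> ` carrier M, mult = undefined, one = undefined, zero = \<phi> \<zero>\<^bsub>M\<^esub>,
     add = (\<lambda>a b. \<phi> (\<psi> a \<oplus>\<^bsub>M\<^esub> \<psi> b)), smult = (\<lambda>r a. \<phi> (r \<odot>\<^bsub>M\<^esub> \<psi> a))\<rparr>)"

lemma transport_module:
  assumes "module R M" "inj_on \<phi> (carrier M)"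
  shows "module R (transport M \<phi>)" "lin R M (transport M \<phi>) \<phi>"
    "bij_betw \<phi> (carrier M) (carrier (transport M \<phi>))"
proof -
  interpret M: module R M by fact
  have im: "\<phi> ` carrier M = carrier (transport M \<phi>)" by (simp add: transport_def Let_def)
  then show "bij_betw \<phi> (carrier M) (carrier (transport M \<phi>))"
    using assms(2) by (auto simp: bij_betw_def)
  show "module R (transport M \<phi>)" "lin R M (transport M \<phi>) \<phi>"
    by (rule module_surj_image[OF assms(1) im];
        simp add: transport_def Let_def the_inv_into_f_f[OF assms(2)])+
qed

text \<open>An element is coded by the list of its coordinates, which fits every type
  \<open>('a + 'p) list\<close>. \<open>projective\<close> also wants a basis inside the element
  type of the copy, hence the renaming of \<open>X\<close> in the proof.\<close>

lemma retract_of_finite_free_projective: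
  fixes M :: "('a, 'b) module" and X :: "'i set"
  assumes "module R M" "finite X" "lin R M (free_mod R X) i" "lin R (free_mod R X) M q"
    and "\<And>m. m \<in> carrier M \<Longrightarrow> q (i m) = m"
  obtains \<phi> :: "'b \<Rightarrow> ('a + 'p) list"
  where "inj_on \<phi> (carrier M)" "projective R (transport M \<phi>)"
proof -
  interpret M: module R M by fact
  note cr = M.R.is_cring
  obtain xs where xs: "set xs = X" using finite_list[OF assms(2)] by blast
  define \<phi> :: "'b \<Rightarrow> ('a + 'p) list" where "\<phi> m = map (\<lambda>x. Inl (i m x)) xs" for m
  have inj: "inj_on \<phi> (carrier M)"
  proof (rule inj_onI)
    fix m m' assume m: "m \<in> carrier M" "m' \<in> carrier M" "\<phi> m = \<phi> m'"
    have "i m x = i m' x" for x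
    proof (cases "x \<in> X")
      case True then show ?thesis using m(3) xs by (simp add: \<phi>_def)
    next
      case False
      then show ?thesis using lin_closed[OF assms(3)] m(1,2) by (simp add: free_mod_def)
    qed
    then have "i m = i m'" by auto
    then show "m = m'" using assms(5) m by metis
  qed
  note T = transport_module[OF assms(1) inj]
  define \<psi> where "\<psi> = the_inv_into (carrier M) \<phi>"
  have \<psi>: "lin R (transport M \<phi>) M \<psi>" unfolding \<psi>_def by (rule lin_inverse[OF T(2,3) assms(1)])
  have \<phi>\<psi>: "\<phi> (\<psi> y) = y" if "y \<in> carrier (transport M \<phi>)" for y
    unfolding \<psi>_def by (rule f_the_inv_into_f[OF inj]) (use that T(3) in \<open>auto simp: bij_betw_def\<close>)
  \<comment> \<open>The new names of the basis are lists of pairwise different lengths, which exist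
    however small \<open>'a\<close> and \<open>'p\<close> are.\<close>
  obtain e :: "'i \<Rightarrow> nat" where e: "inj_on e X" using finite_imp_inj_to_nat_seg[OF assms(2)] by blast
  define \<nu> :: "'i \<Rightarrow> ('a + 'p) list" where "\<nu> x = replicate (e x) undefined" for x
  have \<nu>: "inj_on \<nu> X" using e by (auto simp: inj_on_def \<nu>_def)
  \<comment> \<open>\<open>\<rho>\<close> and \<open>\<rho>'\<close> reindex coefficient functions
    along \<open>\<nu>\<close> in the two directions; off the basis they have to be zero.\<close>
  define \<rho> where "\<rho> f b = (if b \<in> \<nu> ` X then f (the_inv_into X \<nu> b) else \<zero>\<^bsub>R\<^esub>)" for f b
  define \<rho>' where "\<rho>' g x = (if x \<in> X then g (\<nu> x) else \<zero>\<^bsub>R\<^esub>)" for g :: "('a + 'p) list \<Rightarrow> 'a" and x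
  have fin: "finite {b. \<rho> f b \<noteq> \<zero>\<^bsub>R\<^esub>}" for f
    by (rule finite_subset[of _ "\<nu> ` X"]) (use assms(2) in \<open>auto simp: \<rho>_def\<close>)
  have fin': "finite {x. \<rho>' g x \<noteq> \<zero>\<^bsub>R\<^esub>}" for g
    by (rule finite_subset[of _ X]) (use assms(2) in \<open>auto simp: \<rho>'_def\<close>)
  have \<rho>: "lin R (free_mod R X) (free_mod R (\<nu> ` X)) \<rho>"
  proof (rule linI)
    fix f assume f: "f \<in> carrier (free_mod R X)"
    show "\<rho> f \<in> carrier (free_mod R (\<nu> ` X))"
      using f fin by (auto simp: free_mod_def \<rho>_def)
  qed (auto simp: free_mod_def \<rho>_def)
  have \<rho>': "lin R (free_mod R (\<nu> ` X)) (free_mod R X) \<rho>'"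
  proof (rule linI)
    fix g assume g: "g \<in> carrier (free_mod R (\<nu> ` X))"
    show "\<rho>' g \<in> carrier (free_mod R X)"
      using g fin' by (auto simp: free_mod_def \<rho>'_def)
  qed (auto simp: free_mod_def \<rho>'_def)
  have \<rho>\<rho>: "\<rho>' (\<rho> f) = f" if "f \<in> carrier (free_mod R X)" for f
    using that by (auto simp: fun_eq_iff \<rho>_def \<rho>'_def the_inv_into_f_f[OF \<nu>] free_mod_def)
  let ?i = "\<lambda>y. \<rho> (i (\<psi> y))" and ?p = "\<lambda>g. \<phi> (q (\<rho>' g))"
  have li: "lin R (transport M \<phi>) (free_mod R (\<nu> ` X)) ?i"
    by (rule lin_comp[OF lin_comp[OF \<psi> assms(3)] \<rho>])
  have lp: "lin R (free_mod R (\<nu> ` X)) (transport M \<phi>) ?p"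
    by (rule lin_comp[OF lin_comp[OF \<rho>' assms(4)] T(2)])
  have id: "?p (?i y) = y" if "y \<in> carrier (transport M \<phi>)" for y
    using lin_closed[OF \<psi> that] lin_closed[OF assms(3)] assms(5) \<phi>\<psi>[OF that] by (simp add: \<rho>\<rho>)
  have "projective R (transport M \<phi>)"
    unfolding projective_def
    by (intro conjI T(1) exI[of _ "\<nu> ` X"] exI[of _ "restrict ?i (carrier (transport M \<phi>))"]
        exI[of _ "restrict ?p (carrier (free_mod R (\<nu> ` X)))"]
        lin_restrict[OF li T(1)] lin_restrict[OF lp free_mod_module[OF cr]])
      (use id lin_closed[OF li] in simp)
  with inj show thesis by (rule that)
qed

section \<open>Tensor products\<close>

text \<open>The elementary tensor of \<open>x\<close> and \<open>y\<close>.\<close>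

definition tens ::
  "('a, 'r) ring_scheme \<Rightarrow> ('a, 'b) module \<Rightarrow> ('a, 'c) module \<Rightarrow> 'b \<Rightarrow> 'c \<Rightarrow> ('b \<times> 'c \<Rightarrow> 'a) set"
  where "tens R M N x y =
    mod_span R (free_mod R (carrier M \<times> carrier N)) (tensor_rels R M N)
      +>\<^bsub>free_mod R (carrier M \<times> carrier N)\<^esub> free_gen R (x, y)"

locale two_modules =
  fixes R :: "('a, 'r) ring_scheme" and M :: "('a, 'b) module" and N :: "('a, 'c) module"
  assumes module_M: "module R M" and module_N: "module R N"
begin

abbreviation "F \<equiv> free_mod R (carrier M \<times> carrier N)"
abbreviation "\<kappa> \<equiv> a_r_coset F (mod_span R F (tensor_rels R M N))"

lemma cring_R: "cring R"
  using module_M by (simp add: module_def)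

lemma module_F: "module R F"
  by (rule free_mod_module[OF cring_R])

lemma gen_closed: "x \<in> carrier M \<Longrightarrow> y \<in> carrier N \<Longrightarrow> free_gen R (x, y) \<in> carrier F"
  by (rule free_gen_closed[OF cring_R]) auto

lemma rels_subset: "tensor_rels R M N \<subseteq> carrier F"
proof -
  interpret M: module R M by (rule module_M)
  interpret N: module R N by (rule module_N)
  interpret F: module R F by (rule module_F)
  show ?thesis
    unfolding tensor_rels_def Let_def
    by (auto intro!: F.M.minus_closed F.M.add.m_closed F.smult_closed gen_closed)
qed

lemma span_rels_submodule: "submodule (mod_span R F (tensor_rels R M N)) R F"
  by (rule mod_span_submodule[OF module_F rels_subset])

lemma tensor_eq: "tensor R M N = quot_mod F (mod_span R F (tensor_rels R M N))"
  by (simp add: tensor_def Let_def)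

lemma tensor_module: "module R (tensor R M N)"
  and coset_lin: "lin R F (tensor R M N) \<kappa>"
  and coset_surj: "\<kappa> ` carrier F = carrier (tensor R M N)"
  unfolding tensor_eq by (rule quot_mod_module[OF module_F span_rels_submodule])+

lemma tens_eq: "tens R M N x y = \<kappa> (free_gen R (x, y))"
  by (simp add: tens_def)

lemma tens_closed: "x \<in> carrier M \<Longrightarrow> y \<in> carrier N \<Longrightarrow> tens R M N x y \<in> carrier (tensor R M N)"
  unfolding tens_eq by (intro lin_closed[OF coset_lin] gen_closed)

lemma coset_eqI:
  assumes "f \<ominus>\<^bsub>F\<^esub> g \<in> tensor_rels R M N" "f \<in> carrier F" "g \<in> carrier F"
  shows "\<kappa> f = \<kappa> g"
proof -
  interpret F: module R F by (rule module_F)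
  have "\<kappa> (f \<ominus>\<^bsub>F\<^esub> g) = \<zero>\<^bsub>tensor R M N\<^esub>"
    unfolding tensor_eq
    by (subst quot_mod_zero_iff[OF module_F span_rels_submodule])
      (use assms subset_mod_span[of "tensor_rels R M N"] in \<open>auto intro: F.M.minus_closed\<close>)
  then show ?thesis
    using minus_zero_iff[OF tensor_module] lin_closed[OF coset_lin] assms(2,3)
    by (simp add: lin_minus[OF coset_lin module_F tensor_module assms(2,3)])
qed

lemma tens_add_left:
  assumes "x \<in> carrier M" "x' \<in> carrier M" "y \<in> carrier N"
  shows "tens R M N (x \<oplus>\<^bsub>M\<^esub> x') y = tens R M N x y \<oplus>\<^bsub>tensor R M N\<^esub> tens R M N x' y"
proof -
  interpret M: module R M by (rule module_M)
  interpret F: module R F by (rule module_F)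
  have "\<kappa> (free_gen R (x \<oplus>\<^bsub>M\<^esub> x', y)) = \<kappa> (free_gen R (x, y) \<oplus>\<^bsub>F\<^esub> free_gen R (x', y))"
    by (rule coset_eqI) (use assms gen_closed in \<open>auto simp: tensor_rels_def Let_def\<close>)
  then show ?thesis unfolding tens_eq using assms gen_closed by (simp add: lin_add[OF coset_lin])
qed

lemma tens_add_right:
  assumes "x \<in> carrier M" "y \<in> carrier N" "y' \<in> carrier N"
  shows "tens R M N x (y \<oplus>\<^bsub>N\<^esub> y') = tens R M N x y \<oplus>\<^bsub>tensor R M N\<^esub> tens R M N x y'"
proof -
  interpret N: module R N by (rule module_N)
  interpret F: module R F by (rule module_F)
  have "\<kappa> (free_gen R (x, y \<oplus>\<^bsub>N\<^esub> y')) = \<kappa> (free_gen R (x, y) \<oplus>\<^bsub>F\<^esub> free_gen R (x, y'))"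
    by (rule coset_eqI) (use assms gen_closed in \<open>auto simp: tensor_rels_def Let_def\<close>)
  then show ?thesis unfolding tens_eq using assms gen_closed by (simp add: lin_add[OF coset_lin])
qed

lemma tens_smult_left:
  assumes "r \<in> carrier R" "x \<in> carrier M" "y \<in> carrier N"
  shows "tens R M N (r \<odot>\<^bsub>M\<^esub> x) y = r \<odot>\<^bsub>tensor R M N\<^esub> tens R M N x y"
proof -
  interpret M: module R M by (rule module_M)
  interpret F: module R F by (rule module_F)
  have "\<kappa> (free_gen R (r \<odot>\<^bsub>M\<^esub> x, y)) = \<kappa> (r \<odot>\<^bsub>F\<^esub> free_gen R (x, y))"
    by (rule coset_eqI) (use assms gen_closed in \<open>auto simp: tensor_rels_def Let_def\<close>)
  then show ?thesis unfolding tens_eq using assms gen_closed by (simp add: lin_smult[OF coset_lin])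
qed

lemma tens_smult_right:
  assumes "r \<in> carrier R" "x \<in> carrier M" "y \<in> carrier N"
  shows "tens R M N x (r \<odot>\<^bsub>N\<^esub> y) = r \<odot>\<^bsub>tensor R M N\<^esub> tens R M N x y"
proof -
  interpret N: module R N by (rule module_N)
  interpret F: module R F by (rule module_F)
  have "\<kappa> (free_gen R (x, r \<odot>\<^bsub>N\<^esub> y)) = \<kappa> (r \<odot>\<^bsub>F\<^esub> free_gen R (x, y))"
    by (rule coset_eqI) (use assms gen_closed in \<open>auto simp: tensor_rels_def Let_def\<close>)
  then show ?thesis unfolding tens_eq using assms gen_closed by (simp add: lin_smult[OF coset_lin])
qed

lemma tens_lin_left: "y \<in> carrier N \<Longrightarrow> lin R M (tensor R M N) (\<lambda>x. tens R M N x y)"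
  by (intro linI) (auto simp: tens_closed tens_add_left tens_smult_left)

lemma tens_lin_right: "x \<in> carrier M \<Longrightarrow> lin R N (tensor R M N) (tens R M N x)"
  by (intro linI) (auto simp: tens_closed tens_add_right tens_smult_right)

lemma tensor_generated:
  assumes "submodule H R (tensor R M N)"
    and "\<And>x y. x \<in> carrier M \<Longrightarrow> y \<in> carrier N \<Longrightarrow> tens R M N x y \<in> H"
  shows "carrier (tensor R M N) \<subseteq> H"
proof
  fix w assume "w \<in> carrier (tensor R M N)"
  then obtain f where f: "f \<in> carrier F" "w = \<kappa> f" using coset_surj by blast
  interpret F: module R F by (rule module_F)
  let ?S = "{x. f x \<noteq> \<zero>\<^bsub>R\<^esub>}"
  have S: "?S \<subseteq> carrier M \<times> carrier N" "finite ?S" using free_mod_support[OF f(1)] by auto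
  have fc: "f x \<in> carrier R" for x by (rule free_mod_carrier_in[OF f(1)])
  have summand: "f x \<odot>\<^bsub>F\<^esub> free_gen R x \<in> carrier F" if "x \<in> ?S" for x
    by (intro F.smult_closed fc free_gen_closed[OF cring_R]) (use S(1) that in blast)
  have "w = \<kappa> (finsum F (\<lambda>x. f x \<odot>\<^bsub>F\<^esub> free_gen R x) ?S)"
    unfolding f(2) by (rule arg_cong[OF free_expansion[OF cring_R f(1) S(2) subset_refl S(1)]])
  also have "\<dots> = finsum (tensor R M N) (\<lambda>x. \<kappa> (f x \<odot>\<^bsub>F\<^esub> free_gen R x)) ?S"
    by (rule lin_finsum[OF coset_lin module_F tensor_module]) (use summand in blast)
  also have "\<dots> \<in> H"
  proof (rule submodule_finsum[OF tensor_module assms(1)], rule Pi_I)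
    fix x assume x: "x \<in> ?S"
    obtain a b where ab: "x = (a, b)" "a \<in> carrier M" "b \<in> carrier N" using x S(1) by blast
    then have "\<kappa> (f x \<odot>\<^bsub>F\<^esub> free_gen R x) = f x \<odot>\<^bsub>tensor R M N\<^esub> tens R M N a b"
      unfolding tens_eq using lin_smult[OF coset_lin fc gen_closed[OF ab(2,3)]] by simp
    then show "\<kappa> (f x \<odot>\<^bsub>F\<^esub> free_gen R x) \<in> H"
      using submodule_smult[OF assms(1) fc assms(2)[OF ab(2,3)]] by simp
  qed
  finally show "w \<in> H" .
qed

text \<open>Extend \<open>b\<close> linearly to the free module on pairs. Each of the four kinds of
  relation is a difference of two elements with the same value, so the extension passes to the
  quotient.\<close>

lemma tensor_universal:
  assumes K: "module R K"
    and left: "\<And>y. y \<in> carrier N \<Longrightarrow> lin R M K (\<lambda>x. b x y)"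
    and right: "\<And>x. x \<in> carrier M \<Longrightarrow> lin R N K (b x)"
  obtains g where "lin R (tensor R M N) K g"
    "\<And>x y. x \<in> carrier M \<Longrightarrow> y \<in> carrier N \<Longrightarrow> g (tens R M N x y) = b x y"
proof -
  interpret M: module R M by (rule module_M)
  interpret N: module R N by (rule module_N)
  interpret F: module R F by (rule module_F)
  interpret K: module R K by (rule K)
  let ?v = "\<lambda>(x, y). b x y" and ?S = "carrier M \<times> carrier N"
  have b: "b x y \<in> carrier K" if "x \<in> carrier M" "y \<in> carrier N" for x y
    by (rule lin_closed[OF right[OF that(1)] that(2)])
  have v: "?v \<in> ?S \<rightarrow> carrier K" using b by auto
  let ?g = "free_ext R K ?v"
  note g = free_ext_lin[OF K v]
  have gen: "?g (free_gen R (x, y)) = b x y" if "x \<in> carrier M" "y \<in> carrier N" for x y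
    using free_ext_gen[OF K v, of "(x, y)"] that by simp
  have diff: "?g (p \<ominus>\<^bsub>F\<^esub> q) = \<zero>\<^bsub>K\<^esub>" if "?g p = ?g q" "p \<in> carrier F" "q \<in> carrier F" for p q
    using that minus_zero_iff[OF K] lin_closed[OF g] by (simp add: lin_minus[OF g module_F K])
  note gs = gen lin_add[OF g] lin_smult[OF g] gen_closed
    lin_add[OF left] lin_add[OF right] lin_smult[OF left] lin_smult[OF right]
  have "tensor_rels R M N \<subseteq> {f \<in> carrier F. ?g f = \<zero>\<^bsub>K\<^esub>}"
  proof
    fix f assume f: "f \<in> tensor_rels R M N"
    then have "?g f = \<zero>\<^bsub>K\<^esub>"
      unfolding tensor_rels_def Let_def Un_iff mem_Collect_eq
      by (elim disjE exE conjE; hypsubst; intro diff; simp add: gs)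
    then show "f \<in> {f \<in> carrier F. ?g f = \<zero>\<^bsub>K\<^esub>}" using f rels_subset by blast
  qed
  then have ker: "mod_span R F (tensor_rels R M N) \<subseteq> {f \<in> carrier F. ?g f = \<zero>\<^bsub>K\<^esub>}"
    by (rule mod_span_le[OF kernel_submodule[OF g module_F K]])
  have "?g f = \<zero>\<^bsub>K\<^esub>" if "f \<in> carrier F" "\<kappa> f = \<zero>\<^bsub>tensor R M N\<^esub>" for f
    using that ker unfolding tensor_eq quot_mod_zero_iff[OF module_F span_rels_submodule that(1)] by auto
  then obtain h where "lin R (tensor R M N) K h" "\<And>f. f \<in> carrier F \<Longrightarrow> h (\<kappa> f) = ?g f"
    using lin_factor[OF coset_lin coset_surj g module_F K tensor_module] by blast
  then show thesis using that[of h] gen gen_closed by (simp add: tens_eq)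
qed

end

section \<open>Modules of the form \<open>C \<otimes> P\<close>\<close>

text \<open>A local form of "direct summand of a direct sum of copies of \<open>C\<close>", which is all that is needed
  of \<open>C \<otimes> P\<close> for projective \<open>P\<close> and is visibly invariant under isomorphism.\<close>

definition loc_summand :: "('a, 'r) ring_scheme \<Rightarrow> ('a, 'c) module \<Rightarrow> ('a, 'b) module \<Rightarrow> bool"
  where "loc_summand R C W \<longleftrightarrow>
    module R W \<and>
    (\<forall>A. finite A \<and> A \<subseteq> carrier W \<longrightarrow>
       (\<exists>(n :: nat) s t. (\<forall>i<n. lin R C W (s i) \<and> lin R W C (t i)) \<and>
          (\<forall>w\<in>A. w = finsum W (\<lambda>i. s i (t i w)) {..<n})))"

lemma loc_summandD:
  assumes "loc_summand R C W" "finite A" "A \<subseteq> carrier W"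
  shows "\<exists>(n :: nat) s t. (\<forall>i<n. lin R C W (s i) \<and> lin R W C (t i)) \<and>
    (\<forall>w\<in>A. w = finsum W (\<lambda>i. s i (t i w)) {..<n})"
  using assms(1) assms(2,3) unfolding loc_summand_def by simp

lemma loc_summand_module: "loc_summand R C W \<Longrightarrow> module R W"
  by (simp add: loc_summand_def)

text \<open>Decompose \<open>\<phi> w\<close> in \<open>V\<close> and apply \<open>\<psi>\<close> to
  the sum.\<close>

lemma loc_summand_retract:
  fixes W :: "('a, 'b) module"
  assumes "loc_summand R C V" "module R W" "lin R W V \<phi>" "lin R V W \<psi>"
    and id: "\<And>w. w \<in> carrier W \<Longrightarrow> \<psi> (\<phi> w) = w"
  shows "loc_summand R C W"
  unfolding loc_summand_def
proof (intro conjI assms(2) allI impI)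
  fix A assume A: "finite A \<and> A \<subseteq> carrier W"
  have "finite (\<phi> ` A)" "\<phi> ` A \<subseteq> carrier V" using A lin_closed[OF assms(3)] by auto
  from loc_summandD[OF assms(1) this] obtain n :: nat and s t
    where st: "\<forall>i<n. lin R C V (s i) \<and> lin R V C (t i)"
      and sum: "\<forall>w\<in>\<phi> ` A. w = finsum V (\<lambda>i. s i (t i w)) {..<n}"
    by (elim exE conjE)
  have s: "lin R C V (s i)" and t: "lin R V C (t i)" if "i < n" for i using st that by auto
  have "w = finsum W (\<lambda>i. \<psi> (s i (t i (\<phi> w)))) {..<n}" if "w \<in> A" for w
  proof -
    have w: "w \<in> carrier W" using that A by auto
    have st: "s i (t i (\<phi> w)) \<in> carrier V" if "i < n" for i
      by (intro lin_closed[OF s[OF that]] lin_closed[OF t[OF that]] lin_closed[OF assms(3)] w)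
    have "\<psi> (finsum V (\<lambda>i. s i (t i (\<phi> w))) {..<n}) = finsum W (\<lambda>i. \<psi> (s i (t i (\<phi> w)))) {..<n}"
      by (rule lin_finsum[OF assms(4) loc_summand_module[OF assms(1)] assms(2)]) (use st in auto)
    moreover have "\<phi> w = finsum V (\<lambda>i. s i (t i (\<phi> w))) {..<n}" using sum that by blast
    ultimately show ?thesis using id[OF w] by simp
  qed
  then show "\<exists>(n :: nat) s t. (\<forall>i<n. lin R C W (s i) \<and> lin R W C (t i)) \<and>
      (\<forall>w\<in>A. w = finsum W (\<lambda>i. s i (t i w)) {..<n})"
    using lin_comp[OF s assms(4)] lin_comp[OF assms(3) t]
    by (intro exI[of _ n] exI[of _ "\<lambda>i c. \<psi> (s i c)"] exI[of _ "\<lambda>i w. t i (\<phi> w)"]) auto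
qed

text \<open>Let \<open>P\<close> be a retract of R^(X) by \<open>i\<close> and \<open>p\<close>. The
  maps t_y : c \<otimes> q -> i(q)_y c and s_y : c -> c \<otimes> p(e_y) satisfy sum_y s_y t_y = id,
  because sum_y i(q)_y p(e_y) = p(i(q)) = q. At each element finitely many y suffice.\<close>

lemma tensor_projective_loc_summand:
  fixes C :: "('a, 'c) module" and P :: "('a, 'b) module"
  assumes C: "module R C" and P: "projective R P"
  shows "loc_summand R C (tensor R C P)"
proof -
  have mP: "module R P" using P by (simp add: projective_def)
  interpret T: two_modules R C P by (rule two_modules.intro[OF C mP])
  let ?T = "tensor R C P"
  interpret C: module R C by (rule C)
  interpret P: module R P by (rule mP)
  interpret T': module R ?T by (rule T.tensor_module)
  note cr = C.R.is_cring
  obtain X :: "'b set" and i p where ih: "i \<in> mod_hom R P (free_mod R X)"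
    and ph: "p \<in> mod_hom R (free_mod R X) P" and pi: "\<And>x. x \<in> carrier P \<Longrightarrow> p (i x) = x"
    using P unfolding projective_def by blast
  note i = mod_hom_lin[OF ih] and p = mod_hom_lin[OF ph]
  let ?FX = "free_mod R X"
  interpret FX: module R ?FX by (rule free_mod_module[OF cr])
  have iR: "i q y \<in> carrier R" if "q \<in> carrier P" for q y
    by (rule free_mod_carrier_in[OF lin_closed[OF i that]])
  have coord: "\<exists>t. lin R ?T C t \<and> (\<forall>c\<in>carrier C. \<forall>q\<in>carrier P. t (tens R C P c q) = i q y \<odot>\<^bsub>C\<^esub> c)"
    for y
  proof -
    have iadd: "i (q \<oplus>\<^bsub>P\<^esub> q') y = i q y \<oplus>\<^bsub>R\<^esub> i q' y" if "q \<in> carrier P" "q' \<in> carrier P" for q q'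
      using lin_add[OF i that] by (simp add: free_mod_def)
    have ismult: "i (r \<odot>\<^bsub>P\<^esub> q) y = r \<otimes>\<^bsub>R\<^esub> i q y" if "r \<in> carrier R" "q \<in> carrier P" for r q
      using lin_smult[OF i that] by (simp add: free_mod_def)
    have "lin R C C (\<lambda>c. i q y \<odot>\<^bsub>C\<^esub> c)" if "q \<in> carrier P" for q
      by (rule smult_lin[OF C iR[OF that]])
    moreover have "lin R P C (\<lambda>q. i q y \<odot>\<^bsub>C\<^esub> c)" if "c \<in> carrier C" for c
      by (rule linI) (use that iR iadd ismult C.smult_l_distr C.smult_assoc1 in auto)
    ultimately obtain t where "lin R ?T C t"
      "\<And>c q. c \<in> carrier C \<Longrightarrow> q \<in> carrier P \<Longrightarrow> t (tens R C P c q) = i q y \<odot>\<^bsub>C\<^esub> c"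
      using T.tensor_universal[OF C, of "\<lambda>c q. i q y \<odot>\<^bsub>C\<^esub> c"] by blast
    then show ?thesis by blast
  qed
  then obtain t where t: "\<And>y. lin R ?T C (t y)"
    and t_tens: "\<And>y c q. c \<in> carrier C \<Longrightarrow> q \<in> carrier P \<Longrightarrow> t y (tens R C P c q) = i q y \<odot>\<^bsub>C\<^esub> c"
    by metis
  define s where "s y c = tens R C P c (p (free_gen R y))" for y c
  have pg: "p (free_gen R y) \<in> carrier P" if "y \<in> X" for y
    by (rule lin_closed[OF p free_gen_closed[OF cr that]])
  have s: "lin R C ?T (s y)" if "y \<in> X" for y
    unfolding s_def by (rule T.tens_lin_left[OF pg[OF that]])
  define S where "S Y w = finsum ?T (\<lambda>y. s y (t y w)) Y" for Y w
  have S_lin: "lin R ?T ?T (S Y)" if "Y \<subseteq> X" for Y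
    unfolding S_def
    by (rule lin_finsumf[OF _ T.tensor_module T.tensor_module])
      (rule lin_comp[OF t s], use that in auto)
  \<comment> \<open>The identity is required for all finite sets beyond \<open>Y\<close>, so that it
    survives enlarging \<open>Y\<close>: a union then serves a sum of two elements, and later all of
    \<open>A\<close> at once.\<close>
  define fixed where "fixed Y w \<longleftrightarrow> finite Y \<and> Y \<subseteq> X \<and>
    (\<forall>Y'. finite Y' \<longrightarrow> Y \<subseteq> Y' \<longrightarrow> Y' \<subseteq> X \<longrightarrow> S Y' w = w)" for Y w
  let ?G = "{w \<in> carrier ?T. \<exists>Y. fixed Y w}"
  have tens_fixed: "fixed {y. i q y \<noteq> \<zero>\<^bsub>R\<^esub>} (tens R C P c q)" (is "fixed ?Y _")
    if c: "c \<in> carrier C" and q: "q \<in> carrier P" for c q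
    unfolding fixed_def
  proof (intro conjI allI impI)
    note iq = lin_closed[OF i q]
    show "finite ?Y" "?Y \<subseteq> X" using free_mod_support[OF iq] by auto
    fix Y' assume Y': "finite Y'" "?Y \<subseteq> Y'" "Y' \<subseteq> X"
    have fin: "(\<lambda>y. i q y \<odot>\<^bsub>?FX\<^esub> free_gen R y) \<in> Y' \<rightarrow> carrier ?FX"
      by (intro Pi_I FX.smult_closed iR[OF q] free_gen_closed[OF cr]) (use Y'(3) in auto)
    have "S Y' (tens R C P c q) = finsum ?T (\<lambda>y. tens R C P c (p (i q y \<odot>\<^bsub>?FX\<^esub> free_gen R y))) Y'"
      unfolding S_def
    proof (rule T'.M.finsum_cong')
      show "(\<lambda>y. tens R C P c (p (i q y \<odot>\<^bsub>?FX\<^esub> free_gen R y))) \<in> Y' \<rightarrow> carrier ?T"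
        by (intro Pi_I T.tens_closed[OF c] lin_closed[OF p]) (use fin in auto)
      fix y assume "y \<in> Y'"
      then have y: "y \<in> X" using Y'(3) by auto
      have "s y (t y (tens R C P c q)) = i q y \<odot>\<^bsub>?T\<^esub> tens R C P c (p (free_gen R y))"
        unfolding t_tens[OF c q] s_def by (rule T.tens_smult_left[OF iR[OF q] c pg[OF y]])
      also have "\<dots> = tens R C P c (i q y \<odot>\<^bsub>P\<^esub> p (free_gen R y))"
        by (rule T.tens_smult_right[OF iR[OF q] c pg[OF y], symmetric])
      also have "\<dots> = tens R C P c (p (i q y \<odot>\<^bsub>?FX\<^esub> free_gen R y))"
        using lin_smult[OF p iR[OF q] free_gen_closed[OF cr y]] by simp
      finally show "s y (t y (tens R C P c q)) = tens R C P c (p (i q y \<odot>\<^bsub>?FX\<^esub> free_gen R y))" .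
    qed simp
    also have "\<dots> = tens R C P c (p (finsum ?FX (\<lambda>y. i q y \<odot>\<^bsub>?FX\<^esub> free_gen R y) Y'))"
      by (rule lin_finsum[OF lin_comp[OF p T.tens_lin_right[OF c]] FX.module_axioms
            T.tensor_module fin, symmetric])
    also have "\<dots> = tens R C P c (p (i q))"
      using free_expansion[OF cr iq Y'] by (rule arg_cong[OF sym])
    also have "\<dots> = tens R C P c q" by (simp add: pi[OF q])
    finally show "S Y' (tens R C P c q) = tens R C P c q" .
  qed
  have "submodule ?G R ?T"
  proof (rule submodule_intro[OF T.tensor_module], goal_cases)
    case 2
    have "fixed {} \<zero>\<^bsub>?T\<^esub>"
      unfolding fixed_def using lin_zero[OF S_lin T.tensor_module T.tensor_module] by auto
    then show ?case by auto
  next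
    case (3 v w)
    then have vw: "v \<in> carrier ?T" "w \<in> carrier ?T" by auto
    from 3 obtain Y Z where YZ: "fixed Y v" "fixed Z w" by blast
    have "S Y' (v \<oplus>\<^bsub>?T\<^esub> w) = v \<oplus>\<^bsub>?T\<^esub> w" if "finite Y'" "Y \<union> Z \<subseteq> Y'" "Y' \<subseteq> X" for Y'
    proof -
      have "S Y' v = v" "S Y' w = w" using YZ that unfolding fixed_def by blast+
      then show ?thesis using lin_add[OF S_lin[OF that(3)] vw] by simp
    qed
    then have "fixed (Y \<union> Z) (v \<oplus>\<^bsub>?T\<^esub> w)" using YZ unfolding fixed_def by auto
    then show ?case using vw by auto
  next
    case (4 r w)
    then have w: "w \<in> carrier ?T" by auto
    from 4 obtain Y where Y: "fixed Y w" by blast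
    have "S Y' (r \<odot>\<^bsub>?T\<^esub> w) = r \<odot>\<^bsub>?T\<^esub> w" if "finite Y'" "Y \<subseteq> Y'" "Y' \<subseteq> X" for Y'
    proof -
      have "S Y' w = w" using Y that unfolding fixed_def by blast
      then show ?thesis using lin_smult[OF S_lin[OF that(3)] 4(1) w] by simp
    qed
    then have "fixed Y (r \<odot>\<^bsub>?T\<^esub> w)" using Y unfolding fixed_def by auto
    then show ?case using w 4(1) by auto
  qed auto
  then have "carrier ?T \<subseteq> ?G"
    by (rule T.tensor_generated) (use tens_fixed T.tens_closed in blast)
  then have ex_fixed: "\<exists>Y. fixed Y w" if "w \<in> carrier ?T" for w
    using that by blast
  show ?thesis
    unfolding loc_summand_def
  proof (intro conjI T.tensor_module allI impI)
    fix A assume A: "finite A \<and> A \<subseteq> carrier ?T"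
    then have "\<forall>w\<in>A. \<exists>Y. fixed Y w" using ex_fixed by blast
    from bchoice[OF this] obtain Y where Y: "\<And>w. w \<in> A \<Longrightarrow> fixed (Y w) w" by blast
    let ?Y = "\<Union>(Y ` A)"
    have fY: "finite ?Y" "?Y \<subseteq> X" using A Y by (auto simp: fixed_def)
    have SY: "S ?Y w = w" if "w \<in> A" for w
      using Y[OF that] fY that unfolding fixed_def by blast
    \<comment> \<open>\<open>loc_summand\<close> numbers its maps by an initial segment of the
      naturals.\<close>
    obtain h where h: "bij_betw h {..<card ?Y} ?Y"
      using ex_bij_betw_nat_finite[OF fY(1)] by (auto simp: atLeast0LessThan)
    then have hX: "h j \<in> X" if "j < card ?Y" for j
      using bij_betwE[OF h] that fY(2) by blast
    have "w = finsum ?T (\<lambda>j. s (h j) (t (h j) w)) {..<card ?Y}" if "w \<in> A" for w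
    proof -
      have w: "w \<in> carrier ?T" using A that by auto
      have "S ?Y w = finsum ?T (\<lambda>y. s y (t y w)) (h ` {..<card ?Y})"
        unfolding S_def using h by (simp add: bij_betw_def)
      also have "\<dots> = finsum ?T (\<lambda>j. s (h j) (t (h j) w)) {..<card ?Y}"
        by (rule T'.M.finsum_reindex)
          (use h fY(2) lin_closed[OF s lin_closed[OF t w]] in \<open>auto simp: bij_betw_def\<close>)
      finally show ?thesis using SY[OF that] by simp
    qed
    then show "\<exists>(n :: nat) s t. (\<forall>i<n. lin R C ?T (s i) \<and> lin R ?T C (t i)) \<and>
      (\<forall>w\<in>A. w = finsum ?T (\<lambda>i. s i (t i w)) {..<n})"
      using s[OF hX] t
      by (intro exI[of _ "card ?Y"] exI[of _ "\<lambda>j. s (h j)"] exI[of _ "\<lambda>j. t (h j)"]) auto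
  qed
qed

text \<open>The Hom condition of \<open>GC_projective\<close> tests only modules C \<otimes> P. As a
  retract of one of them, with \<open>U\<close> a copy of R, C inherits the condition. Here s c = c
  \<otimes> 1 and t (c \<otimes> u) = u c.\<close>

lemma retract_of_tensor:
  fixes C :: "('a, 'c) module"
  assumes C: "module R C"
  obtains U :: "('a, ('a + 'x) list) module" and s t
  where "projective R U" "lin R C (tensor R C U) s" "lin R (tensor R C U) C t"
    "\<And>c. c \<in> carrier C \<Longrightarrow> t (s c) = c"
proof -
  interpret C: module R C by (rule C)
  note cr = C.R.is_cring
  let ?S = "self_mod R" and ?F = "free_mod R {0 :: nat}"
  interpret S: module R ?S by (rule self_mod_module[OF cr])
  let ?i = "\<lambda>r x. if x = (0 :: nat) then r else \<zero>\<^bsub>R\<^esub>"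
  have i: "lin R ?S ?F ?i"
    by (auto simp: lin_def self_mod_def free_mod_def fun_eq_iff)
  obtain \<phi> :: "'a \<Rightarrow> ('a + 'x) list" where \<phi>: "inj_on \<phi> (carrier ?S)" "projective R (transport ?S \<phi>)"
    by (rule retract_of_finite_free_projective[OF S.module_axioms _ i eval_lin[OF cr, of _ 0]]) auto
  let ?U = "transport ?S \<phi>"
  note U = transport_module[OF S.module_axioms \<phi>(1)]
  define \<psi> where "\<psi> = the_inv_into (carrier ?S) \<phi>"
  have \<psi>: "lin R ?U ?S \<psi>" unfolding \<psi>_def by (rule lin_inverse[OF U(2,3) S.module_axioms])
  have \<psi>R: "\<psi> u \<in> carrier R" if "u \<in> carrier ?U" for u
    using lin_closed[OF \<psi> that] by (simp add: self_mod_def)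
  have one: "\<one>\<^bsub>R\<^esub> \<in> carrier ?S" by (simp add: self_mod_def)
  have \<psi>1: "\<psi> (\<phi> \<one>\<^bsub>R\<^esub>) = \<one>\<^bsub>R\<^esub>" unfolding \<psi>_def by (rule the_inv_into_f_f[OF \<phi>(1) one])
  interpret T: two_modules R C ?U by (rule two_modules.intro[OF C U(1)])
  have "lin R C C (\<lambda>c. \<psi> u \<odot>\<^bsub>C\<^esub> c)" if "u \<in> carrier ?U" for u
    by (rule smult_lin[OF C \<psi>R[OF that]])
  moreover have "lin R ?U C (\<lambda>u. \<psi> u \<odot>\<^bsub>C\<^esub> c)" if c: "c \<in> carrier C" for c
  proof (rule linI)
    fix u v assume uv: "u \<in> carrier ?U" "v \<in> carrier ?U"
    show "\<psi> u \<odot>\<^bsub>C\<^esub> c \<in> carrier C" using \<psi>R uv c by simp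
    have "\<psi> (u \<oplus>\<^bsub>?U\<^esub> v) = \<psi> u \<oplus>\<^bsub>R\<^esub> \<psi> v" using lin_add[OF \<psi> uv] by (simp add: self_mod_def)
    then show "\<psi> (u \<oplus>\<^bsub>?U\<^esub> v) \<odot>\<^bsub>C\<^esub> c = \<psi> u \<odot>\<^bsub>C\<^esub> c \<oplus>\<^bsub>C\<^esub> \<psi> v \<odot>\<^bsub>C\<^esub> c"
      using \<psi>R uv c by (simp add: C.smult_l_distr)
  next
    fix r u assume ru: "r \<in> carrier R" "u \<in> carrier ?U"
    have "\<psi> (r \<odot>\<^bsub>?U\<^esub> u) = r \<otimes>\<^bsub>R\<^esub> \<psi> u" using lin_smult[OF \<psi> ru] by (simp add: self_mod_def)
    then show "\<psi> (r \<odot>\<^bsub>?U\<^esub> u) \<odot>\<^bsub>C\<^esub> c = r \<odot>\<^bsub>C\<^esub> (\<psi> u \<odot>\<^bsub>C\<^esub> c)"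
      using \<psi>R ru c by (simp add: C.smult_assoc1)
  qed
  ultimately obtain t where t: "lin R (tensor R C ?U) C t"
    "\<And>c u. c \<in> carrier C \<Longrightarrow> u \<in> carrier ?U \<Longrightarrow> t (tens R C ?U c u) = \<psi> u \<odot>\<^bsub>C\<^esub> c"
    using T.tensor_universal[OF C, of "\<lambda>c u. \<psi> u \<odot>\<^bsub>C\<^esub> c"] by blast
  have u: "\<phi> \<one>\<^bsub>R\<^esub> \<in> carrier ?U" by (rule lin_closed[OF U(2) one])
  show thesis
    by (rule that[OF \<phi>(2) T.tens_lin_left[OF u] t(1)]) (use t(2) u \<psi>1 in simp)
qed

section \<open>Coresolutions of \<open>G\<^sub>C\<close>-projective modules\<close>

text \<open>Exactness of 0 -> M -> W -> W' and of Hom(W', C) -> Hom(W, C) -> Hom(M, C) -> 0, stated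
  with elements: the part of a complex as in \<open>GC_projective\<close> on which the proof
  rests.\<close>

definition coresolution ::
  "('a, 'r) ring_scheme \<Rightarrow> ('a, 'c) module \<Rightarrow> ('a, 'b) module \<Rightarrow> ('a, 'w) module \<Rightarrow> ('a, 'w) module
     \<Rightarrow> ('b \<Rightarrow> 'w) \<Rightarrow> ('w \<Rightarrow> 'w) \<Rightarrow> bool"
  where "coresolution R C M W W' \<iota> \<pi> \<longleftrightarrow>
    loc_summand R C W \<and> loc_summand R C W' \<and> lin R M W \<iota> \<and> lin R W W' \<pi> \<and>
    inj_on \<iota> (carrier M) \<and> \<iota> ` carrier M = {w \<in> carrier W. \<pi> w = \<zero>\<^bsub>W'\<^esub>} \<and>
    (\<forall>f. lin R M C f \<longrightarrow> (\<exists>g. lin R W C g \<and> (\<forall>x\<in>carrier M. f x = g (\<iota> x)))) \<and>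
    (\<forall>g. lin R W C g \<and> (\<forall>x\<in>carrier M. g (\<iota> x) = \<zero>\<^bsub>C\<^esub>) \<longrightarrow>
       (\<exists>h. lin R W' C h \<and> (\<forall>w\<in>carrier W. g w = h (\<pi> w))))"

lemma coresolution_iso:
  assumes "coresolution R C M W W' \<iota> \<pi>" "lin R N M \<phi>" "bij_betw \<phi> (carrier N) (carrier M)" "module R N"
  shows "coresolution R C N W W' (\<lambda>x. \<iota> (\<phi> x)) \<pi>"
proof -
  let ?\<psi> = "the_inv_into (carrier N) \<phi>"
  have inj: "inj_on \<phi> (carrier N)" and im: "\<phi> ` carrier N = carrier M"
    using assms(3) by (auto simp: bij_betw_def)
  note \<psi> = lin_inverse[OF assms(2,3,4)]
  have \<psi>\<phi>: "?\<psi> (\<phi> x) = x" if "x \<in> carrier N" for x by (rule the_inv_into_f_f[OF inj that])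
  have \<iota>: "lin R M W \<iota>" "inj_on \<iota> (carrier M)" "\<iota> ` carrier M = {w \<in> carrier W. \<pi> w = \<zero>\<^bsub>W'\<^esub>}"
    using assms(1) by (simp_all add: coresolution_def)
  have ext: "\<exists>g. lin R W C g \<and> (\<forall>x\<in>carrier M. f x = g (\<iota> x))" if "lin R M C f" for f
    using assms(1) that by (simp add: coresolution_def)
  have desc: "\<exists>h. lin R W' C h \<and> (\<forall>w\<in>carrier W. g w = h (\<pi> w))"
    if "lin R W C g" "\<forall>x\<in>carrier M. g (\<iota> x) = \<zero>\<^bsub>C\<^esub>" for g
    using assms(1) that by (simp add: coresolution_def)
  show ?thesis
    unfolding coresolution_def
  proof (intro conjI allI impI)
    show "inj_on (\<lambda>x. \<iota> (\<phi> x)) (carrier N)"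
      using comp_inj_on[OF inj, of \<iota>] \<iota>(2) im by (simp add: comp_def)
    show "(\<lambda>x. \<iota> (\<phi> x)) ` carrier N = {w \<in> carrier W. \<pi> w = \<zero>\<^bsub>W'\<^esub>}"
      using \<iota>(3) im by (metis image_image)
    fix f assume "lin R N C f"
    then have "lin R M C (\<lambda>y. f (?\<psi> y))" by (rule lin_comp[OF \<psi>])
    from ext[OF this] obtain g where g: "lin R W C g" "\<And>x. x \<in> carrier M \<Longrightarrow> f (?\<psi> x) = g (\<iota> x)"
      by blast
    have "f x = g (\<iota> (\<phi> x))" if "x \<in> carrier N" for x
      using g(2)[OF lin_closed[OF assms(2) that]] \<psi>\<phi>[OF that] by simp
    with g(1) show "\<exists>g. lin R W C g \<and> (\<forall>x\<in>carrier N. f x = g (\<iota> (\<phi> x)))" by blast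
  next
    fix g assume "lin R W C g \<and> (\<forall>x\<in>carrier N. g (\<iota> (\<phi> x)) = \<zero>\<^bsub>C\<^esub>)"
    then show "\<exists>h. lin R W' C h \<and> (\<forall>w\<in>carrier W. g w = h (\<pi> w))"
      by (intro desc) (auto simp flip: im)
  qed (use assms(1) lin_comp[OF assms(2) \<iota>(1)] in \<open>simp_all add: coresolution_def\<close>)
qed

text \<open>Exactness at Hom(B, V) in terms of \<open>lin\<close>; \<open>h\<close> has to be
  restricted to the carrier to become an element of \<open>mod_hom\<close>.\<close>

lemma Hom_exactD:
  assumes ex: "exact_at R (Hom_mod R D V) (Hom_map R B D V g) (Hom_mod R B V)
      (Hom_map R A B V f) (Hom_mod R A V)"
    and B: "module R B" and D: "module R D"
    and h: "lin R B V h" "\<And>a. a \<in> carrier A \<Longrightarrow> f a \<in> carrier B"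
      "\<And>a. a \<in> carrier A \<Longrightarrow> h (f a) = \<zero>\<^bsub>V\<^esub>" and g: "\<And>b. b \<in> carrier B \<Longrightarrow> g b \<in> carrier D"
  shows "\<exists>k. lin R D V k \<and> (\<forall>b\<in>carrier B. h b = k (g b))"
proof -
  let ?h = "restrict h (carrier B)"
  have h': "?h \<in> mod_hom R B V" by (rule lin_restrict[OF h(1) B])
  have "Hom_map R A B V f ?h = \<zero>\<^bsub>Hom_mod R A V\<^esub>"
    using h' h(2,3) by (auto simp: Hom_map_def Hom_mod_def fun_eq_iff)
  then have "?h \<in> Hom_map R B D V g ` carrier (Hom_mod R D V)"
    using ex h' unfolding exact_at_def by (auto simp: Hom_mod_def)
  then obtain k where k: "k \<in> mod_hom R D V" "?h = Hom_map R B D V g k"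
    by (auto simp: Hom_mod_def)
  have "h b = k (g b)" if "b \<in> carrier B" for b
    using fun_cong[OF k(2), of b] k(1) that by (simp add: Hom_map_def)
  then show ?thesis using mod_hom_lin[OF k(1)] by blast
qed

text \<open>Factor \<open>s\<close> after \<open>h\<close> through \<open>g\<close>, then apply
  \<open>t\<close>, which undoes \<open>s\<close>.\<close>

lemma Hom_exact_retractD:
  assumes ex: "exact_at R (Hom_mod R D V) (Hom_map R B D V g) (Hom_mod R B V)
      (Hom_map R A B V f) (Hom_mod R A V)"
    and B: "module R B" and D: "module R D" and C: "module R C" and V: "module R V"
    and s: "lin R C V s" and t: "lin R V C t" "\<And>c. c \<in> carrier C \<Longrightarrow> t (s c) = c"
    and h: "lin R B C h" "\<And>a. a \<in> carrier A \<Longrightarrow> f a \<in> carrier B"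
      "\<And>a. a \<in> carrier A \<Longrightarrow> h (f a) = \<zero>\<^bsub>C\<^esub>" and g: "\<And>b. b \<in> carrier B \<Longrightarrow> g b \<in> carrier D"
  shows "\<exists>k. lin R D C k \<and> (\<forall>b\<in>carrier B. h b = k (g b))"
proof -
  have "s (h (f a)) = \<zero>\<^bsub>V\<^esub>" if "a \<in> carrier A" for a
    using h(3)[OF that] lin_zero[OF s C V] by simp
  then obtain k where k: "lin R D V k" "\<And>b. b \<in> carrier B \<Longrightarrow> s (h b) = k (g b)"
    using Hom_exactD[OF ex B D lin_comp[OF h(1) s] h(2) _ g] by blast
  have "h b = t (k (g b))" if "b \<in> carrier B" for b
    using k(2)[OF that] t(2)[OF lin_closed[OF h(1) that]] by simp
  then show ?thesis using lin_comp[OF k(1) t(1)] by blast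
qed

text \<open>Take \<open>W = X (-1)\<close> and \<open>W' = X (-2)\<close>. Exactness makes the image
  of \<open>d 0\<close>, a copy of \<open>M\<close>, the kernel of \<open>d (-1)\<close>. The two
  conditions on maps to C are the Hom exactness at \<open>X 0\<close> and at
  \<open>X (-1)\<close>.\<close>

lemma GC_projective_coresolution:
  fixes C :: "('a, 'c) module" and M :: "('a, 'b) module"
  assumes C: "module R C" and M: "module R M" and GC: "GC_projective TYPE('x) R C M"
  shows "\<exists>(W :: ('a, ('a + 'x) list) module) W' \<iota> \<pi>. coresolution R C M W W' \<iota> \<pi>"
proof -
  from GC obtain X :: "int \<Rightarrow> ('a, ('a + 'x) list) module" and d
    where X: "\<And>n. module R (X n)"
      and CP: "\<And>n. n < 0 \<Longrightarrow> \<exists>P :: ('a, ('a + 'x) list) module.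
          projective R P \<and> mod_isomorphic R (X n) (tensor R C P)"
      and ex: "\<And>n. exact_at R (X (n + 1)) (d (n + 1)) (X n) (d n) (X (n - 1))"
      and iso: "mod_isomorphic R M ((X (-1))\<lparr>carrier := d 0 ` carrier (X 0)\<rparr>)"
      and Hom: "\<And>(P :: ('a, ('a + 'x) list) module) n. projective R P \<Longrightarrow> exact_at R
             (Hom_mod R (X (n - 1)) (tensor R C P))
             (Hom_map R (X n) (X (n - 1)) (tensor R C P) (d n))
             (Hom_mod R (X n) (tensor R C P))
             (Hom_map R (X (n + 1)) (X n) (tensor R C P) (d (n + 1)))
             (Hom_mod R (X (n + 1)) (tensor R C P))"
    unfolding GC_projective_def by blast
  have loc: "loc_summand R C (X n)" if n: "n < 0" for n
  proof -
    obtain P :: "('a, ('a + 'x) list) module" and f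
      where P: "projective R P" and f: "f \<in> mod_iso R (X n) (tensor R C P)"
      using CP[OF n] unfolding mod_isomorphic_def by blast
    have f': "lin R (X n) (tensor R C P) f" "bij_betw f (carrier (X n)) (carrier (tensor R C P))"
      using f by (auto simp: mod_iso_def intro: mod_hom_lin)
    show ?thesis
      by (rule loc_summand_retract[OF tensor_projective_loc_summand[OF C P] X f'(1) lin_inverse[OF f' X]])
        (use f'(2) in \<open>simp add: the_inv_into_f_f bij_betw_def\<close>)
  qed
  have d: "lin R (X n) (X (n - 1)) (d n)" for n
    using ex[of n] by (simp add: exact_at_def mod_hom_lin)
  have im: "d (n + 1) ` carrier (X (n + 1)) = {b \<in> carrier (X n). d n b = \<zero>\<^bsub>X (n - 1)\<^esub>}" for n
    using ex[of n] by (simp add: exact_at_def)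
  obtain U :: "('a, ('a + 'x) list) module" and s t
    where U: "projective R U" "lin R C (tensor R C U) s" "lin R (tensor R C U) C t"
      "\<And>c. c \<in> carrier C \<Longrightarrow> t (s c) = c"
    by (rule retract_of_tensor[OF C, where 'x = 'x]) blast
  have mU: "module R U" using U(1) by (simp add: projective_def)
  interpret T: two_modules R C U by (rule two_modules.intro[OF C mU])
  have Hom_C: "\<exists>k. lin R (X (n - 1)) C k \<and> (\<forall>b\<in>carrier (X n). h b = k (d n b))"
    if "lin R (X n) C h" "\<And>a. a \<in> carrier (X (n + 1)) \<Longrightarrow> h (d (n + 1) a) = \<zero>\<^bsub>C\<^esub>" for h n
    by (rule Hom_exact_retractD[OF Hom[OF U(1)] X X C T.tensor_module U(2-4) that(1) _ that(2)])
      (use lin_closed[OF d] lin_closed[OF d[of "n + 1"]] in auto)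
  let ?I = "d 0 ` carrier (X 0)"
  have d0: "lin R (X 0) (X (-1)) (d 0)" using d[of 0] by simp
  have d1: "lin R (X (-1)) (X (-2)) (d (-1))" using d[of "-1"] by simp
  have im0: "?I = {b \<in> carrier (X (-1)). d (-1) b = \<zero>\<^bsub>X (-2)\<^esub>}" using im[of "-1"] by simp
  let ?M = "(X (-1))\<lparr>carrier := ?I\<rparr>"
  have subI: "submodule ?I R (X (-1))" unfolding im0 by (rule kernel_submodule[OF d1 X X])
  note mI = submodule_module[OF X subI]
  have incl: "lin R ?M (X (-1)) (\<lambda>x. x)" by (rule lin_id_sub) (auto simp: im0)
  have "coresolution R C ?M (X (-1)) (X (-2)) (\<lambda>x. x) (d (-1))"
    unfolding coresolution_def
  proof (intro conjI allI impI loc incl d1)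
    show "(\<lambda>x. x) ` carrier ?M = {w \<in> carrier (X (-1)). d (-1) w = \<zero>\<^bsub>X (-2)\<^esub>}" using im0 by simp
    fix f assume f: "lin R ?M C f"
    have d0': "lin R (X 0) ?M (d 0)" using d0 by (auto simp: lin_def)
    \<comment> \<open>After \<open>d 0\<close>, \<open>f\<close> is a map on \<open>X 0\<close> that
      kills the image of \<open>d 1\<close>; it therefore factors as \<open>d 0\<close> followed by
      a map on all of \<open>X (-1)\<close>.\<close>
    have "f (d 0 (d 1 a)) = \<zero>\<^bsub>C\<^esub>" if "a \<in> carrier (X 1)" for a
    proof -
      have "d 1 a \<in> {b \<in> carrier (X 0). d 0 b = \<zero>\<^bsub>X (-1)\<^esub>}" using im[of 0] that by auto
      then show ?thesis using lin_zero[OF f mI C] by simp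
    qed
    then obtain g where "lin R (X (-1)) C g" "\<forall>b\<in>carrier (X 0). f (d 0 b) = g (d 0 b)"
      using Hom_C[of 0 "\<lambda>x. f (d 0 x)"] lin_comp[OF d0' f] by auto
    then show "\<exists>g. lin R (X (-1)) C g \<and> (\<forall>x\<in>carrier ?M. f x = g x)" by auto
  next
    fix g assume "lin R (X (-1)) C g \<and> (\<forall>x\<in>carrier ?M. g x = \<zero>\<^bsub>C\<^esub>)"
    then show "\<exists>h. lin R (X (-2)) C h \<and> (\<forall>w\<in>carrier (X (-1)). g w = h (d (-1) w))"
      using Hom_C[of "-1" g] by auto
  qed auto
  moreover obtain \<phi> where "lin R M ?M \<phi>" "bij_betw \<phi> (carrier M) (carrier ?M)"
    using iso by (auto simp: mod_isomorphic_def mod_iso_def dest: mod_hom_lin)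
  ultimately have "coresolution R C M (X (-1)) (X (-2)) (\<lambda>x. \<phi> x) (d (-1))"
    using coresolution_iso[OF _ _ _ M] by fast
  then show ?thesis by blast
qed

text \<open>The form in which the hypothesis is applied: \<open>M\<close> may live in any type,
  since a retract of a finite free module has a projective copy in the type over which
  \<open>GC_hereditary\<close> quantifies.\<close>

lemma GC_hereditary_coresolution:
  fixes C :: "('a, 'c) module" and M :: "('a, 'b) module" and X :: "'i set"
  assumes "GC_hereditary TYPE('p) TYPE('x) R C" and C: "module R C" and M: "module R M"
    and "finite X" "lin R M (free_mod R X) i" "lin R (free_mod R X) M q"
    and "\<And>m. m \<in> carrier M \<Longrightarrow> q (i m) = m" and N: "submodule N R M"
  shows "\<exists>(W :: ('a, ('a + 'x) list) module) W' \<iota> \<pi>. coresolution R C (M\<lparr>carrier := N\<rparr>) W W' \<iota> \<pi>"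
proof -
  interpret M: module R M by (rule M)
  obtain \<phi> :: "'b \<Rightarrow> ('a + 'p) list" where \<phi>: "inj_on \<phi> (carrier M)" "projective R (transport M \<phi>)"
    by (rule retract_of_finite_free_projective[OF assms(3-7)]) auto
  let ?T = "transport M \<phi>"
  note T = transport_module[OF M \<phi>(1)]
  have NM: "N \<subseteq> carrier M" by (rule submodule_subset[OF N])
  have N': "submodule (\<phi> ` N) R ?T"
  proof (rule submodule_intro[OF T(1)], goal_cases)
    case 1 show ?case using NM lin_closed[OF T(2)] by auto
  next
    case 2 show ?case using lin_zero[OF T(2) M T(1)] submodule_zero[OF N] by force
  next
    case (3 x y)
    then obtain a b where ab: "x = \<phi> a" "y = \<phi> b" "a \<in> N" "b \<in> N" by blast
    then have "x \<oplus>\<^bsub>?T\<^esub> y = \<phi> (a \<oplus>\<^bsub>M\<^esub> b)" using lin_add[OF T(2)] NM by (simp add: subset_iff)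
    then show ?case using submodule_add[OF N ab(3,4)] by blast
  next
    case (4 r x)
    then obtain a where a: "x = \<phi> a" "a \<in> N" by blast
    then have "r \<odot>\<^bsub>?T\<^esub> x = \<phi> (r \<odot>\<^bsub>M\<^esub> a)" using lin_smult[OF T(2) 4(1)] NM by (simp add: subset_iff)
    then show ?case using submodule_smult[OF N 4(1) a(2)] by blast
  qed
  have "GC_projective TYPE('x) R C (?T\<lparr>carrier := \<phi> ` N\<rparr>)"
    using assms(1) \<phi>(2) N' unfolding GC_hereditary_def by blast
  from GC_projective_coresolution[OF C submodule_module[OF T(1) N'] this]
  obtain W W' :: "('a, ('a + 'x) list) module" and \<iota> \<pi>
    where cor: "coresolution R C (?T\<lparr>carrier := \<phi> ` N\<rparr>) W W' \<iota> \<pi>" by blast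
  have "lin R (M\<lparr>carrier := N\<rparr>) (?T\<lparr>carrier := \<phi> ` N\<rparr>) \<phi>"
    using T(2) NM by (auto simp: lin_def subset_iff)
  moreover have "bij_betw \<phi> (carrier (M\<lparr>carrier := N\<rparr>)) (carrier (?T\<lparr>carrier := \<phi> ` N\<rparr>))"
    using inj_on_subset[OF \<phi>(1) NM] by (simp add: bij_betw_def)
  ultimately show ?thesis
    using coresolution_iso[OF cor _ _ submodule_module[OF M N]] by blast
qed

section \<open>Semidualizing modules\<close>

lemma preimage_submodule:
  assumes "lin R M N f" "module R M" "module R N" "submodule H R N"
  shows "submodule {x \<in> carrier M. f x \<in> H} R M"
proof -
  interpret M: module R M by fact
  show ?thesis
    by (rule submodule_intro[OF assms(2)])
      (use assms submodule_zero[OF assms(4)] submodule_add[OF assms(4)] submodule_smult[OF assms(4)]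
        in \<open>auto simp: lin_zero lin_add lin_smult\<close>)
qed

lemma image_submodule:
  assumes "lin R M N f" "module R M" "module R N"
  shows "submodule (f ` carrier M) R N"
proof -
  interpret M: module R M by fact
  show ?thesis
  proof (rule submodule_intro[OF assms(3)], goal_cases)
    case 1 show ?case using lin_closed[OF assms(1)] by auto
  next
    case 2 show ?case using lin_zero[OF assms] by (metis M.M.zero_closed imageI)
  next
    case (3 x y)
    then obtain a b where "x = f a" "y = f b" "a \<in> carrier M" "b \<in> carrier M" by blast
    then show ?case using lin_add[OF assms(1)] by (intro image_eqI[of _ _ "a \<oplus>\<^bsub>M\<^esub> b"]) auto
  next
    case (4 r x)
    then obtain a where "x = f a" "a \<in> carrier M" by blast
    then show ?case using lin_smult[OF assms(1)] 4(1) by (intro image_eqI[of _ _ "r \<odot>\<^bsub>M\<^esub> a"]) auto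
  qed
qed

lemma free_generated:
  assumes "cring R" "submodule H R (free_mod R X)" "\<And>x. x \<in> X \<Longrightarrow> free_gen R x \<in> H"
  shows "carrier (free_mod R X) \<subseteq> H"
proof
  fix f assume f: "f \<in> carrier (free_mod R X)"
  let ?S = "{x. f x \<noteq> \<zero>\<^bsub>R\<^esub>}"
  have "f = finsum (free_mod R X) (\<lambda>x. f x \<odot>\<^bsub>free_mod R X\<^esub> free_gen R x) ?S"
    by (rule free_expansion) (use free_mod_support[OF f] assms(1) f in auto)
  also have "\<dots> \<in> H"
    by (rule submodule_finsum[OF free_mod_module[OF assms(1)] assms(2)], rule Pi_I,
        rule submodule_smult[OF assms(2) free_mod_carrier_in[OF f] assms(3)])
      (use free_mod_support(1)[OF f] in auto)
  finally show "f \<in> H" .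
qed

text \<open>The homothety isomorphism R = Hom(C, C) by elements: \<open>scalar\<close> is its
  surjectivity, \<open>faithful\<close> its injectivity.\<close>

locale scalar_endo =
  fixes R :: "('a, 'r) ring_scheme" and C :: "('a, 'c) module"
  assumes module_C: "module R C"
    and scalar: "lin R C C g \<Longrightarrow> \<exists>r\<in>carrier R. \<forall>c\<in>carrier C. g c = r \<odot>\<^bsub>C\<^esub> c"
    and faithful: "r \<in> carrier R \<Longrightarrow> (\<And>c. c \<in> carrier C \<Longrightarrow> r \<odot>\<^bsub>C\<^esub> c = \<zero>\<^bsub>C\<^esub>) \<Longrightarrow> r = \<zero>\<^bsub>R\<^esub>"

lemma semidualizing_scalar_endo:
  assumes "semidualizing R C"
  shows "scalar_endo R C"
proof (rule scalar_endo.intro)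
  show C: "module R C" using assms by (simp add: semidualizing_def)
  interpret C: module R C by (rule C)
  have bij: "bij_betw (homothety R C) (carrier R) (mod_hom R C C)"
    using assms by (simp add: semidualizing_def mod_iso_def self_mod_def Hom_mod_def)
  have val: "homothety R C r c = r \<odot>\<^bsub>C\<^esub> c" if "r \<in> carrier R" "c \<in> carrier C" for r c
    using that by (simp add: homothety_def)
  show "\<exists>r\<in>carrier R. \<forall>c\<in>carrier C. g c = r \<odot>\<^bsub>C\<^esub> c" if g: "lin R C C g" for g
  proof -
    obtain r where r: "r \<in> carrier R" "restrict g (carrier C) = homothety R C r"
      using bij lin_restrict[OF g C] unfolding bij_betw_def by blast
    have "g c = r \<odot>\<^bsub>C\<^esub> c" if "c \<in> carrier C" for c
      using fun_cong[OF r(2), of c] that val[OF r(1) that] by simp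
    with r(1) show ?thesis by blast
  qed
  show "r = \<zero>\<^bsub>R\<^esub>" if "r \<in> carrier R" "\<And>c. c \<in> carrier C \<Longrightarrow> r \<odot>\<^bsub>C\<^esub> c = \<zero>\<^bsub>C\<^esub>" for r
  proof -
    have "homothety R C r = homothety R C \<zero>\<^bsub>R\<^esub>"
      using that by (auto simp: homothety_def fun_eq_iff)
    then show ?thesis using bij that(1) by (auto simp: bij_betw_def inj_on_def)
  qed
qed

text \<open>\<open>Ext\<close> is built from a resolution picked by \<open>SOME\<close>, so its
  vanishing speaks about one resolution over which there is no control. That every cocycle on
  \<open>F 1\<close> is a coboundary is therefore stated with \<open>F\<close> existentially
  quantified.\<close>

lemma Ext1_vanishing:
  fixes R :: "('a, 'r) ring_scheme" and C :: "('a, 'c) module"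
  assumes "semidualizing R C"
  shows "\<exists>(F :: nat \<Rightarrow> ('a, ('a + 'c) list) module) d \<epsilon>. projective_resolution R C F d \<epsilon> \<and>
    (\<forall>f. lin R (F 1) C f \<and> (\<forall>x\<in>carrier (F 2). f (d 1 x) = \<zero>\<^bsub>C\<^esub>) \<longrightarrow>
       (\<exists>g. lin R (F 0) C g \<and> (\<forall>x\<in>carrier (F 1). f x = g (d 0 x))))"
proof -
  have C: "module R C" using assms by (simp add: semidualizing_def)
  interpret C: module R C by (rule C)
  let ?res = "\<lambda>(F :: nat \<Rightarrow> ('a, ('a + 'c) list) module, d, \<epsilon>). projective_resolution R C F d \<epsilon>"
  have "\<exists>x. ?res x" using assms unfolding semidualizing_def by auto
  then have "?res (Eps ?res)" by (rule someI_ex)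
  moreover obtain F :: "nat \<Rightarrow> ('a, ('a + 'c) list) module" and d \<epsilon> where Fd: "Eps ?res = (F, d, \<epsilon>)"
    by (metis surj_pair)
  ultimately have res: "projective_resolution R C F d \<epsilon>" by simp
  let ?B = "coboundaries R F d C 1" and ?Z = "(Hom_mod R (F 1) C)\<lparr>carrier := cocycles R F d C 1\<rparr>"
  have "Ext R C C 1 = quot_mod ?Z ?B" unfolding Ext_def Fd by simp
  moreover have "carrier (Ext R C C 1) = {\<zero>\<^bsub>Ext R C C 1\<^esub>}" using assms by (simp add: semidualizing_def)
  \<comment> \<open>The zero of \<open>quot_mod\<close> is the subset itself, so the only coset is
    the set of coboundaries.\<close>
  ultimately have triv: "a_rcosets\<^bsub>?Z\<^esub> ?B = {?B}" by (simp add: quot_mod_def)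
  have mF: "module R (F n)" for n using res by (simp add: projective_resolution_def projective_def)
  have d1: "lin R (F 2) (F 1) (d 1)" and d0: "lin R (F 1) (F 0) (d 0)"
    using res unfolding projective_resolution_def exact_at_def
    by (metis mod_hom_lin add.left_neutral one_add_one)+
  have "\<exists>g. lin R (F 0) C g \<and> (\<forall>x\<in>carrier (F 1). f x = g (d 0 x))"
    if f: "lin R (F 1) C f" "\<forall>x\<in>carrier (F 2). f (d 1 x) = \<zero>\<^bsub>C\<^esub>" for f
  proof -
    let ?f = "restrict f (carrier (F 1))" and ?z = "\<lambda>x\<in>carrier (F 1). \<zero>\<^bsub>C\<^esub>"
    have fh: "?f \<in> mod_hom R (F 1) C" by (rule lin_restrict[OF f(1) mF])
    then have "?f \<in> cocycles R F d C 1"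
      using f(2) lin_closed[OF d1] by (auto simp: cocycles_def Hom_map_def Hom_mod_def fun_eq_iff numeral_2_eq_2)
    then have "?B +>\<^bsub>?Z\<^esub> ?f \<in> a_rcosets\<^bsub>?Z\<^esub> ?B" by (auto simp: A_RCOSETS_def')
    then have coset: "?B +>\<^bsub>?Z\<^esub> ?f = ?B" unfolding triv by simp
    have B: "?B = Hom_map R (F 1) (F 0) C (d 0) ` mod_hom R (F 0) C" by (simp add: coboundaries_def)
    have "(\<lambda>x\<in>carrier (F 0). \<zero>\<^bsub>C\<^esub>) \<in> mod_hom R (F 0) C" by (rule lin_restrict[OF lin_zerof[OF mF C] mF])
    moreover have "?z = Hom_map R (F 1) (F 0) C (d 0) (\<lambda>x\<in>carrier (F 0). \<zero>\<^bsub>C\<^esub>)"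
      using calculation lin_closed[OF d0] by (auto simp: Hom_map_def fun_eq_iff)
    ultimately have "?z \<in> ?B" unfolding B by blast
    \<comment> \<open>The zero map is a coboundary, so f = 0 + f lies in its own coset, which is the
      set of coboundaries.\<close>
    then have "?z \<oplus>\<^bsub>?Z\<^esub> ?f \<in> ?B +>\<^bsub>?Z\<^esub> ?f" by (auto simp: a_r_coset_def')
    moreover have "?z \<oplus>\<^bsub>?Z\<^esub> ?f = ?f"
      using lin_closed[OF f(1)] by (auto simp: Hom_mod_def fun_eq_iff)
    ultimately have "?f \<in> ?B" using coset by simp
    then obtain g where g: "g \<in> mod_hom R (F 0) C" "?f = Hom_map R (F 1) (F 0) C (d 0) g"
      unfolding B by blast
    have "f x = g (d 0 x)" if "x \<in> carrier (F 1)" for x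
      using fun_cong[OF g(2), of x] g(1) that by (simp add: Hom_map_def)
    then show ?thesis using mod_hom_lin[OF g(1)] by blast
  qed
  then show ?thesis using res by blast
qed

text \<open>Ext^1(C, C) = 0, carried from the unknown resolution \<open>F\<close> to a free cover of
  C. Comparison maps \<open>\<sigma>\<close> from \<open>L\<close> to \<open>F 0\<close> and
  \<open>\<tau>\<close> back, both over C, exist by projectivity.\<close>

lemma semidualizing_extension:
  fixes C :: "('a, 'c) module"
  assumes "semidualizing R C" and L_def: "L = free_mod R X"
    and \<epsilon>: "lin R L C \<epsilon>" "\<epsilon> ` carrier L = carrier C"
    and h: "lin R (L\<lparr>carrier := {x \<in> carrier L. \<epsilon> x = \<zero>\<^bsub>C\<^esub>}\<rparr>) C h"
  shows "\<exists>h'. lin R L C h' \<and> (\<forall>x\<in>carrier L. \<epsilon> x = \<zero>\<^bsub>C\<^esub> \<longrightarrow> h x = h' x)"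
proof -
  have C: "module R C" using assms(1) by (simp add: semidualizing_def)
  interpret C: module R C by (rule C)
  have L: "module R L" unfolding L_def by (rule free_mod_module[OF C.R.is_cring])
  interpret L: module R L by (rule L)
  let ?Z = "{x \<in> carrier L. \<epsilon> x = \<zero>\<^bsub>C\<^esub>}"
  note Z = kernel_submodule[OF \<epsilon>(1) L C]
  from Ext1_vanishing[OF assms(1)] obtain F :: "nat \<Rightarrow> ('a, ('a + 'c) list) module" and d \<eta>
    where res: "projective_resolution R C F d \<eta>"
      and ext: "\<And>f. lin R (F 1) C f \<Longrightarrow> (\<And>x. x \<in> carrier (F 2) \<Longrightarrow> f (d 1 x) = \<zero>\<^bsub>C\<^esub>) \<Longrightarrow>
        \<exists>g. lin R (F 0) C g \<and> (\<forall>x\<in>carrier (F 1). f x = g (d 0 x))"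
    by blast
  have pF: "projective R (F n)" and mF: "module R (F n)" for n
    using res by (auto simp: projective_resolution_def projective_def)
  have ex0: "exact_at R (F 1) (d 0) (F 0) \<eta> C" and \<eta>_surj: "\<eta> ` carrier (F 0) = carrier C"
    using res by (auto simp: projective_resolution_def)
  have ex1: "exact_at R (F 2) (d 1) (F 1) (d 0) (F 0)"
    using res unfolding projective_resolution_def by (metis add.left_neutral one_add_one)
  have \<eta>: "lin R (F 0) C \<eta>" and d0: "lin R (F 1) (F 0) (d 0)"
    using ex0 by (auto simp: exact_at_def mod_hom_lin)
  have im0: "d 0 ` carrier (F 1) = {b \<in> carrier (F 0). \<eta> b = \<zero>\<^bsub>C\<^esub>}" using ex0 by (simp add: exact_at_def)
  have im1: "d 1 ` carrier (F 2) = {b \<in> carrier (F 1). d 0 b = \<zero>\<^bsub>F 0\<^esub>}" using ex1 by (simp add: exact_at_def)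
  obtain \<sigma> where \<sigma>: "lin R L (F 0) \<sigma>" "\<And>x. x \<in> carrier L \<Longrightarrow> \<eta> (\<sigma> x) = \<epsilon> x"
    using free_lift[OF mF C \<eta> \<eta>_surj \<epsilon>(1)[unfolded L_def]] unfolding L_def by blast
  obtain \<tau> where \<tau>: "lin R (F 0) L \<tau>" "\<And>x. x \<in> carrier (F 0) \<Longrightarrow> \<epsilon> (\<tau> x) = \<eta> x"
    using projective_lift[OF pF L C \<epsilon> \<eta>] by blast
  have td: "lin R (F 1) (L\<lparr>carrier := ?Z\<rparr>) (\<lambda>x. \<tau> (d 0 x))"
  proof -
    have "\<epsilon> (\<tau> (d 0 x)) = \<zero>\<^bsub>C\<^esub>" if "x \<in> carrier (F 1)" for x
      using \<tau>(2)[OF lin_closed[OF d0 that]] im0 that by auto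
    then show ?thesis using lin_comp[OF d0 \<tau>(1)] by (auto simp: lin_def)
  qed
  \<comment> \<open>So \<open>h\<close> after \<open>\<tau>\<close> and \<open>d 0\<close> is a
    cocycle on \<open>F 1\<close>, and equals some \<open>g\<close> on \<open>F 0\<close> after
    \<open>d 0\<close>.\<close>
  have "h (\<tau> (d 0 (d 1 x))) = \<zero>\<^bsub>C\<^esub>" if "x \<in> carrier (F 2)" for x
  proof -
    have "d 0 (d 1 x) = \<zero>\<^bsub>F 0\<^esub>" using im1 that by auto
    then show ?thesis
      using lin_zero[OF \<tau>(1) mF L] lin_zero[OF h submodule_module[OF L Z] C] by simp
  qed
  then obtain g where g: "lin R (F 0) C g" "\<And>x. x \<in> carrier (F 1) \<Longrightarrow> h (\<tau> (d 0 x)) = g (d 0 x)"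
    using ext[OF lin_comp[OF td h]] by blast
  have gh: "h (\<tau> y) = g y" if "y \<in> carrier (F 0)" "\<eta> y = \<zero>\<^bsub>C\<^esub>" for y
  proof -
    have "y \<in> d 0 ` carrier (F 1)" using im0 that by simp
    then obtain x where x: "x \<in> carrier (F 1)" "y = d 0 x" by (rule imageE)
    then show ?thesis using g(2)[OF x(1)] by simp
  qed
  let ?r = "\<lambda>x. x \<ominus>\<^bsub>L\<^esub> \<tau> (\<sigma> x)"
  have \<tau>\<sigma>: "lin R L L (\<lambda>x. \<tau> (\<sigma> x))" by (rule lin_comp[OF \<sigma>(1) \<tau>(1)])
  have r: "lin R L (L\<lparr>carrier := ?Z\<rparr>) ?r"
  proof -
    have "\<epsilon> (?r x) = \<zero>\<^bsub>C\<^esub>" if x: "x \<in> carrier L" for x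
    proof -
      have "\<epsilon> (?r x) = \<epsilon> x \<ominus>\<^bsub>C\<^esub> \<epsilon> (\<tau> (\<sigma> x))"
        by (rule lin_minus[OF \<epsilon>(1) L C x lin_closed[OF \<tau>\<sigma> x]])
      also have "\<epsilon> (\<tau> (\<sigma> x)) = \<epsilon> x" using \<tau>(2)[OF lin_closed[OF \<sigma>(1) x]] \<sigma>(2)[OF x] by simp
      finally show ?thesis using minus_zero_iff[OF C] lin_closed[OF \<epsilon>(1) x] by simp
    qed
    then show ?thesis using lin_minusf[OF lin_id \<tau>\<sigma> L L] by (auto simp: lin_def)
  qed
  \<comment> \<open>The difference of \<open>x\<close> and \<open>\<tau> (\<sigma> x)\<close> lies
    in the kernel of \<open>\<epsilon>\<close>, where \<open>h\<close> is defined, and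
    \<open>g\<close> takes care of the rest. For \<open>x\<close> in the kernel,
    \<open>\<sigma> x\<close> lies in the kernel of \<open>\<eta>\<close>, where \<open>g\<close>
    agrees with \<open>h\<close> after \<open>\<tau>\<close>, so the sum is
    \<open>h x\<close>.\<close>
  let ?h = "\<lambda>x. h (?r x) \<oplus>\<^bsub>C\<^esub> g (\<sigma> x)"
  have "lin R L C ?h" by (rule lin_addf[OF lin_comp[OF r h] lin_comp[OF \<sigma>(1) g(1)] L C])
  moreover have "h x = ?h x" if x: "x \<in> carrier L" "\<epsilon> x = \<zero>\<^bsub>C\<^esub>" for x
  proof -
    have s: "\<sigma> x \<in> carrier (F 0)" "\<eta> (\<sigma> x) = \<zero>\<^bsub>C\<^esub>" using lin_closed[OF \<sigma>(1)] \<sigma>(2) x by auto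
    have t: "\<tau> (\<sigma> x) \<in> ?Z" using lin_closed[OF \<tau>(1) s(1)] \<tau>(2)[OF s(1)] s(2) by simp
    have rx: "?r x \<in> ?Z" using lin_closed[OF r x(1)] by simp
    have "x = ?r x \<oplus>\<^bsub>L\<^esub> \<tau> (\<sigma> x)" using x(1) t by (simp add: a_minus_def L.M.a_assoc L.M.l_neg)
    then have "h x = h (?r x \<oplus>\<^bsub>L\<^esub> \<tau> (\<sigma> x))" by (rule arg_cong)
    also have "\<dots> = h (?r x) \<oplus>\<^bsub>C\<^esub> h (\<tau> (\<sigma> x))" using lin_add[OF h] rx t by simp
    finally show ?thesis using gh[OF s] by simp
  qed
  ultimately show ?thesis by blast
qed

text \<open>A free module of finite rank covers \<open>F 0\<close> by a map p that splits by
  \<open>\<sigma>\<close>. The kernel of \<open>\<eta>\<close> after p is the kernel of p, which is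
  the image of x - \<sigma> (p x), plus \<open>\<sigma>\<close> of the kernel of
  \<open>\<eta>\<close>, which is the image of the finitely generated \<open>F 1\<close>.\<close>

lemma semidualizing_presentation:
  fixes C :: "('a, 'c) module"
  assumes "semidualizing R C"
  obtains l :: nat and \<epsilon> G
  where "lin R (free_mod R {..<l}) C \<epsilon>" "\<epsilon> ` carrier (free_mod R {..<l}) = carrier C"
    "finite G" "G \<subseteq> {x \<in> carrier (free_mod R {..<l}). \<epsilon> x = \<zero>\<^bsub>C\<^esub>}"
    "{x \<in> carrier (free_mod R {..<l}). \<epsilon> x = \<zero>\<^bsub>C\<^esub>} \<subseteq> mod_span R (free_mod R {..<l}) G"
proof -
  have C: "module R C" using assms by (simp add: semidualizing_def)
  interpret C: module R C by (rule C)
  note cr = C.R.is_cring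
  from assms obtain F :: "nat \<Rightarrow> ('a, ('a + 'c) list) module" and d \<eta>
    where res: "projective_resolution R C F d \<eta>" and fg: "\<And>n. fin_gen R (F n)"
    unfolding semidualizing_def by blast
  have pF: "projective R (F n)" and mF: "module R (F n)" for n
    using res by (auto simp: projective_resolution_def projective_def)
  have ex0: "exact_at R (F 1) (d 0) (F 0) \<eta> C" and \<eta>_surj: "\<eta> ` carrier (F 0) = carrier C"
    using res by (auto simp: projective_resolution_def)
  have \<eta>: "lin R (F 0) C \<eta>" and d0: "lin R (F 1) (F 0) (d 0)"
    using ex0 by (auto simp: exact_at_def mod_hom_lin)
  have im0: "d 0 ` carrier (F 1) = {b \<in> carrier (F 0). \<eta> b = \<zero>\<^bsub>C\<^esub>}" using ex0 by (simp add: exact_at_def)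
  obtain S where S: "finite S" "S \<subseteq> carrier (F 0)" "mod_span R (F 0) S = carrier (F 0)"
    using fg[of 0] unfolding fin_gen_def by blast
  obtain T where T: "finite T" "T \<subseteq> carrier (F 1)" "mod_span R (F 1) T = carrier (F 1)"
    using fg[of 1] unfolding fin_gen_def by blast
  obtain g where "bij_betw g {0..<card S} S" using ex_bij_betw_nat_finite[OF S(1)] by blast
  then have g: "g ` {..<card S} = S" by (auto simp: bij_betw_def atLeast0LessThan)
  let ?I = "{..<card S}"
  let ?L = "free_mod R ?I"
  interpret L: module R ?L by (rule free_mod_module[OF cr])
  interpret F0: module R "F 0" by (rule mF)
  have gv: "g \<in> ?I \<rightarrow> carrier (F 0)" using g S(2) by auto
  let ?p = "free_ext R (F 0) g"
  note p = free_ext_lin[OF mF gv]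
  have p_surj: "?p ` carrier ?L = carrier (F 0)"
  proof
    show "?p ` carrier ?L \<subseteq> carrier (F 0)" using lin_closed[OF p] by auto
    have "s \<in> ?p ` carrier ?L" if "s \<in> S" for s
    proof -
      have "s \<in> g ` ?I" using g that by simp
      then obtain j where j: "s = g j" "j \<in> ?I" by (rule imageE)
      then have "s = ?p (free_gen R j)" using free_ext_gen[OF mF gv j(2)] by simp
      then show ?thesis using free_gen_closed[OF cr j(2)] by (rule image_eqI)
    qed
    then have "S \<subseteq> ?p ` carrier ?L" by (rule subsetI)
    from mod_span_le[OF image_submodule[OF p L.module_axioms mF] this]
    show "carrier (F 0) \<subseteq> ?p ` carrier ?L" unfolding S(3) .
  qed
  obtain \<sigma> where \<sigma>: "lin R (F 0) ?L \<sigma>" "\<And>x. x \<in> carrier (F 0) \<Longrightarrow> ?p (\<sigma> x) = x"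
    by (rule projective_lift[OF pF[of 0] L.module_axioms mF p p_surj lin_id]) (rule that)
  let ?\<epsilon> = "\<lambda>x. \<eta> (?p x)"
  let ?Z = "{x \<in> carrier ?L. ?\<epsilon> x = \<zero>\<^bsub>C\<^esub>}"
  have \<epsilon>: "lin R ?L C ?\<epsilon>" by (rule lin_comp[OF p \<eta>])
  have \<epsilon>_surj: "?\<epsilon> ` carrier ?L = carrier C"
    unfolding image_image[of \<eta> ?p, symmetric] p_surj by (rule \<eta>_surj)
  let ?q = "\<lambda>x. x \<ominus>\<^bsub>?L\<^esub> \<sigma> (?p x)"
  have \<sigma>p: "lin R ?L ?L (\<lambda>x. \<sigma> (?p x))" by (rule lin_comp[OF p \<sigma>(1)])
  have q: "lin R ?L ?L ?q" by (rule lin_minusf[OF lin_id \<sigma>p L.module_axioms L.module_axioms])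
  have q_ker: "?p (?q x) = \<zero>\<^bsub>F 0\<^esub>" if x: "x \<in> carrier ?L" for x
  proof -
    have "?p (?q x) = ?p x \<ominus>\<^bsub>F 0\<^esub> ?p (\<sigma> (?p x))"
      by (rule lin_minus[OF p L.module_axioms mF x lin_closed[OF \<sigma>p x]])
    then show ?thesis using \<sigma>(2) minus_zero_iff[OF mF] lin_closed[OF p x] by simp
  qed
  have \<sigma>d: "lin R (F 1) ?L (\<lambda>y. \<sigma> (d 0 y))" by (rule lin_comp[OF d0 \<sigma>(1)])
  let ?G = "(\<lambda>j. ?q (free_gen R j)) ` ?I \<union> (\<lambda>y. \<sigma> (d 0 y)) ` T"
  have GZ: "?G \<subseteq> ?Z"
  proof -
    have "?q (free_gen R j) \<in> ?Z" if "j \<in> ?I" for j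
      using lin_closed[OF q] q_ker free_gen_closed[OF cr that] lin_zero[OF \<eta> mF C] by simp
    moreover have "\<sigma> (d 0 y) \<in> ?Z" if "y \<in> T" for y
    proof -
      have y: "y \<in> carrier (F 1)" using that T(2) by auto
      have dy: "d 0 y \<in> carrier (F 0)" "\<eta> (d 0 y) = \<zero>\<^bsub>C\<^esub>" using im0 y by auto
      then show ?thesis using lin_closed[OF \<sigma>(1)] \<sigma>(2) by simp
    qed
    ultimately show ?thesis by blast
  qed
  have "?Z \<subseteq> mod_span R ?L ?G" (is "_ \<subseteq> ?N")
  proof
    fix x assume x: "x \<in> ?Z"
    have GL: "?G \<subseteq> carrier ?L" using GZ by auto
    note N = mod_span_submodule[OF L.module_axioms GL]
    have GN: "?G \<subseteq> ?N" by (rule subset_mod_span)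
    have "carrier ?L \<subseteq> {x \<in> carrier ?L. ?q x \<in> ?N}"
      by (rule free_generated[OF cr preimage_submodule[OF q L.module_axioms L.module_axioms N]])
        (use GN free_gen_closed[OF cr, of _ ?I] in auto)
    then have qx: "?q x \<in> ?N" using x by auto
    have "mod_span R (F 1) T \<subseteq> {y \<in> carrier (F 1). \<sigma> (d 0 y) \<in> ?N}"
      by (rule mod_span_le[OF preimage_submodule[OF \<sigma>d mF L.module_axioms N]]) (use T(2) GN in auto)
    moreover have "?p x \<in> d 0 ` carrier (F 1)" using im0 x lin_closed[OF p] by simp
    then obtain y where "?p x = d 0 y" "y \<in> carrier (F 1)" by (rule imageE)
    ultimately have sx: "\<sigma> (?p x) \<in> ?N" using T(3) by auto
    have "x = ?q x \<oplus>\<^bsub>?L\<^esub> \<sigma> (?p x)"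
      using x lin_closed[OF \<sigma>p] by (simp add: a_minus_def L.M.a_assoc L.M.l_neg)
    then show "x \<in> ?N" using submodule_add[OF N qx sx] by simp
  qed
  then show thesis using that[OF \<epsilon> \<epsilon>_surj _ GZ] S(1) T(1) by blast
qed

section \<open>Finitely generated modules with a coresolution\<close>

text \<open>The decomposition holds at the images of finitely many generators; both sides are linear
  in \<open>x\<close>, so it holds on all of \<open>M\<close>.\<close>

lemma loc_summand_fin_gen:
  assumes "loc_summand R C W" "module R C" "module R M" "fin_gen R M" "lin R M W f"
  shows "\<exists>(n :: nat) s t. (\<forall>i<n. lin R C W (s i) \<and> lin R W C (t i)) \<and>
    (\<forall>x\<in>carrier M. finsum W (\<lambda>i. s i (t i (f x))) {..<n} = f x)"
proof -
  obtain S where S: "finite S" "S \<subseteq> carrier M" "mod_span R M S = carrier M"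
    using assms(4) unfolding fin_gen_def by blast
  have W: "module R W" by (rule loc_summand_module[OF assms(1)])
  have "finite (f ` S)" "f ` S \<subseteq> carrier W" using S lin_closed[OF assms(5)] by auto
  from loc_summandD[OF assms(1) this] obtain n :: nat and s t
    where st: "\<forall>i<n. lin R C W (s i) \<and> lin R W C (t i)"
      and sum: "\<forall>w\<in>f ` S. w = finsum W (\<lambda>i. s i (t i w)) {..<n}"
    by (elim exE conjE)
  have "lin R M W (\<lambda>x. finsum W (\<lambda>i. s i (t i (f x))) {..<n})"
    by (rule lin_finsumf[OF lin_comp[OF assms(5) lin_comp] assms(3) W]) (use st in auto)
  note eq = lin_eq_on_span[OF assms(5) this assms(3) W S(3,2)]
  have "\<forall>x\<in>carrier M. finsum W (\<lambda>i. s i (t i (f x))) {..<n} = f x"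
    by (intro ballI eq[symmetric]) (rule bspec[OF sum], simp)
  with st show ?thesis by (intro exI conjI)
qed

context scalar_endo
begin

lemma scalar_family:
  assumes "\<And>i. i \<in> A \<Longrightarrow> lin R C C (g i)"
  shows "\<exists>r\<in>A \<rightarrow> carrier R. \<forall>i\<in>A. \<forall>c\<in>carrier C. g i c = r i \<odot>\<^bsub>C\<^esub> c"
proof -
  have "\<forall>i\<in>A. \<exists>r. r \<in> carrier R \<and> (\<forall>c\<in>carrier C. g i c = r \<odot>\<^bsub>C\<^esub> c)"
    using scalar[OF assms] by blast
  from bchoice[OF this] obtain r
    where r: "\<forall>i\<in>A. r i \<in> carrier R \<and> (\<forall>c\<in>carrier C. g i c = r i \<odot>\<^bsub>C\<^esub> c)" by (elim exE)
  show ?thesis by (rule bexI[of _ r]) (use r in auto)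
qed

text \<open>The \<open>\<tau> i\<close> are coordinates of \<open>\<iota>\<close>: its values
  decompose as sum s_i (t_i (\<iota> x)), and \<tau>_i = t_i \<iota>. They generate Hom(M, C) and
  separate points. The last clause is reflexivity: a family \<open>v\<close> satisfying every linear
  relation among the \<open>\<tau> i\<close> is a linear map Hom(M, C) -> C, and this map is
  evaluation at some \<open>u\<close>.\<close>

lemma fin_gen_coresolution_forms:
  assumes M: "module R M" "fin_gen R M" and cor: "coresolution R C M W W' \<iota> \<pi>"
  obtains m :: nat and \<tau> where "\<And>i. i < m \<Longrightarrow> lin R M C (\<tau> i)"
    "\<And>f. lin R M C f \<Longrightarrow> \<exists>r\<in>{..<m} \<rightarrow> carrier R. \<forall>x\<in>carrier M. f x = finsum C (\<lambda>i. r i \<odot>\<^bsub>C\<^esub> \<tau> i x) {..<m}"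
    "\<And>x. x \<in> carrier M \<Longrightarrow> (\<And>i. i < m \<Longrightarrow> \<tau> i x = \<zero>\<^bsub>C\<^esub>) \<Longrightarrow> x = \<zero>\<^bsub>M\<^esub>"
    "\<And>v. v \<in> {..<m} \<rightarrow> carrier C \<Longrightarrow>
      (\<And>r. r \<in> {..<m} \<rightarrow> carrier R \<Longrightarrow> (\<And>x. x \<in> carrier M \<Longrightarrow> finsum C (\<lambda>i. r i \<odot>\<^bsub>C\<^esub> \<tau> i x) {..<m} = \<zero>\<^bsub>C\<^esub>) \<Longrightarrow>
        finsum C (\<lambda>i. r i \<odot>\<^bsub>C\<^esub> v i) {..<m} = \<zero>\<^bsub>C\<^esub>) \<Longrightarrow>
      \<exists>u\<in>carrier M. \<forall>i<m. v i = \<tau> i u"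
proof -
  interpret C: module R C by (rule module_C)
  interpret M: module R M by (rule M(1))
  have loc: "loc_summand R C W" "loc_summand R C W'" and \<iota>: "lin R M W \<iota>" "inj_on \<iota> (carrier M)"
    and \<pi>: "lin R W W' \<pi>" and im: "\<iota> ` carrier M = {w \<in> carrier W. \<pi> w = \<zero>\<^bsub>W'\<^esub>}"
    using cor by (simp_all add: coresolution_def)
  have ext: "\<exists>g. lin R W C g \<and> (\<forall>x\<in>carrier M. f x = g (\<iota> x))" if "lin R M C f" for f
    using cor that by (simp add: coresolution_def)
  have W: "module R W" "module R W'" using loc by (simp_all add: loc_summand_module)
  interpret W: module R W by (rule W(1))
  interpret W': module R W' by (rule W(2))
  from loc_summand_fin_gen[OF loc(1) module_C M \<iota>(1)] obtain m :: nat and s t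
    where "\<forall>i<m. lin R C W (s i) \<and> lin R W C (t i)"
      and \<iota>_sum: "\<forall>x\<in>carrier M. finsum W (\<lambda>i. s i (t i (\<iota> x))) {..<m} = \<iota> x"
    by (elim exE conjE)
  then have s: "lin R C W (s i)" and t: "lin R W C (t i)" if "i < m" for i
    using that by auto
  let ?\<tau> = "\<lambda>i x. t i (\<iota> x)"
  have \<tau>: "lin R M C (?\<tau> i)" if "i < m" for i by (rule lin_comp[OF \<iota>(1) t[OF that]])
  have s_closed: "s i c \<in> carrier W" if "i < m" "c \<in> carrier C" for i c
    by (rule lin_closed[OF s[OF that(1)] that(2)])
  have \<tau>_closed: "?\<tau> i x \<in> carrier C" if "i < m" "x \<in> carrier M" for i x
    by (rule lin_closed[OF \<tau>[OF that(1)] that(2)])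
  \<comment> \<open>For \<open>g\<close> on \<open>W\<close> the maps \<open>g\<close> after
    \<open>s i\<close> are endomorphisms of C, hence scalars \<open>r i\<close>; they compute
    \<open>g\<close> on every sum of values of the \<open>s i\<close>.\<close>
  have push: "g (finsum W (\<lambda>i. s i (v i)) {..<m}) = finsum C (\<lambda>i. r i \<odot>\<^bsub>C\<^esub> v i) {..<m}"
    if g: "lin R W C g" and r: "r \<in> {..<m} \<rightarrow> carrier R"
      "\<forall>i\<in>{..<m}. \<forall>c\<in>carrier C. g (s i c) = r i \<odot>\<^bsub>C\<^esub> c"
      and v: "\<And>i. i < m \<Longrightarrow> v i \<in> carrier C" for g r v
  proof -
    have "g (finsum W (\<lambda>i. s i (v i)) {..<m}) = finsum C (\<lambda>i. g (s i (v i))) {..<m}"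
      by (rule lin_finsum[OF g W(1) module_C]) (use s_closed v in auto)
    also have "\<dots> = finsum C (\<lambda>i. r i \<odot>\<^bsub>C\<^esub> v i) {..<m}"
      by (rule C.M.finsum_cong') (use r v in auto)
    finally show ?thesis .
  qed
  have coeffs: "\<exists>r\<in>{..<m} \<rightarrow> carrier R. \<forall>i\<in>{..<m}. \<forall>c\<in>carrier C. g (s i c) = r i \<odot>\<^bsub>C\<^esub> c"
    if "lin R W C g" for g
    by (rule scalar_family, rule lin_comp[OF s that]) simp
  show thesis
  proof (rule that[OF \<tau>])
    fix f assume "lin R M C f"
    then obtain g where g: "lin R W C g" "\<And>x. x \<in> carrier M \<Longrightarrow> f x = g (\<iota> x)" using ext by blast
    from coeffs[OF g(1)] obtain r where r: "\<forall>i\<in>{..<m}. \<forall>c\<in>carrier C. g (s i c) = r i \<odot>\<^bsub>C\<^esub> c"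
      "r \<in> {..<m} \<rightarrow> carrier R" by (rule bexE)
    have "f x = finsum C (\<lambda>i. r i \<odot>\<^bsub>C\<^esub> ?\<tau> i x) {..<m}" if x: "x \<in> carrier M" for x
    proof -
      have "g (\<iota> x) = g (finsum W (\<lambda>i. s i (t i (\<iota> x))) {..<m})"
        using \<iota>_sum x by simp
      also have "\<dots> = finsum C (\<lambda>i. r i \<odot>\<^bsub>C\<^esub> ?\<tau> i x) {..<m}"
        by (rule push[OF g(1) r(2,1) \<tau>_closed[OF _ x]])
      finally show ?thesis using g(2)[OF x] by simp
    qed
    with r(2) show "\<exists>r\<in>{..<m} \<rightarrow> carrier R. \<forall>x\<in>carrier M. f x = finsum C (\<lambda>i. r i \<odot>\<^bsub>C\<^esub> ?\<tau> i x) {..<m}"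
      by blast
  next
    fix x assume x: "x \<in> carrier M" and 0: "\<And>i. i < m \<Longrightarrow> ?\<tau> i x = \<zero>\<^bsub>C\<^esub>"
    have "finsum W (\<lambda>i. s i (t i (\<iota> x))) {..<m} = \<zero>\<^bsub>W\<^esub>"
      by (rule W.M.add.finprod_one_eqI) (use 0 lin_zero[OF s module_C W(1)] in auto)
    then have "\<iota> x = \<zero>\<^bsub>W\<^esub>" using \<iota>_sum x by simp
    then have "\<iota> x = \<iota> \<zero>\<^bsub>M\<^esub>" using lin_zero[OF \<iota>(1) M(1) W(1)] by simp
    then show "x = \<zero>\<^bsub>M\<^esub>" using \<iota>(2) x by (auto simp: inj_on_def)
  next
    fix v assume v: "v \<in> {..<m} \<rightarrow> carrier C"
      and rel: "\<And>r. r \<in> {..<m} \<rightarrow> carrier R \<Longrightarrow>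
        (\<And>x. x \<in> carrier M \<Longrightarrow> finsum C (\<lambda>i. r i \<odot>\<^bsub>C\<^esub> ?\<tau> i x) {..<m} = \<zero>\<^bsub>C\<^esub>) \<Longrightarrow>
        finsum C (\<lambda>i. r i \<odot>\<^bsub>C\<^esub> v i) {..<m} = \<zero>\<^bsub>C\<^esub>"
    have vC: "v i \<in> carrier C" if "i < m" for i using v that by auto
    \<comment> \<open>The candidate for \<open>\<iota> u\<close>. Maps to C separate the points of
      \<open>W'\<close>, and after \<open>\<pi>\<close> they all kill the image of \<open>M\<close>;
      so once \<open>vanish\<close> is known, \<open>\<pi>\<close> kills this element.\<close>
    let ?w = "finsum W (\<lambda>i. s i (v i)) {..<m}"
    have w: "?w \<in> carrier W" by (rule W.M.finsum_closed) (use s_closed vC in auto)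
    \<comment> \<open>If \<open>g\<close> vanishes on the image of \<open>M\<close>, its scalars
      form a relation among the \<open>\<tau> i\<close>, which \<open>v\<close> satisfies.\<close>
    have vanish: "g ?w = \<zero>\<^bsub>C\<^esub>" if g: "lin R W C g" and g0: "\<And>x. x \<in> carrier M \<Longrightarrow> g (\<iota> x) = \<zero>\<^bsub>C\<^esub>" for g
    proof -
      from coeffs[OF g] obtain r where r: "\<forall>i\<in>{..<m}. \<forall>c\<in>carrier C. g (s i c) = r i \<odot>\<^bsub>C\<^esub> c"
        "r \<in> {..<m} \<rightarrow> carrier R" by (rule bexE)
      have "finsum C (\<lambda>i. r i \<odot>\<^bsub>C\<^esub> ?\<tau> i x) {..<m} = \<zero>\<^bsub>C\<^esub>" if x: "x \<in> carrier M" for x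
      proof -
        have "finsum C (\<lambda>i. r i \<odot>\<^bsub>C\<^esub> ?\<tau> i x) {..<m} = g (finsum W (\<lambda>i. s i (t i (\<iota> x))) {..<m})"
          by (rule push[OF g r(2,1) \<tau>_closed[OF _ x], symmetric])
        also have "\<dots> = g (\<iota> x)"
          using \<iota>_sum x by simp
        finally show ?thesis using g0[OF x] by simp
      qed
      from rel[OF r(2) this] show ?thesis using push[OF g r(2,1) vC] by simp
    qed
    have "\<pi> ?w = \<zero>\<^bsub>W'\<^esub>"
    proof -
      have "finite {\<pi> ?w}" "{\<pi> ?w} \<subseteq> carrier W'" using lin_closed[OF \<pi> w] by auto
      from loc_summandD[OF loc(2) this] obtain n :: nat and s' t'
        where st': "\<forall>i<n. lin R C W' (s' i) \<and> lin R W' C (t' i)"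
          and sum: "\<forall>w\<in>{\<pi> ?w}. w = finsum W' (\<lambda>i. s' i (t' i w)) {..<n}"
        by (elim exE conjE)
      have "t' j (\<pi> ?w) = \<zero>\<^bsub>C\<^esub>" if j: "j < n" for j
      proof (rule vanish[OF lin_comp[OF \<pi>]])
        show t': "lin R W' C (t' j)" using st' j by simp
        fix x assume "x \<in> carrier M"
        then have "\<pi> (\<iota> x) = \<zero>\<^bsub>W'\<^esub>" using im by auto
        then show "t' j (\<pi> (\<iota> x)) = \<zero>\<^bsub>C\<^esub>" using lin_zero[OF t' W(2) module_C] by simp
      qed
      then have "finsum W' (\<lambda>i. s' i (t' i (\<pi> ?w))) {..<n} = \<zero>\<^bsub>W'\<^esub>"
        by (intro W'.M.add.finprod_one_eqI) (use st' lin_zero[OF _ module_C W(2)] in auto)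
      with bspec[OF sum, of "\<pi> ?w"] show ?thesis by (simp only: singleton_iff simp_thms)
    qed
    then have "?w \<in> \<iota> ` carrier M" using im w by simp
    then obtain u where u: "?w = \<iota> u" "u \<in> carrier M" by (rule imageE)
    have "v i = ?\<tau> i u" if i: "i < m" for i
    proof -
      from coeffs[OF t[OF i]] obtain r where r: "\<forall>j\<in>{..<m}. \<forall>c\<in>carrier C. t i (s j c) = r j \<odot>\<^bsub>C\<^esub> c"
        "r \<in> {..<m} \<rightarrow> carrier R" by (rule bexE)
      \<comment> \<open>With \<open>r j\<close> the scalar of \<open>t i\<close> after
        \<open>s j\<close>, decomposing \<open>\<iota> x\<close> gives \<tau>_i = sum r_j \<tau>_j.
        So r - \<delta> is a relation, \<open>v\<close> satisfies it, and v_i = sum r_j v_j = t_i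
        (\<iota> u) = \<tau>_i u.\<close>
      let ?\<delta> = "\<lambda>j. if j = i then \<one>\<^bsub>R\<^esub> else \<zero>\<^bsub>R\<^esub>"
      let ?d = "\<lambda>j. r j \<oplus>\<^bsub>R\<^esub> \<ominus>\<^bsub>R\<^esub> ?\<delta> j"
      have split: "finsum C (\<lambda>j. ?d j \<odot>\<^bsub>C\<^esub> c j) {..<m} = finsum C (\<lambda>j. r j \<odot>\<^bsub>C\<^esub> c j) {..<m} \<ominus>\<^bsub>C\<^esub> c i"
        if c: "\<And>j. j < m \<Longrightarrow> c j \<in> carrier C" for c
      proof -
        have "finsum C (\<lambda>j. ?d j \<odot>\<^bsub>C\<^esub> c j) {..<m}
          = finsum C (\<lambda>j. r j \<odot>\<^bsub>C\<^esub> c j \<oplus>\<^bsub>C\<^esub> (\<ominus>\<^bsub>R\<^esub> \<one>\<^bsub>R\<^esub>) \<odot>\<^bsub>C\<^esub> (?\<delta> j \<odot>\<^bsub>C\<^esub> c j)) {..<m}"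
        proof (rule C.M.finsum_cong', goal_cases)
          case 2 show ?case using r c by (auto simp: Pi_iff)
        next
          case (3 j)
          then show ?case using r c
            by (simp add: C.smult_l_distr C.smult_l_minus Pi_iff)
        qed simp
        also have "\<dots> = finsum C (\<lambda>j. r j \<odot>\<^bsub>C\<^esub> c j) {..<m} \<oplus>\<^bsub>C\<^esub>
            finsum C (\<lambda>j. (\<ominus>\<^bsub>R\<^esub> \<one>\<^bsub>R\<^esub>) \<odot>\<^bsub>C\<^esub> (?\<delta> j \<odot>\<^bsub>C\<^esub> c j)) {..<m}"
          by (rule C.M.finsum_addf) (use r c in \<open>auto simp: Pi_iff\<close>)
        also have "finsum C (\<lambda>j. (\<ominus>\<^bsub>R\<^esub> \<one>\<^bsub>R\<^esub>) \<odot>\<^bsub>C\<^esub> (?\<delta> j \<odot>\<^bsub>C\<^esub> c j)) {..<m}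
          = (\<ominus>\<^bsub>R\<^esub> \<one>\<^bsub>R\<^esub>) \<odot>\<^bsub>C\<^esub> finsum C (\<lambda>j. ?\<delta> j \<odot>\<^bsub>C\<^esub> c j) {..<m}"
          by (rule C.finsum_smult_ldistr[symmetric]) (use c in \<open>auto simp: Pi_iff\<close>)
        also have "finsum C (\<lambda>j. ?\<delta> j \<odot>\<^bsub>C\<^esub> c j) {..<m} = c i"
          by (rule finsum_delta[OF module_C]) (use i c in auto)
        finally show ?thesis using c[OF i] by (simp add: C.smult_l_minus a_minus_def)
      qed
      have "finsum C (\<lambda>j. ?d j \<odot>\<^bsub>C\<^esub> ?\<tau> j x) {..<m} = \<zero>\<^bsub>C\<^esub>" if x: "x \<in> carrier M" for x
      proof -
        have "finsum C (\<lambda>j. r j \<odot>\<^bsub>C\<^esub> ?\<tau> j x) {..<m} = t i (finsum W (\<lambda>i. s i (t i (\<iota> x))) {..<m})"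
          by (rule push[OF t[OF i] r(2,1) \<tau>_closed[OF _ x], symmetric])
        also have "\<dots> = ?\<tau> i x"
          using \<iota>_sum x by simp
        finally show ?thesis
          using split[OF \<tau>_closed[OF _ x]] minus_zero_iff[OF module_C] \<tau>_closed[OF i x] by simp
      qed
      moreover have "?d \<in> {..<m} \<rightarrow> carrier R" using r(2) by (auto simp: Pi_iff)
      ultimately have "finsum C (\<lambda>j. ?d j \<odot>\<^bsub>C\<^esub> v j) {..<m} = \<zero>\<^bsub>C\<^esub>" by (intro rel)
      then have "finsum C (\<lambda>j. r j \<odot>\<^bsub>C\<^esub> v j) {..<m} = v i"
        using split[OF vC] minus_zero_iff[OF module_C _ vC[OF i]] r(2) vC
        by (simp add: Pi_iff)
      then show ?thesis using push[of "t i" r v, OF t[OF i] r(2,1) vC] u(1) by simp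
    qed
    with u(2) show "\<exists>u\<in>carrier M. \<forall>i<m. v i = ?\<tau> i u" by blast
  qed
qed

end

section \<open>Relations of a finitely generated ideal\<close>

text \<open>Here \<open>L \<rightarrow> C\<close> has the finitely generated kernel spanned by \<open>G\<close>, and \<open>F\<close> stands for \<open>L\<^sup>n\<close>. The
  submodule \<open>KH\<close> of \<open>F\<close> below is the kernel of \<open>L\<^sup>n \<rightarrow> C\<^sup>n \<rightarrow> C\<^sup>n / Hom(I, C)\<close>.\<close>

locale relation_module = scalar_endo R C
  for R :: "('a, 'r) ring_scheme" and C :: "('a, 'c) module" +
  fixes L :: "('a, 'l) module" and \<epsilon> :: "'l \<Rightarrow> 'c" and G :: "'l set"
    and F :: "('a, 'f) module" and inc :: "nat \<Rightarrow> 'l \<Rightarrow> 'f" and slice :: "nat \<Rightarrow> 'f \<Rightarrow> 'l"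
    and A :: "'j set" and \<alpha> :: "'j \<Rightarrow> 'f \<Rightarrow> 'c"
    and I :: "('a, 'i) module" and n :: nat and a :: "nat \<Rightarrow> 'i"
  assumes module_L: "module R L" and module_F: "module R F" and module_I: "module R I"
    and \<epsilon>_lin: "lin R L C \<epsilon>" and \<epsilon>_surj: "\<epsilon> ` carrier L = carrier C"
    and finite_G: "finite G" and G_sub: "G \<subseteq> {x \<in> carrier L. \<epsilon> x = \<zero>\<^bsub>C\<^esub>}"
    and G_span: "{x \<in> carrier L. \<epsilon> x = \<zero>\<^bsub>C\<^esub>} \<subseteq> mod_span R L G"
    and extension: "lin R (L\<lparr>carrier := {x \<in> carrier L. \<epsilon> x = \<zero>\<^bsub>C\<^esub>}\<rparr>) C h \<Longrightarrow>
      \<exists>h'. lin R L C h' \<and> (\<forall>x\<in>carrier L. \<epsilon> x = \<zero>\<^bsub>C\<^esub> \<longrightarrow> h x = h' x)"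
    and inc_lin: "k < n \<Longrightarrow> lin R L F (inc k)" and slice_lin: "k < n \<Longrightarrow> lin R F L (slice k)"
    and slice_inc: "k < n \<Longrightarrow> j < n \<Longrightarrow> y \<in> carrier L \<Longrightarrow>
      slice j (inc k y) = (if j = k then y else \<zero>\<^bsub>L\<^esub>)"
    and inc_slice: "x \<in> carrier F \<Longrightarrow> finsum F (\<lambda>k. inc k (slice k x)) {..<n} = x"
    and fin_gen_F: "fin_gen R F"
    and finite_A: "finite A" and \<alpha>_lin: "i \<in> A \<Longrightarrow> lin R F C (\<alpha> i)"
    and \<alpha>_gen: "lin R F C f \<Longrightarrow>
      \<exists>r\<in>A \<rightarrow> carrier R. \<forall>x\<in>carrier F. finsum C (\<lambda>i. r i \<odot>\<^bsub>C\<^esub> \<alpha> i x) A = f x"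
    and a_closed: "a \<in> {..<n} \<rightarrow> carrier I"
    and a_gen: "free_ext R I a ` carrier (free_mod R {..<n}) = carrier I"
begin

section \<open>Projections to C^n and maps with coefficients in R^n\<close>

sublocale C: module R C by (rule module_C)
sublocale L: module R L by (rule module_L)
sublocale F: module R F by (rule module_F)
sublocale I: module R I by (rule module_I)
sublocale Rn: module R "free_mod R {..<n}" by (rule free_mod_module[OF C.R.is_cring])

abbreviation "Rn \<equiv> free_mod R {..<n}"
abbreviation "Z \<equiv> {x \<in> carrier L. \<epsilon> x = \<zero>\<^bsub>C\<^esub>}"

definition "proj k x = \<epsilon> (slice k x)"

text \<open>Hom(I, C) sits in C^n by g -> (g (a k)), the \<open>a k\<close> being generators of
  \<open>I\<close>.\<close>

definition "KH = {x \<in> carrier F. \<exists>g. lin R I C g \<and> (\<forall>k<n. proj k x = g (a k))}"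

abbreviation "MH \<equiv> F\<lparr>carrier := KH\<rparr>"

lemma proj_lin: "k < n \<Longrightarrow> lin R F C (proj k)"
  unfolding proj_def by (rule lin_comp[OF slice_lin \<epsilon>_lin])

lemma proj_closed: "k < n \<Longrightarrow> x \<in> carrier F \<Longrightarrow> proj k x \<in> carrier C"
  by (rule lin_closed[OF proj_lin])

lemma proj_inc: "k < n \<Longrightarrow> j < n \<Longrightarrow> y \<in> carrier L \<Longrightarrow>
    proj j (inc k y) = (if j = k then \<epsilon> y else \<zero>\<^bsub>C\<^esub>)"
  using slice_inc lin_zero[OF \<epsilon>_lin module_L module_C] by (simp add: proj_def)

lemma a_in: "k < n \<Longrightarrow> a k \<in> carrier I"
  using a_closed by auto

lemma proj_surj:
  assumes "\<And>k. k < n \<Longrightarrow> c k \<in> carrier C"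
  shows "\<exists>x\<in>carrier F. \<forall>k<n. proj k x = c k"
proof -
  have "\<forall>k\<in>{..<n}. \<exists>y. y \<in> carrier L \<and> \<epsilon> y = c k"
  proof
    fix k assume "k \<in> {..<n}"
    then have "c k \<in> \<epsilon> ` carrier L" using assms \<epsilon>_surj by simp
    then obtain y where "c k = \<epsilon> y" "y \<in> carrier L" by (rule imageE)
    then show "\<exists>y. y \<in> carrier L \<and> \<epsilon> y = c k" by (intro exI[of _ y]) simp
  qed
  from bchoice[OF this] obtain y where y: "\<forall>k\<in>{..<n}. y k \<in> carrier L \<and> \<epsilon> (y k) = c k"
    by (elim exE)
  have incy: "inc k (y k) \<in> carrier F" if "k < n" for k
    using lin_closed[OF inc_lin[OF that]] y that by simp
  let ?x = "finsum F (\<lambda>k. inc k (y k)) {..<n}"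
  have "proj j ?x = c j" if j: "j < n" for j
  proof -
    have "proj j ?x = finsum C (\<lambda>k. proj j (inc k (y k))) {..<n}"
      by (rule lin_finsum[OF proj_lin[OF j] module_F module_C]) (use incy in auto)
    also have "\<dots> = finsum C (\<lambda>k. if j = k then c k else \<zero>\<^bsub>C\<^esub>) {..<n}"
      by (rule C.M.finsum_cong') (use y j assms in \<open>auto simp: proj_inc\<close>)
    also have "\<dots> = c j" by (rule C.M.add.finprod_singleton) (use j assms in auto)
    finally show ?thesis .
  qed
  moreover have "?x \<in> carrier F" by (rule F.M.finsum_closed) (use incy in auto)
  ultimately show ?thesis by blast
qed

lemma KH_submodule: "submodule KH R F"
proof (rule submodule_intro[OF module_F], goal_cases)
  case 1 show ?case by (auto simp: KH_def)
next
  case 2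
  have "proj k \<zero>\<^bsub>F\<^esub> = \<zero>\<^bsub>C\<^esub>" if "k < n" for k by (rule lin_zero[OF proj_lin[OF that] module_F module_C])
  then show ?case unfolding KH_def using lin_zerof[OF module_I module_C] by auto
next
  case (3 x y)
  then obtain g h where g: "lin R I C g" "\<forall>k<n. proj k x = g (a k)"
    and h: "lin R I C h" "\<forall>k<n. proj k y = h (a k)" unfolding KH_def by blast
  have xy: "x \<in> carrier F" "y \<in> carrier F" using 3 by (auto simp: KH_def)
  have "\<forall>k<n. proj k (x \<oplus>\<^bsub>F\<^esub> y) = g (a k) \<oplus>\<^bsub>C\<^esub> h (a k)"
    using g(2) h(2) by (simp add: lin_add[OF proj_lin] xy)
  with lin_addf[OF g(1) h(1) module_I module_C] xy show ?case
    unfolding KH_def by (intro CollectI conjI exI[of _ "\<lambda>u. g u \<oplus>\<^bsub>C\<^esub> h u"]) auto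
next
  case (4 r x)
  then obtain g where g: "lin R I C g" "\<forall>k<n. proj k x = g (a k)" unfolding KH_def by blast
  have x: "x \<in> carrier F" using 4 by (auto simp: KH_def)
  have "\<forall>k<n. proj k (r \<odot>\<^bsub>F\<^esub> x) = r \<odot>\<^bsub>C\<^esub> g (a k)"
    using g(2) by (simp add: lin_smult[OF proj_lin] x 4(1))
  with lin_smultf[OF g(1) 4(1) module_I module_C] x 4(1) show ?case
    unfolding KH_def by (intro CollectI conjI exI[of _ "\<lambda>u. r \<odot>\<^bsub>C\<^esub> g u"]) auto
qed

lemma KH_sub: "KH \<subseteq> carrier F"
  by (rule submodule_subset[OF KH_submodule])

lemma module_MH: "module R MH"
  by (rule submodule_module[OF module_F KH_submodule])

lemma KH_kernelI:
  assumes "x \<in> carrier F" "\<And>k. k < n \<Longrightarrow> proj k x = \<zero>\<^bsub>C\<^esub>"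
  shows "x \<in> KH"
  unfolding KH_def using assms lin_zerof[OF module_I module_C] by auto

lemma inc_Z: "k < n \<Longrightarrow> z \<in> Z \<Longrightarrow> inc k z \<in> KH"
  using proj_inc lin_closed[OF inc_lin] by (intro KH_kernelI) auto

text \<open>The kernel of F -> C^n is the sum of n copies of \<open>Z\<close>, and \<open>G\<close>
  generates each copy.\<close>

lemma kernel_generated:
  assumes x: "x \<in> carrier F" "\<And>k. k < n \<Longrightarrow> proj k x = \<zero>\<^bsub>C\<^esub>"
    and N: "submodule N R F" "\<And>k z. k < n \<Longrightarrow> z \<in> G \<Longrightarrow> inc k z \<in> N"
  shows "x \<in> N"
proof -
  have "inc k (slice k x) \<in> N" if k: "k < n" for k
  proof -
    have "slice k x \<in> Z"
      using x(2)[OF k] lin_closed[OF slice_lin[OF k] x(1)] by (simp add: proj_def)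
    moreover have "mod_span R L G \<subseteq> {y \<in> carrier L. inc k y \<in> N}"
      by (rule mod_span_le[OF preimage_submodule[OF inc_lin[OF k] module_L module_F N(1)]])
        (use G_sub N(2)[OF k] in auto)
    ultimately show ?thesis using G_span by blast
  qed
  then have "finsum F (\<lambda>k. inc k (slice k x)) {..<n} \<in> N"
    by (intro submodule_finsum[OF module_F N(1)]) auto
  then show ?thesis using inc_slice[OF x(1)] by simp
qed

text \<open>The map C^n -> C with coefficients \<open>r\<close>, pulled back to \<open>F\<close>.
  Since R = Hom(C, C), these are the maps F -> C that factor through C^n. The detour by
  \<open>free_ext\<close> gives linearity in \<open>r\<close> at once.\<close>

definition "form r x = free_ext R C (\<lambda>k. proj k x) r"

lemma form_eq:
  assumes "r \<in> carrier Rn" "x \<in> carrier F"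
  shows "form r x = finsum C (\<lambda>k. r k \<odot>\<^bsub>C\<^esub> proj k x) {..<n}"
  unfolding form_def
  by (rule free_ext_eq[OF module_C _ assms(1)])
    (use proj_closed assms(2) free_mod_support[OF assms(1)] in auto)

lemma form_coeff_lin: "x \<in> carrier F \<Longrightarrow> lin R Rn C (\<lambda>r. form r x)"
  unfolding form_def by (rule free_ext_lin[OF module_C]) (use proj_closed in auto)

lemma form_lin:
  assumes r: "r \<in> carrier Rn"
  shows "lin R F C (form r)"
proof -
  have "lin R F C (\<lambda>x. finsum C (\<lambda>k. r k \<odot>\<^bsub>C\<^esub> proj k x) {..<n})"
    by (rule lin_finsumf[OF lin_smultf[OF proj_lin free_mod_carrier_in[OF r] module_F module_C]
          module_F module_C]) simp
  then show ?thesis by (rule lin_cong[OF _ module_F]) (rule form_eq[OF r])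
qed

lemma ideal_sum:
  assumes r: "r \<in> carrier Rn" and g: "lin R I C g"
  shows "g (free_ext R I a r) = finsum C (\<lambda>k. r k \<odot>\<^bsub>C\<^esub> g (a k)) {..<n}"
proof -
  have "free_ext R I a r = finsum I (\<lambda>k. r k \<odot>\<^bsub>I\<^esub> a k) {..<n}"
    by (rule free_ext_eq[OF module_I a_closed r]) (use free_mod_support[OF r] in auto)
  also have "g \<dots> = finsum C (\<lambda>k. g (r k \<odot>\<^bsub>I\<^esub> a k)) {..<n}"
    by (rule lin_finsum[OF g module_I module_C]) (use a_in free_mod_carrier_in[OF r] in auto)
  also have "\<dots> = finsum C (\<lambda>k. r k \<odot>\<^bsub>C\<^esub> g (a k)) {..<n}"
    by (rule C.M.finsum_cong')
      (use a_in free_mod_carrier_in[OF r] lin_closed[OF g] lin_smult[OF g] in auto)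
  finally show ?thesis .
qed

text \<open>On a point over g in Hom(I, C), the sum of the r_k g (a_k) is g (sum r_k a_k). Hence
  relations among the \<open>a k\<close> give maps that vanish on \<open>KH\<close>.\<close>

lemma form_KH:
  assumes r: "r \<in> carrier Rn" and x: "x \<in> carrier F" and g: "lin R I C g" "\<forall>k<n. proj k x = g (a k)"
  shows "form r x = g (free_ext R I a r)"
  unfolding form_eq[OF r x] ideal_sum[OF r g(1)]
  by (rule C.M.finsum_cong') (use g a_in free_mod_carrier_in[OF r] lin_closed[OF g(1)] in auto)

text \<open>Points with a single nonzero projection c give r_j c = 0 for every c in C, and C is
  faithful.\<close>

lemma form_inj:
  assumes r: "r \<in> carrier Rn" and 0: "\<And>x. x \<in> carrier F \<Longrightarrow> form r x = \<zero>\<^bsub>C\<^esub>"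
  shows "r = \<zero>\<^bsub>Rn\<^esub>"
proof -
  have rR: "r k \<in> carrier R" for k by (rule free_mod_carrier_in[OF r])
  have "r j = \<zero>\<^bsub>R\<^esub>" if j: "j < n" for j
  proof (rule faithful[OF rR])
    fix c assume c: "c \<in> carrier C"
    have "\<exists>x\<in>carrier F. \<forall>k<n. proj k x = (if j = k then c else \<zero>\<^bsub>C\<^esub>)"
      by (rule proj_surj) (use c in auto)
    then obtain x where x: "\<forall>k<n. proj k x = (if j = k then c else \<zero>\<^bsub>C\<^esub>)" "x \<in> carrier F"
      by (rule bexE)
    have "form r x = finsum C (\<lambda>k. if j = k then r k \<odot>\<^bsub>C\<^esub> c else \<zero>\<^bsub>C\<^esub>) {..<n}"
      unfolding form_eq[OF r x(2)] by (rule C.M.finsum_cong') (use x(1) c rR in auto)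
    also have "\<dots> = r j \<odot>\<^bsub>C\<^esub> c" by (rule C.M.add.finprod_singleton) (use j c rR in auto)
    finally show "r j \<odot>\<^bsub>C\<^esub> c = \<zero>\<^bsub>C\<^esub>" using 0[OF x(2)] by simp
  qed
  moreover have "r j = \<zero>\<^bsub>R\<^esub>" if "\<not> j < n" for j
    using r that by (auto simp: free_mod_def)
  ultimately show ?thesis by (auto simp: free_mod_def fun_eq_iff)
qed

end

text \<open>Joins the outcome of \<open>fin_gen_coresolution_forms\<close> for \<open>I\<close> to
  the data of the relations.\<close>

locale ideal_forms = relation_module R C L \<epsilon> G F inc slice A \<alpha> I n a
  for R :: "('a, 'r) ring_scheme" and C :: "('a, 'c) module" and L :: "('a, 'l) module" and \<epsilon> G
    and F :: "('a, 'f) module" and inc slice and A :: "'j set" and \<alpha>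
    and I :: "('a, 'i) module" and n a +
  fixes m :: nat and \<tau> :: "nat \<Rightarrow> 'i \<Rightarrow> 'c"
  assumes \<tau>_lin: "i < m \<Longrightarrow> lin R I C (\<tau> i)"
    and \<tau>_gen: "lin R I C f \<Longrightarrow>
      \<exists>r\<in>{..<m} \<rightarrow> carrier R. \<forall>x\<in>carrier I. f x = finsum C (\<lambda>i. r i \<odot>\<^bsub>C\<^esub> \<tau> i x) {..<m}"
    and \<tau>_inj: "u \<in> carrier I \<Longrightarrow> (\<And>i. i < m \<Longrightarrow> \<tau> i u = \<zero>\<^bsub>C\<^esub>) \<Longrightarrow> u = \<zero>\<^bsub>I\<^esub>"
    \<comment> \<open>\<open>v\<close> lists the values on \<open>\<tau>\<close> of a linear map \<open>Hom(I, C) \<rightarrow> C\<close>\<close>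
    and \<tau>_reflexive: "v \<in> {..<m} \<rightarrow> carrier C \<Longrightarrow>
      (\<And>r. r \<in> {..<m} \<rightarrow> carrier R \<Longrightarrow>
        (\<And>x. x \<in> carrier I \<Longrightarrow> finsum C (\<lambda>i. r i \<odot>\<^bsub>C\<^esub> \<tau> i x) {..<m} = \<zero>\<^bsub>C\<^esub>) \<Longrightarrow>
        finsum C (\<lambda>i. r i \<odot>\<^bsub>C\<^esub> v i) {..<m} = \<zero>\<^bsub>C\<^esub>) \<Longrightarrow>
      \<exists>u\<in>carrier I. \<forall>i<m. v i = \<tau> i u"
begin

section \<open>Generators of \<open>KH\<close>, and maps from \<open>KH\<close> to C\<close>

lemma lifts: "\<exists>\<xi>. \<forall>i<m. \<xi> i \<in> carrier F \<and> (\<forall>k<n. proj k (\<xi> i) = \<tau> i (a k))"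
proof -
  have "\<exists>x. x \<in> carrier F \<and> (\<forall>k<n. proj k x = \<tau> i (a k))" if "i < m" for i
    using proj_surj[of "\<lambda>k. \<tau> i (a k)"] lin_closed[OF \<tau>_lin[OF that] a_in] by blast
  then show ?thesis by (intro choice) blast
qed

text \<open>One choice of lifts to \<open>F\<close> of the generators of Hom(I, C), fixed because
  several lemmas refer to the same lifts.\<close>

definition "\<xi> = (SOME \<xi>. \<forall>i<m. \<xi> i \<in> carrier F \<and> (\<forall>k<n. proj k (\<xi> i) = \<tau> i (a k)))"

lemma \<xi>: "i < m \<Longrightarrow> \<xi> i \<in> carrier F" "i < m \<Longrightarrow> k < n \<Longrightarrow> proj k (\<xi> i) = \<tau> i (a k)"
  using someI_ex[OF lifts, folded \<xi>_def] by auto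

lemma \<xi>_KH: "i < m \<Longrightarrow> \<xi> i \<in> KH"
  unfolding KH_def using \<xi> \<tau>_lin by blast

definition "comb r = finsum F (\<lambda>i. r i \<odot>\<^bsub>F\<^esub> \<xi> i) {..<m}"

lemma comb_KH: "r \<in> {..<m} \<rightarrow> carrier R \<Longrightarrow> comb r \<in> KH"
  unfolding comb_def
  by (intro submodule_finsum[OF module_F KH_submodule] Pi_I submodule_smult[OF KH_submodule] \<xi>_KH) auto

lemma proj_comb:
  assumes r: "r \<in> {..<m} \<rightarrow> carrier R" and k: "k < n"
  shows "proj k (comb r) = finsum C (\<lambda>i. r i \<odot>\<^bsub>C\<^esub> \<tau> i (a k)) {..<m}"
proof -
  have rR: "r i \<in> carrier R" if "i < m" for i using r that by auto
  have "proj k (comb r) = finsum C (\<lambda>i. proj k (r i \<odot>\<^bsub>F\<^esub> \<xi> i)) {..<m}"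
    unfolding comb_def by (rule lin_finsum[OF proj_lin[OF k] module_F module_C]) (use rR \<xi>(1) in auto)
  also have "\<dots> = finsum C (\<lambda>i. r i \<odot>\<^bsub>C\<^esub> \<tau> i (a k)) {..<m}"
    by (rule C.M.finsum_cong')
      (use rR \<xi> k a_in lin_closed[OF \<tau>_lin] lin_smult[OF proj_lin[OF k]] in auto)
  finally show ?thesis .
qed

text \<open>Both \<open>x\<close> and \<open>comb r\<close> lie over the same map \<open>g\<close>
  on \<open>I\<close>, so they have equal projections.\<close>

lemma KH_decomposition:
  assumes x: "x \<in> carrier F" and g: "lin R I C g" "\<forall>k<n. proj k x = g (a k)"
    and r: "r \<in> {..<m} \<rightarrow> carrier R" "\<forall>u\<in>carrier I. g u = finsum C (\<lambda>i. r i \<odot>\<^bsub>C\<^esub> \<tau> i u) {..<m}"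
    and k: "k < n"
  shows "proj k (x \<ominus>\<^bsub>F\<^esub> comb r) = \<zero>\<^bsub>C\<^esub>"
proof -
  have c: "comb r \<in> carrier F" using comb_KH[OF r(1)] KH_sub by blast
  have "proj k x = proj k (comb r)" using proj_comb[OF r(1) k] g(2) r(2) a_in[OF k] k by simp
  then show ?thesis
    using minus_zero_iff[OF module_C proj_closed[OF k x] proj_closed[OF k c]]
    by (simp only: lin_minus[OF proj_lin[OF k] module_F module_C x c])
qed

lemma F_split: "x \<in> carrier F \<Longrightarrow> y \<in> carrier F \<Longrightarrow> (x \<ominus>\<^bsub>F\<^esub> y) \<oplus>\<^bsub>F\<^esub> y = x"
  by (simp add: a_minus_def F.M.a_assoc F.M.l_neg)

text \<open>\<open>KH\<close> is an extension of Hom(I, C) by the kernel of F -> C^n: lifts of the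
  \<open>\<tau> i\<close> and the copies of \<open>G\<close> generate it together.\<close>

lemma KH_fin_gen: "fin_gen R MH"
proof (rule fin_genI[OF module_MH])
  let ?S = "\<xi> ` {..<m} \<union> (\<lambda>(k, z). inc k z) ` ({..<n} \<times> G)"
  show "finite ?S" using finite_G by simp
  show "?S \<subseteq> carrier MH" using \<xi>_KH inc_Z G_sub by auto
  fix N assume N: "submodule N R MH" "?S \<subseteq> N"
  have NF: "submodule N R F" by (rule submodule_trans[OF module_F KH_submodule N(1)])
  show "carrier MH \<subseteq> N"
  proof
    fix x assume "x \<in> carrier MH"
    then obtain g where x: "x \<in> carrier F" and g: "lin R I C g" "\<forall>k<n. proj k x = g (a k)"
      by (auto simp: KH_def)
    obtain r where r: "\<forall>u\<in>carrier I. g u = finsum C (\<lambda>i. r i \<odot>\<^bsub>C\<^esub> \<tau> i u) {..<m}"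
      "r \<in> {..<m} \<rightarrow> carrier R"
      using \<tau>_gen[OF g(1)] by (rule bexE)
    have c: "comb r \<in> carrier F" using comb_KH[OF r(2)] KH_sub by blast
    have "comb r \<in> N"
      unfolding comb_def
      by (intro submodule_finsum[OF module_F NF] Pi_I submodule_smult[OF NF]) (use r(2) N(2) in auto)
    moreover have "x \<ominus>\<^bsub>F\<^esub> comb r \<in> N"
      by (rule kernel_generated[OF _ KH_decomposition[OF x g r(2,1)] NF]) (use x c N(2) in auto)
    ultimately show "x \<in> N" using submodule_add[OF NF] F_split[OF x c] by metis
  qed
qed

text \<open>This is Ext^1(H, C) = 0. On the copies of \<open>Z\<close>, \<open>h\<close> extends
  because Ext^1(C, C) = 0; the remainder is a linear map Hom(I, C) -> C, which reflexivity of
  \<open>I\<close> realises by coefficients in R^n.\<close>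

lemma KH_extension:
  assumes h: "lin R MH C h"
  shows "\<exists>h'. lin R F C h' \<and> (\<forall>x\<in>KH. h x = h' x)"
proof -
  have "\<forall>k\<in>{..<n}. \<exists>\<phi>. lin R L C \<phi> \<and> (\<forall>z\<in>carrier L. \<epsilon> z = \<zero>\<^bsub>C\<^esub> \<longrightarrow> h (inc k z) = \<phi> z)"
  proof
    fix k assume "k \<in> {..<n}"
    then have k: "k < n" by simp
    have "lin R (L\<lparr>carrier := Z\<rparr>) MH (inc k)"
      using inc_lin[OF k] inc_Z[OF k] by (auto simp: lin_def)
    from extension[OF lin_comp[OF this h]]
    show "\<exists>\<phi>. lin R L C \<phi> \<and> (\<forall>z\<in>carrier L. \<epsilon> z = \<zero>\<^bsub>C\<^esub> \<longrightarrow> h (inc k z) = \<phi> z)" .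
  qed
  from bchoice[OF this] obtain \<phi> where \<phi>: "\<forall>k\<in>{..<n}. lin R L C (\<phi> k) \<and>
      (\<forall>z\<in>carrier L. \<epsilon> z = \<zero>\<^bsub>C\<^esub> \<longrightarrow> h (inc k z) = \<phi> k z)" by (elim exE)
  let ?h1 = "\<lambda>x. finsum C (\<lambda>k. \<phi> k (slice k x)) {..<n}"
  have h1: "lin R F C ?h1"
    by (rule lin_finsumf[OF lin_comp[OF slice_lin] module_F module_C]) (use \<phi> in auto)
  have h1': "lin R MH C ?h1" by (rule lin_sub[OF h1 KH_sub])
  have h_h1: "h x = ?h1 x" if x: "x \<in> carrier F" "\<And>k. k < n \<Longrightarrow> proj k x = \<zero>\<^bsub>C\<^esub>" for x
  proof -
    have sZ: "slice k x \<in> Z" if "k < n" for k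
      using x(2)[OF that] lin_closed[OF slice_lin[OF that] x(1)] by (simp add: proj_def)
    have i: "(\<lambda>k. inc k (slice k x)) \<in> {..<n} \<rightarrow> KH" using inc_Z sZ by blast
    have "h x = h (finsum MH (\<lambda>k. inc k (slice k x)) {..<n})"
      using finsum_sub[OF module_F KH_submodule i] inc_slice[OF x(1)] by simp
    also have "\<dots> = finsum C (\<lambda>k. h (inc k (slice k x))) {..<n}"
      by (rule lin_finsum[OF h module_MH module_C]) (use i in simp)
    also have "\<dots> = ?h1 x"
    proof (rule C.M.finsum_cong')
      show "(\<lambda>k. \<phi> k (slice k x)) \<in> {..<n} \<rightarrow> carrier C"
        using \<phi> sZ lin_closed by fastforce
      show "h (inc k (slice k x)) = \<phi> k (slice k x)" if "k \<in> {..<n}" for k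
        using \<phi> that sZ[of k] by simp
    qed simp
    finally show ?thesis .
  qed
  let ?h2 = "\<lambda>x. h x \<ominus>\<^bsub>C\<^esub> ?h1 x"
  have h2: "lin R MH C ?h2" by (rule lin_minusf[OF h h1' module_MH module_C])
  have hC: "h x \<in> carrier C" "?h1 x \<in> carrier C" "?h2 x \<in> carrier C" if "x \<in> KH" for x
    using lin_closed[OF h, of x] lin_closed[OF h1', of x] lin_closed[OF h2, of x] that by simp_all
  have h2_0: "?h2 x = \<zero>\<^bsub>C\<^esub>" if x: "x \<in> carrier F" "\<And>k. k < n \<Longrightarrow> proj k x = \<zero>\<^bsub>C\<^esub>" for x
    using h_h1[OF x] minus_zero_iff[OF module_C hC(1,2)] KH_kernelI[OF x] by blast
  \<comment> \<open>The values at the \<open>\<tau> i\<close> of the map that the remainder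
    \<open>?h2\<close> induces on Hom(I, C). A relation among the \<open>\<tau> i\<close> puts
    \<open>comb r\<close> into the kernel of F -> C^n, where \<open>?h2\<close> vanishes, so
    \<open>v\<close> satisfies it.\<close>
  define v where "v i = ?h2 (\<xi> i)" for i
  have v: "v \<in> {..<m} \<rightarrow> carrier C" using hC(3) \<xi>_KH by (auto simp: v_def)
  have h2_comb: "?h2 (comb r) = finsum C (\<lambda>i. r i \<odot>\<^bsub>C\<^esub> v i) {..<m}"
    if r: "r \<in> {..<m} \<rightarrow> carrier R" for r
  proof -
    have s: "r i \<odot>\<^bsub>F\<^esub> \<xi> i \<in> KH" if "i < m" for i
      using submodule_smult[OF KH_submodule _ \<xi>_KH] r that by auto
    have "?h2 (comb r) = ?h2 (finsum MH (\<lambda>i. r i \<odot>\<^bsub>F\<^esub> \<xi> i) {..<m})"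
      unfolding comb_def using finsum_sub[OF module_F KH_submodule, of "\<lambda>i. r i \<odot>\<^bsub>F\<^esub> \<xi> i" "{..<m}"] s
      by (simp add: Pi_iff)
    also have "\<dots> = finsum C (\<lambda>i. ?h2 (r i \<odot>\<^bsub>F\<^esub> \<xi> i)) {..<m}"
      by (rule lin_finsum[OF h2 module_MH module_C]) (use s in auto)
    also have "\<dots> = finsum C (\<lambda>i. r i \<odot>\<^bsub>C\<^esub> v i) {..<m}"
    proof (rule C.M.finsum_cong')
      show "(\<lambda>i. r i \<odot>\<^bsub>C\<^esub> v i) \<in> {..<m} \<rightarrow> carrier C" using r v by auto
      show "?h2 (r i \<odot>\<^bsub>F\<^esub> \<xi> i) = r i \<odot>\<^bsub>C\<^esub> v i" if "i \<in> {..<m}" for i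
        using lin_smult[OF h2, of "r i" "\<xi> i"] r that \<xi>_KH[of i] unfolding v_def by auto
    qed simp
    finally show ?thesis .
  qed
  have "finsum C (\<lambda>i. r i \<odot>\<^bsub>C\<^esub> v i) {..<m} = \<zero>\<^bsub>C\<^esub>"
    if r: "r \<in> {..<m} \<rightarrow> carrier R"
      "\<And>x. x \<in> carrier I \<Longrightarrow> finsum C (\<lambda>i. r i \<odot>\<^bsub>C\<^esub> \<tau> i x) {..<m} = \<zero>\<^bsub>C\<^esub>" for r
  proof -
    have "?h2 (comb r) = \<zero>\<^bsub>C\<^esub>"
      by (rule h2_0) (use comb_KH[OF r(1)] KH_sub proj_comb[OF r(1)] r(2)[OF a_in] in auto)
    then show ?thesis using h2_comb[OF r(1)] by simp
  qed
  from \<tau>_reflexive[OF v this] obtain u where u: "\<forall>i<m. v i = \<tau> i u" "u \<in> carrier I" by (rule bexE)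
  have "u \<in> free_ext R I a ` carrier Rn" using u(2) a_gen by simp
  then obtain b where b: "u = free_ext R I a b" "b \<in> carrier Rn" by (rule imageE)
  \<comment> \<open>Here u = sum b_k a_k, so over g the value of \<open>form b\<close> is
    \<open>g u\<close>, which is also the value of the remainder.\<close>
  let ?h' = "\<lambda>x. ?h1 x \<oplus>\<^bsub>C\<^esub> form b x"
  have "h x = ?h' x" if xK: "x \<in> KH" for x
  proof -
    obtain g where x: "x \<in> carrier F" and g: "lin R I C g" "\<forall>k<n. proj k x = g (a k)"
      using xK by (auto simp: KH_def)
    obtain r where r: "\<forall>u\<in>carrier I. g u = finsum C (\<lambda>i. r i \<odot>\<^bsub>C\<^esub> \<tau> i u) {..<m}"
      "r \<in> {..<m} \<rightarrow> carrier R"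
      using \<tau>_gen[OF g(1)] by (rule bexE)
    note c = comb_KH[OF r(2)]
    have "?h2 (x \<ominus>\<^bsub>F\<^esub> comb r) = \<zero>\<^bsub>C\<^esub>"
      by (rule h2_0[OF _ KH_decomposition[OF x g r(2,1)]]) (use x c KH_sub in auto)
    moreover have "?h2 (x \<ominus>\<^bsub>F\<^esub> comb r) = ?h2 x \<ominus>\<^bsub>C\<^esub> ?h2 (comb r)"
      using lin_minus[OF h2 module_MH module_C, of x "comb r"] xK c
      by (simp only: minus_sub[OF module_F KH_submodule xK c]) simp
    ultimately have "?h2 x = ?h2 (comb r)"
      using minus_zero_iff[OF module_C hC(3)[OF xK] hC(3)[OF c]] by simp
    also have "\<dots> = finsum C (\<lambda>i. r i \<odot>\<^bsub>C\<^esub> \<tau> i u) {..<m}"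
      unfolding h2_comb[OF r(2)]
      by (rule C.M.finsum_cong') (use u r(2) lin_closed[OF \<tau>_lin u(2)] in auto)
    also have "\<dots> = g u" using r(1) u(2) by simp
    also have "\<dots> = form b x" using form_KH[OF b(2) x g] b(1) by simp
    finally have "?h2 x = form b x" .
    moreover have "?h1 x \<oplus>\<^bsub>C\<^esub> ?h2 x = h x"
      using hC[OF xK] by (simp add: a_minus_def C.M.a_ac C.M.r_neg C.M.r_neg1 C.M.r_neg2)
    ultimately show ?thesis by simp
  qed
  moreover have "lin R F C ?h'" by (rule lin_addf[OF h1 form_lin[OF b(2)] module_F module_C])
  ultimately show ?thesis by blast
qed

text \<open>A map Hom(H, C) -> K. Since \<open>f\<close> kills the kernel of F -> C^n, it is some
  \<open>form r\<close>; since it kills the \<open>\<xi> i\<close>, every \<open>\<tau> i\<close>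
  kills sum r_k a_k, which is then zero.\<close>

lemma vanishing_form:
  assumes f: "lin R F C f" and f0: "\<And>x. x \<in> KH \<Longrightarrow> f x = \<zero>\<^bsub>C\<^esub>"
  shows "\<exists>r. r \<in> carrier Rn \<and> free_ext R I a r = \<zero>\<^bsub>I\<^esub> \<and> (\<forall>x\<in>carrier F. f x = form r x)"
proof -
  have "\<forall>k\<in>{..<n}. \<exists>r. r \<in> carrier R \<and> (\<forall>y\<in>carrier L. f (inc k y) = r \<odot>\<^bsub>C\<^esub> \<epsilon> y)"
  proof
    fix k assume "k \<in> {..<n}"
    then have k: "k < n" by simp
    obtain g where g: "lin R C C g" "\<And>y. y \<in> carrier L \<Longrightarrow> g (\<epsilon> y) = f (inc k y)"
      by (rule lin_factor[OF \<epsilon>_lin \<epsilon>_surj lin_comp[OF inc_lin[OF k] f] module_L module_C module_C])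
        (use f0 inc_Z[OF k] in auto)
    from scalar[OF g(1)] obtain r where r: "\<forall>c\<in>carrier C. g c = r \<odot>\<^bsub>C\<^esub> c" "r \<in> carrier R" by (rule bexE)
    have "f (inc k y) = r \<odot>\<^bsub>C\<^esub> \<epsilon> y" if "y \<in> carrier L" for y
      using g(2)[OF that] r(1) lin_closed[OF \<epsilon>_lin that] by simp
    with r(2) show "\<exists>r. r \<in> carrier R \<and> (\<forall>y\<in>carrier L. f (inc k y) = r \<odot>\<^bsub>C\<^esub> \<epsilon> y)" by blast
  qed
  from bchoice[OF this] obtain r0
    where r0: "\<forall>k\<in>{..<n}. r0 k \<in> carrier R \<and> (\<forall>y\<in>carrier L. f (inc k y) = r0 k \<odot>\<^bsub>C\<^esub> \<epsilon> y)" by (elim exE)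
  \<comment> \<open>Elements of \<open>free_mod\<close> vanish off the basis, so the coefficients
    are cut off at \<open>n\<close>.\<close>
  define r where "r k = (if k < n then r0 k else \<zero>\<^bsub>R\<^esub>)" for k
  have "finite {k. r k \<noteq> \<zero>\<^bsub>R\<^esub>}" by (rule finite_subset[of _ "{..<n}"]) (auto simp: r_def)
  then have r: "r \<in> carrier Rn" using r0 by (auto simp: free_mod_def r_def)
  have fr: "f x = form r x" if x: "x \<in> carrier F" for x
  proof -
    have s: "slice k x \<in> carrier L" if "k < n" for k by (rule lin_closed[OF slice_lin[OF that] x])
    have "f x = f (finsum F (\<lambda>k. inc k (slice k x)) {..<n})" using inc_slice[OF x] by simp
    also have "\<dots> = finsum C (\<lambda>k. f (inc k (slice k x))) {..<n}"
      by (rule lin_finsum[OF f module_F module_C]) (use s lin_closed[OF inc_lin] in auto)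
    also have "\<dots> = form r x"
      unfolding form_eq[OF r x]
      by (rule C.M.finsum_cong') (use r0 s proj_closed x in \<open>auto simp: r_def proj_def\<close>)
    finally show ?thesis .
  qed
  have "free_ext R I a r = \<zero>\<^bsub>I\<^esub>"
  proof (rule \<tau>_inj)
    show "free_ext R I a r \<in> carrier I" by (rule lin_closed[OF free_ext_lin[OF module_I a_closed] r])
    fix i assume i: "i < m"
    have "form r (\<xi> i) = \<tau> i (free_ext R I a r)"
      by (rule form_KH[OF r \<xi>(1)[OF i] \<tau>_lin[OF i]]) (use \<xi>(2)[OF i] in blast)
    then show "\<tau> i (free_ext R I a r) = \<zero>\<^bsub>C\<^esub>"
      using fr[OF \<xi>(1)[OF i]] f0[OF \<xi>_KH[OF i]] by simp
  qed
  with r fr show ?thesis by blast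
qed

end

text \<open>For r in K the proof finds form r = sum c_i \<gamma>_i + sum c'_z \<delta>_z with
  finitely many fixed maps that vanish on \<open>KH\<close>. By \<open>vanishing_form\<close> these
  come from elements of K, and \<open>form_inj\<close> turns the equation between maps into one in
  K.\<close>

lemma (in ideal_forms) relations_fin_gen:
  assumes cor: "coresolution R C MH W W' \<iota> \<pi>"
  shows "fin_gen R (Rn\<lparr>carrier := {r \<in> carrier Rn. free_ext R I a r = \<zero>\<^bsub>I\<^esub>}\<rparr>)"
proof -
  have loc: "loc_summand R C W" "loc_summand R C W'" and \<iota>: "lin R MH W \<iota>"
    and \<pi>: "lin R W W' \<pi>" and im: "\<iota> ` carrier MH = {w \<in> carrier W. \<pi> w = \<zero>\<^bsub>W'\<^esub>}"
    using cor by (simp_all add: coresolution_def)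
  have ext: "\<exists>g. lin R W C g \<and> (\<forall>x\<in>carrier MH. f x = g (\<iota> x))" if "lin R MH C f" for f
    using cor that by (simp add: coresolution_def)
  have desc: "\<exists>h. lin R W' C h \<and> (\<forall>w\<in>carrier W. g w = h (\<pi> w))"
    if "lin R W C g" "\<forall>x\<in>carrier MH. g (\<iota> x) = \<zero>\<^bsub>C\<^esub>" for g
    using cor that by (simp add: coresolution_def)
  have W: "module R W" "module R W'" using loc by (simp_all add: loc_summand_module)
  interpret W: module R W by (rule W(1))
  interpret W': module R W' by (rule W(2))
  \<comment> \<open>\<open>\<iota>\<close> is a finite sum of its coordinates in C followed by maps
    to \<open>W\<close>, and \<open>KH_extension\<close> extends each coordinate to
    \<open>F\<close>.\<close>
  obtain e where e: "lin R F W e" "\<forall>x\<in>KH. \<iota> x = e x"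
  proof -
    from loc_summand_fin_gen[OF loc(1) module_C module_MH KH_fin_gen \<iota>] obtain p :: nat and s t
      where st: "\<forall>i<p. lin R C W (s i) \<and> lin R W C (t i)"
        and sum: "\<forall>x\<in>carrier MH. finsum W (\<lambda>i. s i (t i (\<iota> x))) {..<p} = \<iota> x"
      by (elim exE conjE)
    have "\<forall>i\<in>{..<p}. \<exists>h. lin R F C h \<and> (\<forall>x\<in>KH. t i (\<iota> x) = h x)"
    proof
      fix i assume "i \<in> {..<p}"
      then have "lin R MH C (\<lambda>x. t i (\<iota> x))" using lin_comp[OF \<iota>] st by auto
      then show "\<exists>h. lin R F C h \<and> (\<forall>x\<in>KH. t i (\<iota> x) = h x)" by (rule KH_extension)
    qed
    from bchoice[OF this] obtain h
      where h: "\<forall>i\<in>{..<p}. lin R F C (h i) \<and> (\<forall>x\<in>KH. t i (\<iota> x) = h i x)" by (elim exE)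
    have "lin R F W (\<lambda>x. finsum W (\<lambda>i. s i (h i x)) {..<p})"
      by (rule lin_finsumf[OF lin_comp module_F W(1)]) (use h st in auto)
    moreover have "\<iota> x = finsum W (\<lambda>i. s i (h i x)) {..<p}" if x: "x \<in> KH" for x
    proof -
      have hx: "h i x \<in> carrier C" if "i < p" for i
        using h that x KH_sub lin_closed[of R F C "h i" x] by auto
      have "finsum W (\<lambda>i. s i (t i (\<iota> x))) {..<p} = finsum W (\<lambda>i. s i (h i x)) {..<p}"
        by (rule W.M.finsum_cong') (use h x st hx lin_closed in \<open>fastforce+\<close>)
      then show ?thesis using sum x by simp
    qed
    ultimately show thesis using that by blast
  qed
  \<comment> \<open>The restriction to \<open>KH\<close> of each generator of Hom(F, C) extends
    along \<open>\<iota>\<close> to a map on \<open>W\<close>; pulled back by \<open>e\<close>, it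
    agrees with the generator on \<open>KH\<close>.\<close>
  have "\<forall>i\<in>A. \<exists>g. lin R W C g \<and> (\<forall>x\<in>carrier MH. \<alpha> i x = g (\<iota> x))"
    using ext lin_sub[OF \<alpha>_lin KH_sub] by blast
  from bchoice[OF this] obtain \<beta>
    where \<beta>: "\<forall>i\<in>A. lin R W C (\<beta> i) \<and> (\<forall>x\<in>carrier MH. \<alpha> i x = \<beta> i (\<iota> x))" by (elim exE)
  have \<beta>_lin: "lin R W C (\<beta> i)" if "i \<in> A" for i using \<beta> that by blast
  have \<beta>e: "lin R F C (\<lambda>x. \<beta> i (e x))" if "i \<in> A" for i by (rule lin_comp[OF e(1) \<beta>_lin[OF that]])
  \<comment> \<open>The maps \<open>\<gamma> i\<close> and, below, \<open>\<delta> z\<close> vanish on \<open>KH\<close> and generate all maps \<open>F \<rightarrow> C\<close> that do.\<close>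
  let ?\<gamma> = "\<lambda>i x. \<alpha> i x \<ominus>\<^bsub>C\<^esub> \<beta> i (e x)"
  have \<gamma>: "lin R F C (?\<gamma> i)" if "i \<in> A" for i
    by (rule lin_minusf[OF \<alpha>_lin[OF that] \<beta>e[OF that] module_F module_C])
  have "?\<gamma> i x = \<zero>\<^bsub>C\<^esub>" if "i \<in> A" "x \<in> KH" for i x
  proof -
    have "\<alpha> i x = \<beta> i (e x)" using \<beta> e(2) that by simp
    then show ?thesis
      using minus_zero_iff[OF module_C] lin_closed[OF \<alpha>_lin] lin_closed[OF \<beta>e] that KH_sub by auto
  qed
  then have "\<forall>i\<in>A. \<exists>r. r \<in> carrier Rn \<and> free_ext R I a r = \<zero>\<^bsub>I\<^esub> \<and> (\<forall>x\<in>carrier F. ?\<gamma> i x = form r x)"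
    using vanishing_form[OF \<gamma>] by blast
  from bchoice[OF this] obtain \<rho> where \<rho>: "\<forall>i\<in>A. \<rho> i \<in> carrier Rn \<and>
      free_ext R I a (\<rho> i) = \<zero>\<^bsub>I\<^esub> \<and> (\<forall>x\<in>carrier F. ?\<gamma> i x = form (\<rho> i) x)" by (elim exE)
  have \<pi>e: "lin R F W' (\<lambda>x. \<pi> (e x))" by (rule lin_comp[OF e(1) \<pi>])
  \<comment> \<open>Finite generation of \<open>F\<close> bounds the number of coordinates of
    \<open>W'\<close> that \<open>\<pi>\<close> after \<open>e\<close> meets.\<close>
  from loc_summand_fin_gen[OF loc(2) module_C module_F fin_gen_F \<pi>e] obtain q :: nat and s t
    where st: "\<forall>z<q. lin R C W' (s z) \<and> lin R W' C (t z)"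
      and sum: "\<forall>x\<in>carrier F. finsum W' (\<lambda>z. s z (t z (\<pi> (e x)))) {..<q} = \<pi> (e x)"
    by (elim exE conjE)
  let ?\<delta> = "\<lambda>z x. t z (\<pi> (e x))"
  have \<delta>: "lin R F C (?\<delta> z)" if "z \<in> {..<q}" for z using lin_comp[OF \<pi>e] st that by auto
  have "?\<delta> z x = \<zero>\<^bsub>C\<^esub>" if "z \<in> {..<q}" "x \<in> KH" for z x
  proof -
    have "e x = \<iota> x" using e(2) that(2) by simp
    then have "\<pi> (e x) = \<zero>\<^bsub>W'\<^esub>" using im that(2) by auto
    then show ?thesis using lin_zero[of R W' C "t z"] st that(1) W(2) module_C by simp
  qed
  then have "\<forall>z\<in>{..<q}. \<exists>r. r \<in> carrier Rn \<and> free_ext R I a r = \<zero>\<^bsub>I\<^esub> \<and> (\<forall>x\<in>carrier F. ?\<delta> z x = form r x)"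
    using vanishing_form[OF \<delta>] by blast
  from bchoice[OF this] obtain \<rho>' where \<rho>': "\<forall>z\<in>{..<q}. \<rho>' z \<in> carrier Rn \<and>
      free_ext R I a (\<rho>' z) = \<zero>\<^bsub>I\<^esub> \<and> (\<forall>x\<in>carrier F. ?\<delta> z x = form (\<rho>' z) x)" by (elim exE)
  let ?K = "{r \<in> carrier Rn. free_ext R I a r = \<zero>\<^bsub>I\<^esub>}"
  have K: "submodule ?K R Rn"
    by (rule kernel_submodule[OF free_ext_lin[OF module_I a_closed] Rn.module_axioms module_I])
  let ?S = "\<rho> ` A \<union> \<rho>' ` {..<q}"
  show ?thesis
  proof (rule fin_genI[OF submodule_module[OF Rn.module_axioms K]])
    show "finite ?S" using finite_A by simp
    show "?S \<subseteq> carrier (Rn\<lparr>carrier := ?K\<rparr>)" using \<rho> \<rho>' by auto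
    fix N assume N: "submodule N R (Rn\<lparr>carrier := ?K\<rparr>)" "?S \<subseteq> N"
    have NR: "submodule N R Rn" by (rule submodule_trans[OF Rn.module_axioms K N(1)])
    show "carrier (Rn\<lparr>carrier := ?K\<rparr>) \<subseteq> N"
    proof
      fix r assume "r \<in> carrier (Rn\<lparr>carrier := ?K\<rparr>)"
      then have r: "r \<in> carrier Rn" "free_ext R I a r = \<zero>\<^bsub>I\<^esub>" by auto
      obtain c where c: "\<forall>x\<in>carrier F. finsum C (\<lambda>i. c i \<odot>\<^bsub>C\<^esub> \<alpha> i x) A = form r x"
        "c \<in> A \<rightarrow> carrier R"
        using \<alpha>_gen[OF form_lin[OF r(1)]] by (rule bexE)
      have cR: "c i \<in> carrier R" if "i \<in> A" for i using c(2) that by auto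
      \<comment> \<open>Subtracting the combination of the \<open>?\<gamma> i\<close> from
        \<open>form r\<close> leaves \<open>?b\<close> after \<open>e\<close>. As \<open>r\<close>
        is a relation, \<open>form r\<close> vanishes on \<open>KH\<close>; so \<open>?b\<close>
        kills the image of \<open>\<iota>\<close> and factors through \<open>\<pi>\<close>.\<close>
      let ?b = "\<lambda>w. finsum C (\<lambda>i. c i \<odot>\<^bsub>C\<^esub> \<beta> i w) A"
      have b: "lin R W C ?b"
        by (rule lin_finsumf[OF lin_smultf[OF \<beta>_lin cR W(1) module_C] W(1) module_C])
      have "?b (\<iota> x) = \<zero>\<^bsub>C\<^esub>" if x: "x \<in> KH" for x
      proof -
        obtain g where xF: "x \<in> carrier F" and g: "lin R I C g" "\<forall>k<n. proj k x = g (a k)"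
          using x by (auto simp: KH_def)
        have "?b (\<iota> x) = finsum C (\<lambda>i. c i \<odot>\<^bsub>C\<^esub> \<alpha> i x) A"
          by (rule C.M.finsum_cong') (use \<beta> x cR lin_closed[OF \<alpha>_lin xF] in auto)
        also have "\<dots> = form r x" using c(1) xF by simp
        also have "\<dots> = g \<zero>\<^bsub>I\<^esub>" using form_KH[OF r(1) xF g] r(2) by simp
        also have "\<dots> = \<zero>\<^bsub>C\<^esub>" by (rule lin_zero[OF g(1) module_I module_C])
        finally show ?thesis .
      qed
      then obtain f2 where f2: "lin R W' C f2" "\<forall>w\<in>carrier W. ?b w = f2 (\<pi> w)"
        using desc[OF b] by auto
      have "lin R C C (\<lambda>c. f2 (s z c))" if "z \<in> {..<q}" for z
        by (rule lin_comp[OF _ f2(1)]) (use st that in auto)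
      \<comment> \<open>The maps \<open>f2\<close> after \<open>s z\<close> are endomorphisms of C,
        hence scalars, and these are the coefficients of the \<open>?\<delta> z\<close>.\<close>
      then obtain c' where c': "\<forall>z\<in>{..<q}. \<forall>y\<in>carrier C. f2 (s z y) = c' z \<odot>\<^bsub>C\<^esub> y"
        "c' \<in> {..<q} \<rightarrow> carrier R"
        using scalar_family[of "{..<q}" "\<lambda>z c. f2 (s z c)"] by blast
      have cR': "c' z \<in> carrier R" if "z \<in> {..<q}" for z using c'(2) that by auto
      let ?r1 = "finsum Rn (\<lambda>i. c i \<odot>\<^bsub>Rn\<^esub> \<rho> i) A"
      let ?r2 = "finsum Rn (\<lambda>z. c' z \<odot>\<^bsub>Rn\<^esub> \<rho>' z) {..<q}"
      have r1: "?r1 \<in> carrier Rn" by (rule Rn.M.finsum_closed) (use \<rho> cR in auto)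
      have r2: "?r2 \<in> carrier Rn" by (rule Rn.M.finsum_closed) (use \<rho>' cR' in auto)
      \<comment> \<open>The index type is left general, as both \<open>A\<close> and the numbers
        below \<open>q\<close> occur.\<close>
      have form_sum: "form (finsum Rn (\<lambda>i. d i \<odot>\<^bsub>Rn\<^esub> \<sigma> i) B) x = finsum C (\<lambda>i. d i \<odot>\<^bsub>C\<^esub> form (\<sigma> i) x) B"
        if x: "x \<in> carrier F" and d: "\<And>i. i \<in> B \<Longrightarrow> d i \<in> carrier R"
          and \<sigma>: "\<And>i. i \<in> B \<Longrightarrow> \<sigma> i \<in> carrier Rn" for x d \<sigma> and B :: "'z set"
      proof -
        note fl = form_coeff_lin[OF x]
        have "form (finsum Rn (\<lambda>i. d i \<odot>\<^bsub>Rn\<^esub> \<sigma> i) B) x = finsum C (\<lambda>i. form (d i \<odot>\<^bsub>Rn\<^esub> \<sigma> i) x) B"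
          by (rule lin_finsum[OF fl Rn.module_axioms module_C]) (use d \<sigma> in auto)
        also have "\<dots> = finsum C (\<lambda>i. d i \<odot>\<^bsub>C\<^esub> form (\<sigma> i) x) B"
          by (rule C.M.finsum_cong')
            (use d \<sigma> lin_closed[OF fl] in \<open>auto simp: lin_smult[OF fl]\<close>)
        finally show ?thesis .
      qed
      have "form r x = form (?r1 \<oplus>\<^bsub>Rn\<^esub> ?r2) x" if x: "x \<in> carrier F" for x
      proof -
        have ex: "e x \<in> carrier W" and \<pi>ex: "\<pi> (e x) \<in> carrier W'"
          using lin_closed[OF e(1) x] lin_closed[OF \<pi>e x] by auto
        have \<gamma>C: "?\<gamma> i x \<in> carrier C" and \<beta>C: "\<beta> i (e x) \<in> carrier C" and \<alpha>C: "\<alpha> i x \<in> carrier C"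
          if "i \<in> A" for i
          using lin_closed[OF \<gamma>[OF that] x] lin_closed[OF \<beta>e[OF that] x] lin_closed[OF \<alpha>_lin[OF that] x] by auto
        have "form r x = finsum C (\<lambda>i. c i \<odot>\<^bsub>C\<^esub> \<alpha> i x) A" using c(1) x by simp
        also have "\<dots> = finsum C (\<lambda>i. c i \<odot>\<^bsub>C\<^esub> ?\<gamma> i x \<oplus>\<^bsub>C\<^esub> c i \<odot>\<^bsub>C\<^esub> \<beta> i (e x)) A"
        proof (rule C.M.finsum_cong')
          show "(\<lambda>i. c i \<odot>\<^bsub>C\<^esub> ?\<gamma> i x \<oplus>\<^bsub>C\<^esub> c i \<odot>\<^bsub>C\<^esub> \<beta> i (e x)) \<in> A \<rightarrow> carrier C"
            using cR \<gamma>C \<beta>C by auto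
          fix i assume i: "i \<in> A"
          have "c i \<odot>\<^bsub>C\<^esub> ?\<gamma> i x \<oplus>\<^bsub>C\<^esub> c i \<odot>\<^bsub>C\<^esub> \<beta> i (e x) = c i \<odot>\<^bsub>C\<^esub> (?\<gamma> i x \<oplus>\<^bsub>C\<^esub> \<beta> i (e x))"
            by (rule C.smult_r_distr[OF cR[OF i] \<gamma>C[OF i] \<beta>C[OF i], symmetric])
          also have "?\<gamma> i x \<oplus>\<^bsub>C\<^esub> \<beta> i (e x) = \<alpha> i x"
            using \<alpha>C[OF i] \<beta>C[OF i] by (simp add: a_minus_def C.M.a_assoc C.M.l_neg)
          finally show "c i \<odot>\<^bsub>C\<^esub> \<alpha> i x = c i \<odot>\<^bsub>C\<^esub> ?\<gamma> i x \<oplus>\<^bsub>C\<^esub> c i \<odot>\<^bsub>C\<^esub> \<beta> i (e x)" by simp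
        qed simp
        also have "\<dots> = finsum C (\<lambda>i. c i \<odot>\<^bsub>C\<^esub> ?\<gamma> i x) A \<oplus>\<^bsub>C\<^esub> ?b (e x)"
          by (rule C.M.finsum_addf) (use cR \<gamma>C \<beta>C in auto)
        also have "finsum C (\<lambda>i. c i \<odot>\<^bsub>C\<^esub> ?\<gamma> i x) A = finsum C (\<lambda>i. c i \<odot>\<^bsub>C\<^esub> form (\<rho> i) x) A"
          by (rule C.M.finsum_cong') (use \<rho> x cR lin_closed[OF form_lin _] in auto)
        also have "\<dots> = form ?r1 x" by (rule form_sum[OF x, symmetric]) (use cR \<rho> in auto)
        also have "?b (e x) = f2 (finsum W' (\<lambda>z. s z (?\<delta> z x)) {..<q})" using f2(2) ex sum x by simp
        also have "\<dots> = finsum C (\<lambda>z. f2 (s z (?\<delta> z x))) {..<q}"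
          by (rule lin_finsum[OF f2(1) W(2) module_C])
            (use st lin_closed[OF \<delta> x] lin_closed in \<open>fastforce\<close>)
        also have "\<dots> = finsum C (\<lambda>z. c' z \<odot>\<^bsub>C\<^esub> form (\<rho>' z) x) {..<q}"
        proof (rule C.M.finsum_cong')
          show "(\<lambda>z. c' z \<odot>\<^bsub>C\<^esub> form (\<rho>' z) x) \<in> {..<q} \<rightarrow> carrier C"
            using cR' \<rho>' lin_closed[OF form_lin _] x by auto
          show "f2 (s z (?\<delta> z x)) = c' z \<odot>\<^bsub>C\<^esub> form (\<rho>' z) x" if "z \<in> {..<q}" for z
            using c'(1) lin_closed[OF \<delta>[OF that] x] \<rho>' that x by simp
        qed simp
        also have "\<dots> = form ?r2 x" by (rule form_sum[OF x, symmetric]) (use cR' \<rho>' in auto)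
        also have "form ?r1 x \<oplus>\<^bsub>C\<^esub> form ?r2 x = form (?r1 \<oplus>\<^bsub>Rn\<^esub> ?r2) x"
          by (rule lin_add[OF form_coeff_lin[OF x] r1 r2, symmetric])
        finally show ?thesis .
      qed
      note eq = this
      have r12: "?r1 \<oplus>\<^bsub>Rn\<^esub> ?r2 \<in> carrier Rn" using r1 r2 by simp
      have "r \<ominus>\<^bsub>Rn\<^esub> (?r1 \<oplus>\<^bsub>Rn\<^esub> ?r2) = \<zero>\<^bsub>Rn\<^esub>"
      proof (rule form_inj)
        show "r \<ominus>\<^bsub>Rn\<^esub> (?r1 \<oplus>\<^bsub>Rn\<^esub> ?r2) \<in> carrier Rn" using r(1) r12 by simp
        fix x assume x: "x \<in> carrier F"
        note fl = form_coeff_lin[OF x]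
        show "form (r \<ominus>\<^bsub>Rn\<^esub> (?r1 \<oplus>\<^bsub>Rn\<^esub> ?r2)) x = \<zero>\<^bsub>C\<^esub>"
          unfolding lin_minus[OF fl Rn.module_axioms module_C r(1) r12]
          using minus_zero_iff[OF module_C] eq[OF x] lin_closed[OF fl r(1)] lin_closed[OF fl r12] by blast
      qed
      then have r_eq: "r = ?r1 \<oplus>\<^bsub>Rn\<^esub> ?r2" using minus_zero_iff[OF Rn.module_axioms r(1) r12] by blast
      have "?r1 \<in> N"
        by (rule submodule_finsum[OF Rn.module_axioms NR]) (use cR N(2) submodule_smult[OF NR] in auto)
      moreover have "?r2 \<in> N"
        by (rule submodule_finsum[OF Rn.module_axioms NR]) (use cR' N(2) submodule_smult[OF NR] in auto)
      ultimately show "r \<in> N" unfolding r_eq by (rule submodule_add[OF NR])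
    qed
  qed
qed

section \<open>Ideals and coherence\<close>

lemma finsum_Times:
  assumes "module R M" "finite X" "finite Y" "\<And>x y. x \<in> X \<Longrightarrow> y \<in> Y \<Longrightarrow> f x y \<in> carrier M"
  shows "finsum M (\<lambda>x. finsum M (f x) Y) X = finsum M (\<lambda>(x, y). f x y) (X \<times> Y)"
proof -
  interpret M: module R M by fact
  from assms(2,4) show ?thesis
  proof (induction X rule: finite_induct)
    case empty then show ?case by simp
  next
    case (insert a X)
    have X: "(\<lambda>x. finsum M (f x) Y) \<in> X \<rightarrow> carrier M" and a: "f a \<in> Y \<rightarrow> carrier M"
      using insert.prems by auto
    have "finsum M (\<lambda>(x, y). f x y) (insert a X \<times> Y) = finsum M (\<lambda>(x, y). f x y) (Pair a ` Y \<union> X \<times> Y)"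
      by (rule arg_cong[where f = "finsum M _"]) auto
    also have "\<dots> = finsum M (\<lambda>(x, y). f x y) (Pair a ` Y) \<oplus>\<^bsub>M\<^esub> finsum M (\<lambda>(x, y). f x y) (X \<times> Y)"
      by (rule M.M.finsum_Un_disjoint) (use insert assms(3) in auto)
    also have "finsum M (\<lambda>(x, y). f x y) (Pair a ` Y) = finsum M (\<lambda>y. case (a, y) of (x, y) \<Rightarrow> f x y) Y"
      by (rule M.M.finsum_reindex) (use a in \<open>auto simp: inj_on_def\<close>)
    also have "\<dots> = finsum M (f a) Y" by simp
    finally have "finsum M (\<lambda>(x, y). f x y) (insert a X \<times> Y)
      = finsum M (f a) Y \<oplus>\<^bsub>M\<^esub> finsum M (\<lambda>x. finsum M (f x) Y) X"
      using insert by simp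
    then show ?case using insert.hyps X a by (simp add: M.M.finsum_insert)
  qed
qed

text \<open>Hom(R^X, C) = C^X, and the \<open>c j\<close> generate C, so the maps x -> x_i c_j
  generate the former. The coefficients come from writing f (e_i) in the \<open>c j\<close>.\<close>

lemma free_forms:
  fixes X :: "'i set" and Y :: "'j set"
  assumes C: "module R C" and fin: "finite X" "finite Y" and c: "c \<in> Y \<rightarrow> carrier C"
    and gen: "free_ext R C c ` carrier (free_mod R Y) = carrier C"
    and f: "lin R (free_mod R X) C f"
  shows "\<exists>r\<in>X \<times> Y \<rightarrow> carrier R. \<forall>x\<in>carrier (free_mod R X).
    finsum C (\<lambda>p. r p \<odot>\<^bsub>C\<^esub> (x (fst p) \<odot>\<^bsub>C\<^esub> c (snd p))) (X \<times> Y) = f x"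
proof -
  interpret C: module R C by (rule C)
  note cr = C.R.is_cring
  let ?F = "free_mod R X"
  interpret F: module R ?F by (rule free_mod_module[OF cr])
  have g: "free_gen R i \<in> carrier ?F" if "i \<in> X" for i by (rule free_gen_closed[OF cr that])
  have "\<forall>i\<in>X. \<exists>z. z \<in> carrier (free_mod R Y) \<and> free_ext R C c z = f (free_gen R i)"
  proof
    fix i assume "i \<in> X"
    then have "f (free_gen R i) \<in> free_ext R C c ` carrier (free_mod R Y)"
      unfolding gen by (intro lin_closed[OF f] g)
    then obtain z where "f (free_gen R i) = free_ext R C c z" "z \<in> carrier (free_mod R Y)" by (rule imageE)
    then show "\<exists>z. z \<in> carrier (free_mod R Y) \<and> free_ext R C c z = f (free_gen R i)"
      by (intro exI[of _ z]) simp
  qed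
  from bchoice[OF this] obtain z
    where z: "\<forall>i\<in>X. z i \<in> carrier (free_mod R Y) \<and> free_ext R C c (z i) = f (free_gen R i)" by (elim exE)
  have zR: "z i j \<in> carrier R" if "i \<in> X" for i j
    by (rule free_mod_carrier_in[of _ _ Y]) (use z that in simp)
  have cC: "c j \<in> carrier C" if "j \<in> Y" for j using c that by auto
  let ?r = "\<lambda>p. z (fst p) (snd p)"
  have "finsum C (\<lambda>p. ?r p \<odot>\<^bsub>C\<^esub> (x (fst p) \<odot>\<^bsub>C\<^esub> c (snd p))) (X \<times> Y) = f x" if x: "x \<in> carrier ?F" for x
  proof -
    have xR: "x i \<in> carrier R" for i by (rule free_mod_carrier_in[OF x])
    have "f x = f (finsum ?F (\<lambda>i. x i \<odot>\<^bsub>?F\<^esub> free_gen R i) X)"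
      by (rule arg_cong[OF free_expansion[OF cr x fin(1) free_mod_support(1)[OF x] subset_refl]])
    also have "\<dots> = finsum C (\<lambda>i. f (x i \<odot>\<^bsub>?F\<^esub> free_gen R i)) X"
      by (rule lin_finsum[OF f F.module_axioms C]) (use xR g in auto)
    also have "\<dots> = finsum C (\<lambda>i. finsum C (\<lambda>j. z i j \<odot>\<^bsub>C\<^esub> (x i \<odot>\<^bsub>C\<^esub> c j)) Y) X"
    proof (rule C.M.finsum_cong')
      show "(\<lambda>i. finsum C (\<lambda>j. z i j \<odot>\<^bsub>C\<^esub> (x i \<odot>\<^bsub>C\<^esub> c j)) Y) \<in> X \<rightarrow> carrier C"
        using zR xR cC by (intro Pi_I C.M.finsum_closed) auto
      fix i assume i: "i \<in> X"
      have "f (x i \<odot>\<^bsub>?F\<^esub> free_gen R i) = x i \<odot>\<^bsub>C\<^esub> free_ext R C c (z i)"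
        using lin_smult[OF f xR g[OF i]] z i by simp
      also have "free_ext R C c (z i) = finsum C (\<lambda>j. z i j \<odot>\<^bsub>C\<^esub> c j) Y"
        by (rule free_ext_eq[OF C c _ fin(2) _ subset_refl]) (use z i free_mod_support(1) in blast)+
      also have "x i \<odot>\<^bsub>C\<^esub> \<dots> = finsum C (\<lambda>j. x i \<odot>\<^bsub>C\<^esub> (z i j \<odot>\<^bsub>C\<^esub> c j)) Y"
        by (rule C.finsum_smult_ldistr[OF fin(2) xR]) (use zR[OF i] cC in auto)
      also have "\<dots> = finsum C (\<lambda>j. z i j \<odot>\<^bsub>C\<^esub> (x i \<odot>\<^bsub>C\<^esub> c j)) Y"
        by (rule C.M.finsum_cong')
          (use zR[OF i] xR cC in \<open>auto simp: C.smult_assoc1[symmetric] C.R.m_comm\<close>)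
      finally show "f (x i \<odot>\<^bsub>?F\<^esub> free_gen R i) = finsum C (\<lambda>j. z i j \<odot>\<^bsub>C\<^esub> (x i \<odot>\<^bsub>C\<^esub> c j)) Y" .
    qed simp
    also have "\<dots> = finsum C (\<lambda>(i, j). z i j \<odot>\<^bsub>C\<^esub> (x i \<odot>\<^bsub>C\<^esub> c j)) (X \<times> Y)"
      by (rule finsum_Times[OF C fin]) (use zR xR cC in auto)
    also have "\<dots> = finsum C (\<lambda>p. ?r p \<odot>\<^bsub>C\<^esub> (x (fst p) \<odot>\<^bsub>C\<^esub> c (snd p))) (X \<times> Y)"
      by (simp add: case_prod_beta')
    finally show ?thesis by simp
  qed
  then show ?thesis by (intro bexI[of _ ?r] ballI) (use zR in auto)
qed

lemma free_fin_gen: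
  assumes "cring R" "finite X"
  shows "fin_gen R (free_mod R X)"
proof (rule fin_genI[OF free_mod_module[OF assms(1)]])
  show "finite (free_gen R ` X)" using assms(2) by simp
  show "free_gen R ` X \<subseteq> carrier (free_mod R X)"
    by (intro image_subsetI free_gen_closed assms(1))
  show "carrier (free_mod R X) \<subseteq> N" if "submodule N R (free_mod R X)" "free_gen R ` X \<subseteq> N" for N
    by (rule free_generated[OF assms(1) that(1)]) (use that(2) in auto)
qed

section \<open>Ideals as submodules of R\<close>

lemma self_mod_submodule_iff:
  assumes "cring R"
  shows "submodule T R (self_mod R) \<longleftrightarrow> ideal T R"
proof
  interpret cring R by fact
  interpret S: module R "self_mod R" by (rule self_mod_module[OF assms])
  show "ideal T R" if T: "submodule T R (self_mod R)"
  proof -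
    have sub: "T \<subseteq> carrier R" using submodule_subset[OF T] by (simp add: self_mod_def)
    have smult: "r \<otimes>\<^bsub>R\<^esub> x \<in> T" if "r \<in> carrier R" "x \<in> T" for r x
      using submodule_smult[OF T that] by (simp add: self_mod_def)
    have neg: "\<ominus>\<^bsub>R\<^esub> x \<in> T" if "x \<in> T" for x
    proof -
      have "(\<ominus>\<^bsub>R\<^esub> \<one>\<^bsub>R\<^esub>) \<otimes>\<^bsub>R\<^esub> x \<in> T" by (rule smult) (use that in auto)
      then show ?thesis using that sub by (simp add: l_minus subset_iff)
    qed
    show ?thesis
    proof (rule idealI[OF ring_axioms])
      show "subgroup T (add_monoid R)"
      proof (rule add.subgroupI)
        show "T \<noteq> {}" using submodule_zero[OF T] by auto
        show "x \<oplus>\<^bsub>R\<^esub> y \<in> T" if "x \<in> T" "y \<in> T" for x y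
          using submodule_add[OF T that] by (simp add: self_mod_def)
      qed (use sub neg in auto)
      show "r \<otimes>\<^bsub>R\<^esub> x \<in> T" if "x \<in> T" "r \<in> carrier R" for r x using smult that by blast
      show "x \<otimes>\<^bsub>R\<^esub> r \<in> T" if "x \<in> T" "r \<in> carrier R" for r x
        using smult[of r x] m_comm[of x r] that sub by auto
    qed
  qed
  show "submodule T R (self_mod R)" if T: "ideal T R"
  proof -
    interpret T: ideal T R by (rule T)
    show ?thesis
      by (rule submodule_intro[OF S.module_axioms])
        (use T.a_subset T.I_l_closed in \<open>auto simp: self_mod_def\<close>)
  qed
qed

lemma (in relation_module) ideal_forms_exist:
  assumes "fin_gen R I" "coresolution R C I W W' \<iota> \<pi>"
  shows "\<exists>m \<tau>. ideal_forms R C L \<epsilon> G F inc slice A \<alpha> I n a m \<tau>"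
proof (rule fin_gen_coresolution_forms[OF module_I assms], goal_cases)
  case (1 m \<tau>)
  have "ideal_forms_axioms R C I m \<tau>"
    by (rule ideal_forms_axioms.intro) (fact 1)+
  then show ?case using relation_module_axioms ideal_forms.intro by blast
qed

theorem corollary3p4:
  fixes R :: "('a, 'r) ring_scheme" and C :: "('a, 'c) module"
  assumes "cring R"
    and "semidualizing R C"
    and "GC_hereditary TYPE('p) TYPE('x) R C"
  shows "coherent_ring R"
  unfolding coherent_ring_def
proof (intro allI impI, elim conjE)
  fix S assume S: "finite S" "S \<subseteq> carrier R"
  note cr = assms(1)
  interpret R: cring R by (rule cr)
  have C: "module R C" using assms(2) by (simp add: semidualizing_def)
  interpret scalar_endo R C by (rule semidualizing_scalar_endo[OF assms(2)])
  interpret C: module R C by (rule C)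
  let ?S = "self_mod R"
  let ?I = "?S\<lparr>carrier := Idl\<^bsub>R\<^esub> S\<rparr>"
  note mS = self_mod_module[OF cr]
  have J: "submodule (Idl\<^bsub>R\<^esub> S) R ?S"
    using R.genideal_ideal[OF S(2)] self_mod_submodule_iff[OF cr] by blast
  note mI = submodule_module[OF mS J]
  have SJ: "S \<subseteq> Idl\<^bsub>R\<^esub> S" by (rule R.genideal_self[OF S(2)])
  \<comment> \<open>Minimality of the generated ideal serves in place of an explicit description of
    its elements.\<close>
  have min: "Idl\<^bsub>R\<^esub> S \<subseteq> N" if "submodule N R ?I" "S \<subseteq> N" for N
    by (rule R.genideal_minimal)
      (use submodule_trans[OF mS J that(1)] that(2) self_mod_submodule_iff[OF cr] in auto)
  have fg: "fin_gen R ?I" by (rule fin_genI[OF mI S(1)]) (use SJ min in auto)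
  define n where "n = card S"
  let ?Rn = "free_mod R {..<n}"
  note mRn = free_mod_module[OF cr, of "{..<n}"]
  obtain a where "bij_betw a {0..<card S} S" using ex_bij_betw_nat_finite[OF S(1)] by blast
  then have a_im: "a ` {..<n} = S" by (auto simp: bij_betw_def atLeast0LessThan n_def)
  then have a: "a \<in> {..<n} \<rightarrow> carrier ?I" using SJ by auto
  note p = free_ext_lin[OF mI a]
  have a_gen: "free_ext R ?I a ` carrier ?Rn = carrier ?I"
  proof
    show "free_ext R ?I a ` carrier ?Rn \<subseteq> carrier ?I" using lin_closed[OF p] by blast
    have "S \<subseteq> free_ext R ?I a ` carrier ?Rn"
    proof
      fix s assume "s \<in> S"
      then have "s \<in> a ` {..<n}" using a_im by simp
      then obtain k where k: "s = a k" "k \<in> {..<n}" by (rule imageE)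
      then show "s \<in> free_ext R ?I a ` carrier ?Rn"
        using free_ext_gen[OF mI a k(2)] free_gen_closed[OF cr k(2)] by (intro image_eqI) auto
    qed
    then show "carrier ?I \<subseteq> free_ext R ?I a ` carrier ?Rn"
      using min[OF image_submodule[OF p mRn mI]] by simp
  qed
  \<comment> \<open>R is a retract of the free module on one generator, so the hypothesis applies to
    the ideal.\<close>
  have i: "lin R ?S (free_mod R {0 :: nat}) (\<lambda>r x. if x = 0 then r else \<zero>\<^bsub>R\<^esub>)"
    by (auto simp: lin_def self_mod_def free_mod_def fun_eq_iff)
  obtain WI WI' :: "('a, ('a + 'x) list) module" and \<iota>I \<pi>I
    where cor: "coresolution R C ?I WI WI' \<iota>I \<pi>I"
    using GC_hereditary_coresolution[OF assms(3) C mS _ i eval_lin[OF cr, of _ 0] _ J] by auto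
  obtain l :: nat and \<epsilon> G where \<epsilon>: "lin R (free_mod R {..<l}) C \<epsilon>"
    "\<epsilon> ` carrier (free_mod R {..<l}) = carrier C"
    and G: "finite G" "G \<subseteq> {x \<in> carrier (free_mod R {..<l}). \<epsilon> x = \<zero>\<^bsub>C\<^esub>}"
      "{x \<in> carrier (free_mod R {..<l}). \<epsilon> x = \<zero>\<^bsub>C\<^esub>} \<subseteq> mod_span R (free_mod R {..<l}) G"
    by (rule semidualizing_presentation[OF assms(2)])
  let ?L = "free_mod R {..<l}"
  interpret L: module R ?L by (rule free_mod_module[OF cr])
  \<comment> \<open>L^n is realised as the free module on pairs, so that \<open>KH\<close> is a
    submodule of a finite free module and falls under the hypothesis as well.\<close>
  let ?X = "{..<n} \<times> {..<l}"
  let ?F = "free_mod R ?X"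
  interpret F: module R ?F by (rule free_mod_module[OF cr])
  define inc where "inc k y = (\<lambda>(i, j). if i = k then y j else \<zero>\<^bsub>R\<^esub>)" for k :: nat and y :: "nat \<Rightarrow> 'a"
  define slice where "slice k x = (\<lambda>j. x (k, j))" for k :: nat and x :: "nat \<times> nat \<Rightarrow> 'a"
  have inc: "lin R ?L ?F (inc k)" if k: "k < n" for k
  proof (rule linI)
    fix y assume y: "y \<in> carrier ?L"
    have "finite {p. inc k y p \<noteq> \<zero>\<^bsub>R\<^esub>}"
      by (rule finite_subset[of _ "{k} \<times> {j. y j \<noteq> \<zero>\<^bsub>R\<^esub>}"])
        (use y in \<open>auto simp: inc_def free_mod_def split: if_splits\<close>)
    then show "inc k y \<in> carrier ?F"
      using y k by (auto simp: inc_def free_mod_def range_subsetD split: if_splits)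
  qed (auto simp: inc_def free_mod_def fun_eq_iff)
  have slice: "lin R ?F ?L (slice k)" if k: "k < n" for k
  proof (rule linI)
    fix x assume x: "x \<in> carrier ?F"
    have "finite (Pair k -` {p. x p \<noteq> \<zero>\<^bsub>R\<^esub>})"
      using free_mod_support(2)[OF x] by (intro finite_vimageI) (auto simp: inj_on_def)
    then have "finite {j. slice k x j \<noteq> \<zero>\<^bsub>R\<^esub>}" by (simp add: slice_def vimage_def)
    then show "slice k x \<in> carrier ?L" using x k by (auto simp: slice_def free_mod_def)
  qed (auto simp: slice_def free_mod_def)
  have inc_slice: "finsum ?F (\<lambda>k. inc k (slice k x)) {..<n} = x" if x: "x \<in> carrier ?F" for x
  proof
    fix p :: "nat \<times> nat"
    interpret S: module R ?S by (rule mS)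
    obtain i j where p: "p = (i, j)" by (cases p)
    have xR: "x q \<in> carrier R" for q by (rule free_mod_carrier_in[OF x])
    have "(\<lambda>k. inc k (slice k x)) \<in> {..<n} \<rightarrow> carrier ?F"
      by (intro Pi_I lin_closed[OF inc] lin_closed[OF slice] x) auto
    then have "finsum ?F (\<lambda>k. inc k (slice k x)) {..<n} p = finsum ?S (\<lambda>k. inc k (slice k x) p) {..<n}"
      by (rule lin_finsum[OF eval_lin[OF cr] F.module_axioms mS])
    also have "\<dots> = finsum ?S (\<lambda>k. if i = k then x (k, j) else \<zero>\<^bsub>?S\<^esub>) {..<n}"
      by (rule S.M.finsum_cong') (use xR in \<open>auto simp: inc_def slice_def p self_mod_def\<close>)
    also have "\<dots> = x p"
    proof (cases "i < n")
      case True then show ?thesis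
        unfolding p by (intro S.M.add.finprod_singleton) (use xR in \<open>auto simp: self_mod_def\<close>)
    next
      case False
      then have "finsum ?S (\<lambda>k. if i = k then x (k, j) else \<zero>\<^bsub>?S\<^esub>) {..<n} = \<zero>\<^bsub>?S\<^esub>"
        by (intro S.M.add.finprod_one_eqI) auto
      moreover have "x p = \<zero>\<^bsub>?S\<^esub>" using x False p by (auto simp: free_mod_def self_mod_def)
      ultimately show ?thesis by (rule trans[OF _ sym])
    qed
    finally show "finsum ?F (\<lambda>k. inc k (slice k x)) {..<n} p = x p" .
  qed
  \<comment> \<open>The images of the basis of \<open>L\<close> generate C, since
    \<open>\<epsilon>\<close> is surjective.\<close>
  let ?c = "\<lambda>j. \<epsilon> (free_gen R j)"
  have c: "?c \<in> {..<l} \<rightarrow> carrier C" using lin_closed[OF \<epsilon>(1)] free_gen_closed[OF cr, of _ "{..<l}"] by auto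
  have "free_ext R C ?c y = \<epsilon> y" if "y \<in> carrier ?L" for y
    by (rule free_lin_eq[OF cr free_ext_lin[OF C c] \<epsilon>(1) C free_ext_gen[OF C c] that])
  then have c_gen: "free_ext R C ?c ` carrier ?L = carrier C" using \<epsilon>(2) by (simp cong: image_cong)
  \<comment> \<open>An index pairs a coordinate of \<open>F\<close> with a generator of C, as in
    \<open>free_forms\<close>.\<close>
  let ?\<alpha> = "\<lambda>p x. x (fst p) \<odot>\<^bsub>C\<^esub> ?c (snd p)"
  have \<alpha>: "lin R ?F C (?\<alpha> p)" if "p \<in> ?X \<times> {..<l}" for p
  proof -
    have "?c (snd p) \<in> carrier C" using c that by auto
    then show ?thesis
      by (intro linI) (auto simp: free_mod_def range_subsetD C.smult_l_distr C.smult_assoc1)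
  qed
  have data: "relation_module R C ?L \<epsilon> G ?F inc slice (?X \<times> {..<l}) ?\<alpha> ?I n a"
  proof (intro relation_module.intro relation_module_axioms.intro scalar_endo_axioms
      L.module_axioms F.module_axioms mI \<epsilon> G inc slice inc_slice a a_gen \<alpha>)
    show "\<exists>h'. lin R ?L C h' \<and> (\<forall>x\<in>carrier ?L. \<epsilon> x = \<zero>\<^bsub>C\<^esub> \<longrightarrow> h x = h' x)"
      if "lin R (?L\<lparr>carrier := {x \<in> carrier ?L. \<epsilon> x = \<zero>\<^bsub>C\<^esub>}\<rparr>) C h" for h
      by (rule semidualizing_extension[OF assms(2) refl \<epsilon> that])
    show "slice j (inc k y) = (if j = k then y else \<zero>\<^bsub>?L\<^esub>)" for j k y
      by (auto simp: slice_def inc_def free_mod_def)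
    show "fin_gen R ?F" by (rule free_fin_gen[OF cr]) simp
    show "\<exists>r\<in>?X \<times> {..<l} \<rightarrow> carrier R. \<forall>x\<in>carrier ?F.
        finsum C (\<lambda>i. r i \<odot>\<^bsub>C\<^esub> ?\<alpha> i x) (?X \<times> {..<l}) = f x" if "lin R ?F C f" for f
      by (rule free_forms[OF C _ _ c c_gen that]) auto
  qed auto
  interpret D: relation_module R C ?L \<epsilon> G ?F inc slice "?X \<times> {..<l}" ?\<alpha> ?I n a by (rule data)
  obtain m \<tau> where "ideal_forms R C ?L \<epsilon> G ?F inc slice (?X \<times> {..<l}) ?\<alpha> ?I n a m \<tau>"
    using D.ideal_forms_exist[OF fg cor] by blast
  then interpret D: ideal_forms R C ?L \<epsilon> G ?F inc slice "?X \<times> {..<l}" ?\<alpha> ?I n a m \<tau> .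
  \<comment> \<open>The hypothesis for \<open>KH\<close> in \<open>F\<close>; \<open>F\<close> is
    finite free, so the retraction is the identity.\<close>
  obtain W W' :: "('a, ('a + 'x) list) module" and \<iota> \<pi> where "coresolution R C D.MH W W' \<iota> \<pi>"
    using GC_hereditary_coresolution[OF assms(3) C F.module_axioms _ lin_id lin_id _ D.KH_submodule] by auto
  note K = D.relations_fin_gen[OF this]
  \<comment> \<open>\<open>mod_hom\<close> wants maps that are undefined off the carrier; image and
    kernel stay the same.\<close>
  let ?p = "restrict (free_ext R ?I a) (carrier ?Rn)"
  have "?p \<in> mod_hom R ?Rn ?I" by (rule lin_restrict[OF p mRn])
  moreover have "?p ` carrier ?Rn = carrier ?I" using a_gen by simp
  moreover have "{x \<in> carrier ?Rn. ?p x = \<zero>\<^bsub>?I\<^esub>} = {x \<in> carrier ?Rn. free_ext R ?I a x = \<zero>\<^bsub>?I\<^esub>}" by auto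
  ultimately show "fin_presented R ?I"
    unfolding fin_presented_def using K by (intro exI[of _ n] exI[of _ ?p]) simp
qed

end
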